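(* Let $X$ be a variety over $k$. Let $\sim$ be the equivalence relation on the set of points of $X$ defined by: $x\sim y$ if and only if the local rings of $X$ at $x$ and $y$ are $k$-isomorphic. If there is a finite equivalence class of $\sim$, then $\mathrm{Aut}(X)$ is a Jordan group.
   Context: $k$ is an algebraically closed field of characteristic zero; variety means algebraic variety over $k$, and points are closed points. $\mathrm{Aut}(X)$ is the automorphism group of $X$. A group $G$ is called a Jordan group if there exists a positive integer $J_G$, depending only on $G$, such that every finite subgroup $K$ of $G$ contains a normal (in $K$) abelian subgroup whose index in $K$ is at most $J_G$. *)

theory Defs
  imports
    "HOL-Computational_Algebra.Polynomial"
    "HOL-Analysis.Abstract_Topology"
    "HOL-Algebra.QuotRing"
    "HOL-Algebra.Bij"
begin

section \<open>Spaces with functions\<close>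

text \<open>
  A variety is taken in the sense of Serre: a topological space (of closed points) together with
  a sheaf of \<open>k\<close>-valued functions that is locally isomorphic to an affine algebraic set.
  A function on an open set \<open>U\<close> is represented by a total function; only its values on \<open>U\<close>
  matter (\<open>regular_cong\<close>).  \<open>regular X U\<close> is meaningful only for open \<open>U\<close>.
\<close>

record ('a, 'k) fn_space =
  space_top :: "'a topology"
  regular :: "'a set \<Rightarrow> ('a \<Rightarrow> 'k) set"

abbreviation points :: "('a, 'k, 'z) fn_space_scheme \<Rightarrow> 'a set" where
  "points X \<equiv> topspace (space_top X)"

locale space_with_functions =
  fixes X :: "('a, 'k::field) fn_space"
  assumes regular_cong:
      "\<lbrakk>openin (space_top X) U; f \<in> regular X U; \<And>x. x \<in> U \<Longrightarrow> g x = f x\<rbrakk> \<Longrightarrow> g \<in> regular X U"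
    and regular_const: "openin (space_top X) U \<Longrightarrow> (\<lambda>_. c) \<in> regular X U"
    and regular_add:
      "\<lbrakk>openin (space_top X) U; f \<in> regular X U; g \<in> regular X U\<rbrakk>
        \<Longrightarrow> (\<lambda>x. f x + g x) \<in> regular X U"
    and regular_mult:
      "\<lbrakk>openin (space_top X) U; f \<in> regular X U; g \<in> regular X U\<rbrakk>
        \<Longrightarrow> (\<lambda>x. f x * g x) \<in> regular X U"
    and regular_subset:
      "\<lbrakk>openin (space_top X) U; openin (space_top X) V; V \<subseteq> U; f \<in> regular X U\<rbrakk>
        \<Longrightarrow> f \<in> regular X V"
    and regular_glue:
      "\<lbrakk>openin (space_top X) U;
        \<And>x. x \<in> U \<Longrightarrow> \<exists>V. openin (space_top X) V \<and> x \<in> V \<and> V \<subseteq> U \<and> f \<in> regular X V\<rbrakk>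
        \<Longrightarrow> f \<in> regular X U"

definition morphism :: "('a, 'k) fn_space \<Rightarrow> ('b, 'k) fn_space \<Rightarrow> ('a \<Rightarrow> 'b) \<Rightarrow> bool" where
  "morphism X Y \<phi> \<longleftrightarrow>
     continuous_map (space_top X) (space_top Y) \<phi> \<and>
     (\<forall>V f. openin (space_top Y) V \<and> f \<in> regular Y V
        \<longrightarrow> f \<circ> \<phi> \<in> regular X {x \<in> points X. \<phi> x \<in> V})"

definition isomorphism :: "('a, 'k) fn_space \<Rightarrow> ('b, 'k) fn_space \<Rightarrow> ('a \<Rightarrow> 'b) \<Rightarrow> bool" where
  "isomorphism X Y \<phi> \<longleftrightarrow>
     morphism X Y \<phi> \<and>
     (\<exists>\<psi>. morphism Y X \<psi> \<and> (\<forall>x \<in> points X. \<psi> (\<phi> x) = x) \<and> (\<forall>y \<in> points Y. \<phi> (\<psi> y) = y))"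

definition open_subspace :: "('a, 'k) fn_space \<Rightarrow> 'a set \<Rightarrow> ('a, 'k) fn_space" where
  "open_subspace X U = \<lparr>space_top = subtopology (space_top X) U, regular = regular X\<rparr>"


section \<open>Affine algebraic sets\<close>

text \<open>
  A point of affine \<open>n\<close>-space is a coordinate function on \<open>{..<n}\<close>, extended by \<open>undefined\<close>.
  Polynomials enter only through the functions they define, that is, as the \<open>k\<close>-algebra of
  functions generated by the coordinates.
\<close>

definition affine_space :: "nat \<Rightarrow> (nat \<Rightarrow> 'k) set" where
  "affine_space n = {..<n} \<rightarrow>\<^sub>E UNIV"

inductive_set poly_functions :: "nat \<Rightarrow> ((nat \<Rightarrow> 'k::field) \<Rightarrow> 'k) set" for n where
  const: "(\<lambda>_. c) \<in> poly_functions n"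
| coord: "i < n \<Longrightarrow> (\<lambda>x. x i) \<in> poly_functions n"
| add: "\<lbrakk>p \<in> poly_functions n; q \<in> poly_functions n\<rbrakk> \<Longrightarrow> (\<lambda>x. p x + q x) \<in> poly_functions n"
| mult: "\<lbrakk>p \<in> poly_functions n; q \<in> poly_functions n\<rbrakk> \<Longrightarrow> (\<lambda>x. p x * q x) \<in> poly_functions n"

definition zero_locus :: "nat \<Rightarrow> ((nat \<Rightarrow> 'k::field) \<Rightarrow> 'k) set \<Rightarrow> (nat \<Rightarrow> 'k) set" where
  "zero_locus n P = {x \<in> affine_space n. \<forall>p \<in> P. p x = 0}"

definition algebraic_set :: "nat \<Rightarrow> (nat \<Rightarrow> 'k::field) set \<Rightarrow> bool" where
  "algebraic_set n V \<longleftrightarrow> (\<exists>P \<subseteq> poly_functions n. V = zero_locus n P)"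

definition zariski_topology :: "nat \<Rightarrow> (nat \<Rightarrow> 'k::field) topology" where
  "zariski_topology n =
     topology (\<lambda>U. U \<subseteq> affine_space n \<and> algebraic_set n (affine_space n - U))"

lemma istopology_zariski:
  "istopology (\<lambda>U. U \<subseteq> affine_space n \<and> algebraic_set n (affine_space n - U :: (nat \<Rightarrow> 'k::field) set))"
  unfolding istopology_def
proof (intro conjI allI impI)
  fix U V :: "(nat \<Rightarrow> 'k) set"
  assume "U \<subseteq> affine_space n \<and> algebraic_set n (affine_space n - U)"
     and "V \<subseteq> affine_space n \<and> algebraic_set n (affine_space n - V)"
  then obtain P Q where U: "U \<subseteq> affine_space n" and
      P: "P \<subseteq> poly_functions n" "affine_space n - U = zero_locus n P" and
      Q: "Q \<subseteq> poly_functions n" "affine_space n - V = zero_locus n Q"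
    unfolding algebraic_set_def by blast
  show "U \<inter> V \<subseteq> affine_space n" using U by blast
  let ?R = "{\<lambda>x. p x * q x | p q. p \<in> P \<and> q \<in> Q}"
  have "affine_space n - U \<inter> V = zero_locus n P \<union> zero_locus n Q"
    using P Q by blast
  also have "\<dots> = zero_locus n ?R"
    by (fastforce simp: zero_locus_def)
  finally have "affine_space n - U \<inter> V = zero_locus n ?R" .
  moreover have "?R \<subseteq> poly_functions n"
    using P(1) Q(1) by (auto intro: poly_functions.mult)
  ultimately show "algebraic_set n (affine_space n - U \<inter> V)"
    unfolding algebraic_set_def by blast
next
  fix \<K> :: "(nat \<Rightarrow> 'k) set set"
  assume K: "\<forall>U \<in> \<K>. U \<subseteq> affine_space n \<and> algebraic_set n (affine_space n - U)"
  then show "\<Union>\<K> \<subseteq> affine_space n" by blast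
  from K obtain P where P: "\<And>U. U \<in> \<K> \<Longrightarrow> P U \<subseteq> poly_functions n \<and> affine_space n - U = zero_locus n (P U)"
    unfolding algebraic_set_def by metis
  have "affine_space n - \<Union>\<K> = {x \<in> affine_space n. \<forall>U \<in> \<K>. x \<in> affine_space n - U}"
    by blast
  also have "\<dots> = {x \<in> affine_space n. \<forall>U \<in> \<K>. x \<in> zero_locus n (P U)}"
    using P by auto
  also have "\<dots> = zero_locus n (\<Union>(P ` \<K>))"
    by (auto simp: zero_locus_def)
  finally have "affine_space n - \<Union>\<K> = zero_locus n (\<Union>(P ` \<K>))" .
  moreover have "\<Union>(P ` \<K>) \<subseteq> poly_functions n"
    using P by (simp add: UN_least)
  ultimately show "algebraic_set n (affine_space n - \<Union>\<K>)"
    unfolding algebraic_set_def by (intro exI[of _ "\<Union>(P ` \<K>)"] conjI)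
qed

lemma openin_zariski_topology:
  "openin (zariski_topology n) U \<longleftrightarrow> U \<subseteq> affine_space n \<and> algebraic_set n (affine_space n - U)"
  unfolding zariski_topology_def using topology_inverse'[OF istopology_zariski] by metis

definition affine_variety :: "nat \<Rightarrow> (nat \<Rightarrow> 'k::field) set \<Rightarrow> (nat \<Rightarrow> 'k, 'k) fn_space" where
  "affine_variety n V =
     \<lparr>space_top = subtopology (zariski_topology n) V,
      regular = (\<lambda>U. {f. \<forall>x \<in> U. \<exists>W p q.
         openin (subtopology (zariski_topology n) V) W \<and> x \<in> W \<and> W \<subseteq> U \<and>
         p \<in> poly_functions n \<and> q \<in> poly_functions n \<and>
         (\<forall>y \<in> W. q y \<noteq> 0 \<and> f y = p y / q y)})\<rparr>"


lemma topspace_zariski_topology: "topspace (zariski_topology n) = affine_space n"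
proof -
  have "algebraic_set n {}"
    unfolding algebraic_set_def zero_locus_def
    by (rule exI[of _ "{\<lambda>_. 1}"]) (auto intro: poly_functions.const)
  then have "openin (zariski_topology n) (affine_space n)"
    by (simp add: openin_zariski_topology)
  then show ?thesis
    using openin_zariski_topology openin_subset openin_topspace by (metis subset_antisym)
qed

lemma space_with_functions_affine_variety:
  fixes V :: "(nat \<Rightarrow> 'k::field) set"
  shows "space_with_functions (affine_variety n V)"
proof -
  let ?T = "subtopology (zariski_topology n) V"
  have top: "space_top (affine_variety n V) = ?T" by (simp add: affine_variety_def)
  have iff: "f \<in> regular (affine_variety n V) U \<longleftrightarrow> (\<forall>x \<in> U. \<exists>W p q. openin ?T W \<and> x \<in> W \<and>
      W \<subseteq> U \<and> p \<in> poly_functions n \<and> q \<in> poly_functions n \<and>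
      (\<forall>y \<in> W. q y \<noteq> 0 \<and> f y = p y / q y))" for f U
    by (simp add: affine_variety_def)
  have comb: "\<exists>W p q. openin ?T W \<and> x \<in> W \<and> W \<subseteq> U \<and> p \<in> poly_functions n \<and>
         q \<in> poly_functions n \<and> (\<forall>y \<in> W. q y \<noteq> 0 \<and> h y = p y / q y)"
    if f: "f \<in> regular (affine_variety n V) U" and g: "g \<in> regular (affine_variety n V) U"
      and x: "x \<in> U" and h: "h = (\<lambda>x. f x + g x) \<or> h = (\<lambda>x. f x * g x)" for U f g h x
  proof -
    from f x obtain W1 p1 q1 where 1: "openin ?T W1" "x \<in> W1" "W1 \<subseteq> U" "p1 \<in> poly_functions n"
        "q1 \<in> poly_functions n" "\<forall>y \<in> W1. q1 y \<noteq> 0 \<and> f y = p1 y / q1 y"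
      unfolding iff by meson
    from g x obtain W2 p2 q2 where 2: "openin ?T W2" "x \<in> W2" "W2 \<subseteq> U" "p2 \<in> poly_functions n"
        "q2 \<in> poly_functions n" "\<forall>y \<in> W2. q2 y \<noteq> 0 \<and> g y = p2 y / q2 y"
      unfolding iff by meson
    let ?q = "\<lambda>x. q1 x * q2 x"
    have q: "?q \<in> poly_functions n" using 1 2 by (auto intro: poly_functions.mult)
    from h show ?thesis
    proof
      assume h: "h = (\<lambda>x. f x + g x)"
      have "(\<lambda>x. p1 x * q2 x + p2 x * q1 x) \<in> poly_functions n"
        using 1 2 by (intro poly_functions.add poly_functions.mult)
      moreover have "\<forall>y \<in> W1 \<inter> W2. ?q y \<noteq> 0 \<and> h y = (p1 y * q2 y + p2 y * q1 y) / ?q y"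
        using 1 2 h by (auto simp: field_simps)
      ultimately show ?thesis
                  using q 1 2 by (intro exI[of _ "W1 \<inter> W2"] exI[of _ "\<lambda>x. p1 x * q2 x + p2 x * q1 x"] exI[of _ ?q]) auto
    next
      assume h: "h = (\<lambda>x. f x * g x)"
      have "(\<lambda>x. p1 x * p2 x) \<in> poly_functions n"
        using 1 2 by (intro poly_functions.mult)
      moreover have "\<forall>y \<in> W1 \<inter> W2. ?q y \<noteq> 0 \<and> h y = (p1 y * p2 y) / ?q y"
        using 1 2 h by auto
      ultimately show ?thesis
                  using q 1 2 by (intro exI[of _ "W1 \<inter> W2"] exI[of _ "\<lambda>x. p1 x * p2 x"] exI[of _ ?q]) auto
    qed
  qed
  show ?thesis
  proof (unfold_locales, unfold top)
    fix U f g assume f: "f \<in> regular (affine_variety n V) U" and g: "\<And>x. x \<in> U \<Longrightarrow> g x = f x"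
    show "g \<in> regular (affine_variety n V) U"
      unfolding iff
    proof
      fix x assume "x \<in> U"
      with f obtain W p q where W: "openin ?T W" "x \<in> W" "W \<subseteq> U" "p \<in> poly_functions n"
          "q \<in> poly_functions n" "\<forall>y \<in> W. q y \<noteq> 0 \<and> f y = p y / q y"
        unfolding iff by meson
      then have "\<forall>y \<in> W. q y \<noteq> 0 \<and> g y = p y / q y"
        using g by auto
      with W show "\<exists>W p q. openin ?T W \<and> x \<in> W \<and> W \<subseteq> U \<and> p \<in> poly_functions n \<and>
          q \<in> poly_functions n \<and> (\<forall>y \<in> W. q y \<noteq> 0 \<and> g y = p y / q y)"
        by (intro exI[of _ W] exI[of _ p] exI[of _ q]) simp
    qed
  next
    fix U and c :: 'k assume U: "openin ?T U"
    show "(\<lambda>_. c) \<in> regular (affine_variety n V) U"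
      unfolding iff
    proof
      fix x assume "x \<in> U"
      with U show "\<exists>W p q. openin ?T W \<and> x \<in> W \<and> W \<subseteq> U \<and> p \<in> poly_functions n \<and>
          q \<in> poly_functions n \<and> (\<forall>y \<in> W. q y \<noteq> 0 \<and> c = p y / q y)"
        by (intro exI[of _ U] exI[of _ "\<lambda>_. c"] exI[of _ "\<lambda>_. 1"]) (simp add: poly_functions.const)
    qed
  next
    fix U f g assume "f \<in> regular (affine_variety n V) U" "g \<in> regular (affine_variety n V) U"
    from comb[OF this] show "(\<lambda>x. f x + g x) \<in> regular (affine_variety n V) U"
      unfolding iff by simp
  next
    fix U f g assume "f \<in> regular (affine_variety n V) U" "g \<in> regular (affine_variety n V) U"
    from comb[OF this] show "(\<lambda>x. f x * g x) \<in> regular (affine_variety n V) U"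
      unfolding iff by simp
  next
    fix U U' f assume U': "openin ?T U'" "U' \<subseteq> U" and f: "f \<in> regular (affine_variety n V) U"
    show "f \<in> regular (affine_variety n V) U'"
      unfolding iff
    proof
      fix x assume x: "x \<in> U'"
      with U' have "x \<in> U" by blast
      with f obtain W p q where W: "openin ?T W" "x \<in> W" "p \<in> poly_functions n"
          "q \<in> poly_functions n" "\<forall>y \<in> W. q y \<noteq> 0 \<and> f y = p y / q y"
        unfolding iff by meson
      with x U' show "\<exists>W p q. openin ?T W \<and> x \<in> W \<and> W \<subseteq> U' \<and> p \<in> poly_functions n \<and>
          q \<in> poly_functions n \<and> (\<forall>y \<in> W. q y \<noteq> 0 \<and> f y = p y / q y)"
        by (intro exI[of _ "W \<inter> U'"] exI[of _ p] exI[of _ q]) auto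
    qed
  next
    fix U f assume loc: "\<And>x. x \<in> U \<Longrightarrow> \<exists>W. openin ?T W \<and> x \<in> W \<and> W \<subseteq> U \<and>
        f \<in> regular (affine_variety n V) W"
    show "f \<in> regular (affine_variety n V) U"
      unfolding iff
    proof
      fix x assume "x \<in> U"
      from loc[OF this] obtain U' where U': "x \<in> U'" "U' \<subseteq> U" "f \<in> regular (affine_variety n V) U'"
        by blast
      then obtain W p q where W: "openin ?T W" "x \<in> W" "W \<subseteq> U'" "p \<in> poly_functions n"
          "q \<in> poly_functions n" "\<forall>y \<in> W. q y \<noteq> 0 \<and> f y = p y / q y"
        unfolding iff by meson
      with U'(2) show "\<exists>W p q. openin ?T W \<and> x \<in> W \<and> W \<subseteq> U \<and> p \<in> poly_functions n \<and>
          q \<in> poly_functions n \<and> (\<forall>y \<in> W. q y \<noteq> 0 \<and> f y = p y / q y)"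
        by (intro exI[of _ W] exI[of _ p] exI[of _ q]) auto
    qed
  qed
qed


section \<open>Varieties\<close>

definition affine_open :: "('a, 'k::field) fn_space \<Rightarrow> 'a set \<Rightarrow> bool" where
  "affine_open X U \<longleftrightarrow>
     openin (space_top X) U \<and>
     (\<exists>n V \<phi>. algebraic_set n V \<and> isomorphism (open_subspace X U) (affine_variety n V) \<phi>)"

text \<open>
  The topology of the product variety \<open>X \<times> Y\<close>, which is finer than the product topology.
  On affine opens \<open>U \<subseteq> X\<close>, \<open>V \<subseteq> Y\<close> the regular functions on \<open>U \<times> V\<close> are the sums
  \<open>\<Sum>i. f\<^sub>i \<otimes> g\<^sub>i\<close>, so the sets where such a sum does not vanish form a base.
\<close>

definition zariski_product ::
    "('a, 'k::field) fn_space \<Rightarrow> ('b, 'k) fn_space \<Rightarrow> ('a \<times> 'b) topology" where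
  "zariski_product X Y = topology_generated_by
     {{(x, y) \<in> U \<times> V. (\<Sum>i<m. f i x * g i y) \<noteq> 0} | U V f g (m::nat).
        openin (space_top X) U \<and> openin (space_top Y) V \<and>
        (\<forall>i<m. f i \<in> regular X U) \<and> (\<forall>i<m. g i \<in> regular Y V)}"

definition separated :: "('a, 'k::field) fn_space \<Rightarrow> bool" where
  "separated X \<longleftrightarrow> closedin (zariski_product X X) {(x, x) | x. x \<in> points X}"

text \<open>
  Varieties are irreducible.  For a reducible \<open>X\<close>, fixing a point does not control the action of
  an automorphism on the components away from that point.
\<close>

definition irreducible_space :: "'a topology \<Rightarrow> bool" where
  "irreducible_space T \<longleftrightarrow>
     topspace T \<noteq> {} \<and>
     (\<forall>C D. closedin T C \<and> closedin T D \<and> topspace T = C \<union> D \<longrightarrow> C = topspace T \<or> D = topspace T)"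

locale variety = space_with_functions X
  for X :: "('a, 'k::field) fn_space" +
  assumes finite_affine_cover: "\<exists>\<U>. finite \<U> \<and> (\<forall>U \<in> \<U>. affine_open X U) \<and> \<Union>\<U> = points X"
    and separated: "separated X"
    and irreducible: "irreducible_space (space_top X)"


section \<open>Local rings\<close>

definition local_sections :: "('a, 'k) fn_space \<Rightarrow> 'a \<Rightarrow> ('a set \<times> ('a \<Rightarrow> 'k)) set" where
  "local_sections X x = {(U, f). openin (space_top X) U \<and> x \<in> U \<and> f \<in> regular X U}"

definition germ_rel ::
    "('a, 'k) fn_space \<Rightarrow> 'a \<Rightarrow> (('a set \<times> ('a \<Rightarrow> 'k)) \<times> ('a set \<times> ('a \<Rightarrow> 'k))) set" where
  "germ_rel X x = {((U, f), (V, g)).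
     (U, f) \<in> local_sections X x \<and> (V, g) \<in> local_sections X x \<and>
     (\<exists>W. openin (space_top X) W \<and> x \<in> W \<and> W \<subseteq> U \<inter> V \<and> (\<forall>y \<in> W. f y = g y))}"

definition germ ::
    "('a, 'k) fn_space \<Rightarrow> 'a \<Rightarrow> 'a set \<Rightarrow> ('a \<Rightarrow> 'k) \<Rightarrow> ('a set \<times> ('a \<Rightarrow> 'k)) set" where
  "germ X x U f = germ_rel X x `` {(U, f)}"

definition const_germ ::
    "('a, 'k) fn_space \<Rightarrow> 'a \<Rightarrow> 'k \<Rightarrow> ('a set \<times> ('a \<Rightarrow> 'k)) set" where
  "const_germ X x c = germ X x (points X) (\<lambda>_. c)"

definition local_ring ::
    "('a, 'k::field) fn_space \<Rightarrow> 'a \<Rightarrow> ('a set \<times> ('a \<Rightarrow> 'k)) set ring" where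
  "local_ring X x =
     \<lparr>carrier = local_sections X x // germ_rel X x,
      mult = (\<lambda>A B. \<Union>(U, f) \<in> A. \<Union>(V, g) \<in> B. germ X x (U \<inter> V) (\<lambda>y. f y * g y)),
      one = const_germ X x 1,
      zero = const_germ X x 0,
      add = (\<lambda>A B. \<Union>(U, f) \<in> A. \<Union>(V, g) \<in> B. germ X x (U \<inter> V) (\<lambda>y. f y + g y))\<rparr>"

context space_with_functions
begin

lemma germ_rel_iff:
  "(a, b) \<in> germ_rel X x \<longleftrightarrow> a \<in> local_sections X x \<and> b \<in> local_sections X x \<and>
     (\<exists>W. openin (space_top X) W \<and> x \<in> W \<and> W \<subseteq> fst a \<inter> fst b \<and> (\<forall>y \<in> W. snd a y = snd b y))"
  by (simp add: germ_rel_def split_beta)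

lemma germ_rel_equiv: "equiv (local_sections X x) (germ_rel X x)"
proof (rule equivI)
  show "germ_rel X x \<subseteq> local_sections X x \<times> local_sections X x"
    unfolding germ_rel_def by blast
  show "refl_on (local_sections X x) (germ_rel X x)"
  proof (rule refl_onI)
    fix a assume "a \<in> local_sections X x"
    then show "(a, a) \<in> germ_rel X x"
      unfolding germ_rel_iff by (intro conjI exI[of _ "fst a"]) (auto simp: local_sections_def)
  qed
  show "sym (germ_rel X x)"
  proof (rule symI)
    fix a b assume "(a, b) \<in> germ_rel X x"
    then show "(b, a) \<in> germ_rel X x"
      unfolding germ_rel_iff by (metis Int_commute)
  qed
  show "trans (germ_rel X x)"
  proof (rule transI)
    fix a b c assume "(a, b) \<in> germ_rel X x" "(b, c) \<in> germ_rel X x"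
    then obtain W1 W2 where "a \<in> local_sections X x" "c \<in> local_sections X x"
        "openin (space_top X) W1" "x \<in> W1" "W1 \<subseteq> fst a \<inter> fst b" "\<forall>y \<in> W1. snd a y = snd b y"
        "openin (space_top X) W2" "x \<in> W2" "W2 \<subseteq> fst b \<inter> fst c" "\<forall>y \<in> W2. snd b y = snd c y"
      unfolding germ_rel_iff by (elim conjE exE) (rule that)
    then show "(a, c) \<in> germ_rel X x"
      unfolding germ_rel_iff by (intro conjI exI[of _ "W1 \<inter> W2"]) auto
  qed
qed

lemma germ_eq_iff:
  assumes "(U, f) \<in> local_sections X x" "(V, g) \<in> local_sections X x"
  shows "germ X x U f = germ X x V g \<longleftrightarrow>
    (\<exists>W. openin (space_top X) W \<and> x \<in> W \<and> W \<subseteq> U \<inter> V \<and> (\<forall>y \<in> W. f y = g y))"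
proof -
  have "germ X x U f = germ X x V g \<longleftrightarrow> ((U, f), (V, g)) \<in> germ_rel X x"
    unfolding germ_def using eq_equiv_class_iff[OF germ_rel_equiv assms] .
  then show ?thesis using assms by (simp add: germ_rel_def)
qed

lemma germ_in_carrier:
  "(U, f) \<in> local_sections X x \<Longrightarrow> germ X x U f \<in> carrier (local_ring X x)"
  by (simp add: germ_def local_ring_def quotientI)

lemma carrier_local_ringE:
  assumes "A \<in> carrier (local_ring X x)"
  obtains U f where "(U, f) \<in> local_sections X x" "A = germ X x U f"
  using assms unfolding local_ring_def germ_def by (auto elim!: quotientE)

lemma local_sections_add:
  "\<lbrakk>(U, f) \<in> local_sections X x; (V, g) \<in> local_sections X x\<rbrakk>
    \<Longrightarrow> (U \<inter> V, \<lambda>y. f y + g y) \<in> local_sections X x"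
  unfolding local_sections_def
  by (auto intro!: regular_add intro: regular_subset[of U "U \<inter> V"] regular_subset[of V "U \<inter> V"])

lemma local_sections_mult:
  "\<lbrakk>(U, f) \<in> local_sections X x; (V, g) \<in> local_sections X x\<rbrakk>
    \<Longrightarrow> (U \<inter> V, \<lambda>y. f y * g y) \<in> local_sections X x"
  unfolding local_sections_def
  by (auto intro!: regular_mult intro: regular_subset[of U "U \<inter> V"] regular_subset[of V "U \<inter> V"])

lemma local_sections_const:
  "x \<in> points X \<Longrightarrow> (points X, \<lambda>_. c) \<in> local_sections X x"
  by (simp add: local_sections_def regular_const)

lemma germ_op:
  fixes op :: "'k \<Rightarrow> 'k \<Rightarrow> 'k"
  assumes op: "\<And>U f V g. \<lbrakk>(U, f) \<in> local_sections X x; (V, g) \<in> local_sections X x\<rbrakk>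
      \<Longrightarrow> (U \<inter> V, \<lambda>y. op (f y) (g y)) \<in> local_sections X x"
    and U: "(U, f) \<in> local_sections X x" and V: "(V, g) \<in> local_sections X x"
  shows "(\<Union>(U', f') \<in> germ X x U f. \<Union>(V', g') \<in> germ X x V g. germ X x (U' \<inter> V') (\<lambda>y. op (f' y) (g' y)))
       = germ X x (U \<inter> V) (\<lambda>y. op (f y) (g y))"
proof -
  have eq: "germ X x (U' \<inter> V') (\<lambda>y. op (f' y) (g' y)) = germ X x (U \<inter> V) (\<lambda>y. op (f y) (g y))"
    if "(U', f') \<in> germ X x U f" "(V', g') \<in> germ X x V g" for U' f' V' g'
  proof -
    from that obtain W1 W2 where
        s: "(U', f') \<in> local_sections X x" "(V', g') \<in> local_sections X x"
        and W: "openin (space_top X) W1" "x \<in> W1" "W1 \<subseteq> U \<inter> U'" "\<forall>y \<in> W1. f y = f' y"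
        "openin (space_top X) W2" "x \<in> W2" "W2 \<subseteq> V \<inter> V'" "\<forall>y \<in> W2. g y = g' y"
      unfolding germ_def germ_rel_def by auto
    show ?thesis
      unfolding germ_eq_iff[OF op[OF s] op[OF U V]]
      using W by (intro exI[of _ "W1 \<inter> W2"]) auto
  qed
  have ne: "(U, f) \<in> germ X x U f" "(V, g) \<in> germ X x V g"
    unfolding germ_def using equiv_class_self[OF germ_rel_equiv] U V by auto
  have "(\<Union>(U', f') \<in> germ X x U f. \<Union>(V', g') \<in> germ X x V g. germ X x (U' \<inter> V') (\<lambda>y. op (f' y) (g' y)))
      = (\<Union>a \<in> germ X x U f. \<Union>b \<in> germ X x V g. germ X x (U \<inter> V) (\<lambda>y. op (f y) (g y)))"
    by (intro SUP_cong refl) (auto simp: eq split: prod.splits)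
  then show ?thesis using ne by auto
qed

lemma germ_add:
  "\<lbrakk>(U, f) \<in> local_sections X x; (V, g) \<in> local_sections X x\<rbrakk> \<Longrightarrow>
    germ X x U f \<oplus>\<^bsub>local_ring X x\<^esub> germ X x V g = germ X x (U \<inter> V) (\<lambda>y. f y + g y)"
  unfolding local_ring_def using germ_op[OF local_sections_add] by simp

lemma germ_mult:
  "\<lbrakk>(U, f) \<in> local_sections X x; (V, g) \<in> local_sections X x\<rbrakk> \<Longrightarrow>
    germ X x U f \<otimes>\<^bsub>local_ring X x\<^esub> germ X x V g = germ X x (U \<inter> V) (\<lambda>y. f y * g y)"
  unfolding local_ring_def using germ_op[OF local_sections_mult] by simp

lemma germ_eqI:
  assumes "(U, f) \<in> local_sections X x" "(V, g) \<in> local_sections X x"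
    and "\<And>y. y \<in> U \<inter> V \<Longrightarrow> f y = g y"
  shows "germ X x U f = germ X x V g"
  unfolding germ_eq_iff[OF assms(1,2)]
  using assms by (intro exI[of _ "U \<inter> V"]) (auto simp: local_sections_def)

lemma cring_local_ring:
  assumes x: "x \<in> points X"
  shows "cring (local_ring X x)"
proof -
  note c = local_sections_const[OF x]
  note s = local_sections_add local_sections_mult c
  have z: "\<zero>\<^bsub>local_ring X x\<^esub> = germ X x (points X) (\<lambda>_. 0)"
    and o: "\<one>\<^bsub>local_ring X x\<^esub> = germ X x (points X) (\<lambda>_. 1)"
    by (simp_all add: local_ring_def const_germ_def)
  show ?thesis
  proof (intro cringI abelian_groupI comm_monoidI)
    fix A assume "A \<in> carrier (local_ring X x)"
    then obtain U f where A: "(U, f) \<in> local_sections X x" "A = germ X x U f"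
      by (rule carrier_local_ringE)
    have n: "(points X \<inter> U, \<lambda>y. -1 * f y) \<in> local_sections X x"
      by (rule local_sections_mult[OF c A(1)])
    show "\<exists>B \<in> carrier (local_ring X x). B \<oplus>\<^bsub>local_ring X x\<^esub> A = \<zero>\<^bsub>local_ring X x\<^esub>"
      unfolding A(2) z
      by (rule bexI[OF _ germ_in_carrier[OF n]])
        (subst germ_add[OF n A(1)], rule germ_eqI, rule local_sections_add[OF n A(1)], rule c, simp)
  qed (((elim carrier_local_ringE)?, hypsubst?, simp only: z o germ_add germ_mult s,
        rule germ_in_carrier germ_eqI; (intro s; assumption)?; (simp add: algebra_simps)?)+)
qed

end

definition local_rings_k_isomorphic :: "('a, 'k::field) fn_space \<Rightarrow> 'a \<Rightarrow> 'a \<Rightarrow> bool" where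
  "local_rings_k_isomorphic X x y \<longleftrightarrow>
     (\<exists>h \<in> ring_iso (local_ring X x) (local_ring X y). \<forall>c. h (const_germ X x c) = const_germ X y c)"

definition same_local_ring :: "('a, 'k::field) fn_space \<Rightarrow> ('a \<times> 'a) set" where
  "same_local_ring X =
     {(x, y). x \<in> points X \<and> y \<in> points X \<and> local_rings_k_isomorphic X x y}"


lemma (in space_with_functions) equiv_same_local_ring:
  "equiv (points X) (same_local_ring X)"
proof (rule equivI)
  show "same_local_ring X \<subseteq> points X \<times> points X"
    by (auto simp: same_local_ring_def)
  have "id \<in> ring_iso R R" for R :: "('a set \<times> ('a \<Rightarrow> 'k)) set ring"
    by (auto simp: ring_iso_def ring_hom_def)
  then show "refl_on (points X) (same_local_ring X)"
    unfolding refl_on_def same_local_ring_def local_rings_k_isomorphic_def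
    by (fastforce intro: bexI[of _ id])
  show "trans (same_local_ring X)"
  proof (rule transI)
    fix x y z assume "(x, y) \<in> same_local_ring X" "(y, z) \<in> same_local_ring X"
    then obtain f g where "x \<in> points X" "z \<in> points X"
        "f \<in> ring_iso (local_ring X x) (local_ring X y)" "\<forall>c. f (const_germ X x c) = const_germ X y c"
        "g \<in> ring_iso (local_ring X y) (local_ring X z)" "\<forall>c. g (const_germ X y c) = const_germ X z c"
      unfolding same_local_ring_def local_rings_k_isomorphic_def by auto
    then show "(x, z) \<in> same_local_ring X"
      unfolding same_local_ring_def local_rings_k_isomorphic_def
      by (auto intro!: bexI[of _ "g \<circ> f"] ring_iso_set_trans)
  qed
  show "sym (same_local_ring X)"
  proof (rule symI)
    fix x y assume "(x, y) \<in> same_local_ring X"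
    then obtain f where x: "x \<in> points X" and y: "y \<in> points X" and
        f: "f \<in> ring_iso (local_ring X x) (local_ring X y)" "\<forall>c. f (const_germ X x c) = const_germ X y c"
      unfolding same_local_ring_def local_rings_k_isomorphic_def by auto
    let ?h = "inv_into (carrier (local_ring X x)) f"
    have h: "?h \<in> ring_iso (local_ring X y) (local_ring X x)"
      using ring_iso_set_sym[OF cring.axioms(1)[OF cring_local_ring[OF x]] f(1)] .
    have "?h (const_germ X y c) = const_germ X x c" for c
    proof -
      have "const_germ X x c \<in> carrier (local_ring X x)"
        unfolding const_germ_def by (rule germ_in_carrier[OF local_sections_const[OF x]])
      moreover have "inj_on f (carrier (local_ring X x))"
        using f(1) by (simp add: ring_iso_def bij_betw_def)
      ultimately show ?thesis using f(2) inv_into_f_f by metis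
    qed
    with x y h show "(y, x) \<in> same_local_ring X"
      unfolding same_local_ring_def local_rings_k_isomorphic_def by blast
  qed
qed


section \<open>Automorphism groups and Jordan groups\<close>

definition Aut :: "('a, 'k) fn_space \<Rightarrow> ('a \<Rightarrow> 'a) monoid" where
  "Aut X = (BijGroup (points X))\<lparr>carrier := {\<sigma> \<in> Bij (points X). isomorphism X X \<sigma>}\<rparr>"

lemma morphism_compose:
  assumes "morphism X Y \<phi>" "morphism Y Z \<psi>"
  shows "morphism X Z (\<psi> \<circ> \<phi>)"
proof -
  have cont: "continuous_map (space_top X) (space_top Y) \<phi>" "continuous_map (space_top Y) (space_top Z) \<psi>"
    using assms by (auto simp: morphism_def)
  show ?thesis
    unfolding morphism_def
  proof (intro conjI allI impI)
    show "continuous_map (space_top X) (space_top Z) (\<psi> \<circ> \<phi>)"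
      using cont by (rule continuous_map_compose)
    fix V f assume V: "openin (space_top Z) V \<and> f \<in> regular Z V"
    let ?W = "{y \<in> points Y. \<psi> y \<in> V}"
    have "openin (space_top Y) ?W"
      using cont(2) V openin_continuous_map_preimage by blast
    moreover have "f \<circ> \<psi> \<in> regular Y ?W"
      using assms(2) V by (auto simp: morphism_def)
    ultimately have "f \<circ> \<psi> \<circ> \<phi> \<in> regular X {x \<in> points X. \<phi> x \<in> ?W}"
      using assms(1) unfolding morphism_def by blast
    moreover have "{x \<in> points X. \<phi> x \<in> ?W} = {x \<in> points X. (\<psi> \<circ> \<phi>) x \<in> V}"
      using cont(1) by (auto simp: continuous_map_def)
    ultimately show "f \<circ> (\<psi> \<circ> \<phi>) \<in> regular X {x \<in> points X. (\<psi> \<circ> \<phi>) x \<in> V}"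
      by (simp add: comp_assoc)
  qed
qed

context space_with_functions
begin

lemma morphism_id: "morphism X X id"
  by (auto simp: morphism_def Collect_conj_eq Int_absorb1 openin_subset)

lemma morphism_cong:
  assumes \<phi>: "morphism X X \<phi>" and eq: "\<And>x. x \<in> points X \<Longrightarrow> \<psi> x = \<phi> x"
  shows "morphism X X \<psi>"
proof -
  have cont: "continuous_map (space_top X) (space_top X) \<phi>"
    using \<phi> by (simp add: morphism_def)
  have "f \<circ> \<psi> \<in> regular X {x \<in> points X. \<psi> x \<in> V}"
    if V: "openin (space_top X) V" "f \<in> regular X V" for V f
  proof -
    have e: "{x \<in> points X. \<psi> x \<in> V} = {x \<in> points X. \<phi> x \<in> V}" using eq by auto
    have "f \<circ> \<phi> \<in> regular X {x \<in> points X. \<phi> x \<in> V}"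
      using \<phi> V by (simp add: morphism_def)
    then show ?thesis
      unfolding e
      by (rule regular_cong[OF openin_continuous_map_preimage[OF cont V(1)]]) (simp add: eq)
  qed
  moreover have "continuous_map (space_top X) (space_top X) \<psi>"
    using cont eq by (metis continuous_map_eq)
  ultimately show ?thesis by (simp add: morphism_def)
qed

lemma group_Aut: "group (Aut X)"
proof -
  let ?S = "points X"
  let ?H = "{\<sigma> \<in> Bij ?S. isomorphism X X \<sigma>}"
  interpret B: group "BijGroup ?S" by (rule group_BijGroup)
  have maps: "\<phi> x \<in> ?S" if "morphism X X \<phi>" "x \<in> ?S" for \<phi> x
    using that by (auto simp: morphism_def continuous_map_def)
  have one: "(\<lambda>x \<in> ?S. x) \<in> ?H"
  proof -
    have "morphism X X (\<lambda>x \<in> ?S. x)" by (rule morphism_cong[OF morphism_id]) simp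
    then show ?thesis
      using morphism_id by (auto simp: id_Bij isomorphism_def intro!: exI[of _ id])
  qed
  have "subgroup ?H (BijGroup ?S)"
  proof (rule B.subgroupI)
    show "?H \<subseteq> carrier (BijGroup ?S)" by (auto simp: BijGroup_def)
    show "?H \<noteq> {}" using one by blast
  next
    fix \<sigma> assume s: "\<sigma> \<in> ?H"
    then obtain \<tau> where t: "morphism X X \<sigma>" "morphism X X \<tau>" "\<forall>x \<in> ?S. \<tau> (\<sigma> x) = x" "\<forall>x \<in> ?S. \<sigma> (\<tau> x) = x"
      by (auto simp: isomorphism_def)
    let ?i = "\<lambda>x \<in> ?S. inv_into ?S \<sigma> x"
    have inj: "inj_on \<sigma> ?S" using s by (auto simp: Bij_def bij_betw_def)
    have i: "?i x = \<tau> x" if "x \<in> ?S" for x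
      using inv_into_f_f[OF inj maps[OF t(2) that]] t(4) that by simp
    have "morphism X X ?i" using morphism_cong[OF t(2) i] .
    then have "isomorphism X X ?i"
      unfolding isomorphism_def using t i maps by (auto intro!: exI[of _ \<sigma>] simp del: restrict_apply)
    moreover have "inv\<^bsub>BijGroup ?S\<^esub> \<sigma> = ?i" using s by (simp add: inv_BijGroup)
    ultimately show "inv\<^bsub>BijGroup ?S\<^esub> \<sigma> \<in> ?H" using s by (simp add: restrict_inv_into_Bij)
  next
    fix \<sigma> \<rho> assume sr: "\<sigma> \<in> ?H" "\<rho> \<in> ?H"
    then obtain \<sigma>' \<rho>' where t: "morphism X X \<sigma>" "morphism X X \<sigma>'"
        "\<forall>x \<in> ?S. \<sigma>' (\<sigma> x) = x" "\<forall>x \<in> ?S. \<sigma> (\<sigma>' x) = x"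
        "morphism X X \<rho>" "morphism X X \<rho>'" "\<forall>x \<in> ?S. \<rho>' (\<rho> x) = x" "\<forall>x \<in> ?S. \<rho> (\<rho>' x) = x"
      by (auto simp: isomorphism_def)
    have "morphism X X (compose ?S \<sigma> \<rho>)"
      by (rule morphism_cong[OF morphism_compose[OF t(5) t(1)]]) (simp add: compose_def)
    moreover have "morphism X X (\<rho>' \<circ> \<sigma>')" by (rule morphism_compose[OF t(2) t(6)])
    ultimately have "isomorphism X X (compose ?S \<sigma> \<rho>)"
      unfolding isomorphism_def using t maps
      by (auto intro!: exI[of _ "\<rho>' \<circ> \<sigma>'"] simp: compose_def)
    then show "\<sigma> \<otimes>\<^bsub>BijGroup ?S\<^esub> \<rho> \<in> ?H"
      using sr by (simp add: BijGroup_def compose_Bij)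
  qed
  then show ?thesis
    unfolding Aut_def by (rule B.subgroup_imp_group)
qed

end

definition jordan_group :: "('g, 'z) monoid_scheme \<Rightarrow> bool" where
  "jordan_group G \<longleftrightarrow>
     group G \<and>
     (\<exists>J::nat. J > 0 \<and>
       (\<forall>K. subgroup K G \<and> finite K \<longrightarrow>
         (\<exists>A. A \<lhd> G\<lparr>carrier := K\<rparr> \<and> comm_group (G\<lparr>carrier := A\<rparr>) \<and>
              card (rcosets\<^bsub>G\<lparr>carrier := K\<rparr>\<^esub> A) \<le> J)))"

end

theory Submission
  imports
    Defs
    Complex_Main
    "HOL-Library.Function_Algebras"
    "HOL-Computational_Algebra.Fundamental_Theorem_Algebra"
    "HOL-Analysis.Continuum_Not_Denumerable"
    "HOL-Algebra.Generated_Groups"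
begin

text \<open>
  An automorphism permutes each class of \<open>\<sim>\<close>, so in a finite group \<open>K\<close> of automorphisms the
  stabilizer \<open>H\<close> of a point \<open>x\<close> of a finite class \<open>C\<close> has index at most the cardinality of \<open>C\<close>.
  The group \<open>H\<close> acts faithfully on the cotangent space at \<open>x\<close>, whose dimension does not depend on
  \<open>K\<close>: an element of finite order that acts trivially there acts trivially modulo every power of
  the maximal ideal (characteristic zero), hence on the local ring (Krull), hence near \<open>x\<close>, hence
  everywhere, because \<open>X\<close> is separated and irreducible.  Jordan's theorem for matrix groups over
  the field, which reduces to the complex numbers because the finitely many matrix entries
  generate a ring that embeds into them, provides an abelian subgroup of \<open>H\<close> of bounded index,
  whose normal core in \<open>K\<close> has bounded index too.

  For a finite complex matrix group, measure the distance to the identity in the operator norm of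
  an invariant norm.  Commutators of elements near the identity are much nearer, and if \<open>a\<close>
  commutes with \<open>c = [a, b]\<close> then \<open>c\<^sup>m = [a\<^sup>m, b]\<close> stays near the identity for all \<open>m\<close>, which
  forces \<open>c = 1\<close>.  Hence elements near the identity commute, and a packing argument bounds the
  index of the subgroup that they generate.
\<close>

section \<open>Noetherian subrings\<close>

text \<open>The bound must be fixed before the finite group is chosen. In the complex case the
  obstacle is that the invariant norm changes with the group, so compactness of the unit ball of one
  fixed norm does not suffice. The packing bound therefore has to hold for all norms on matrices at
  once, and elimination with pivoting gives one that depends only on the number of entries, the
  radius and the separation.

  In the cotangent argument no quotient ring is formed. Germs are total functions compared near
  \<open>x\<close>, and powers of the maximal ideal are described by fractions of polynomials in the
  ambient affine coordinates. For this reason Krull's theorem is proved relative to an ideal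
  \<open>J\<close>, which will consist of the polynomials that vanish on the variety near
  \<open>x\<close>, and its hypothesis and conclusion carry factors that are invertible at the
  point. In the same way the embedding into the complex numbers works with subrings and
  pseudo-division instead of fields of fractions.\<close>

definition unital_subring :: "'r::comm_ring_1 set \<Rightarrow> bool" where
  "unital_subring S \<longleftrightarrow> 1 \<in> S \<and> (\<forall>a \<in> S. \<forall>b \<in> S. a - b \<in> S \<and> a * b \<in> S)"

lemma unital_subringD:
  assumes "unital_subring S"
  shows "1 \<in> S" "0 \<in> S" "a \<in> S \<Longrightarrow> b \<in> S \<Longrightarrow> a - b \<in> S" "a \<in> S \<Longrightarrow> b \<in> S \<Longrightarrow> a * b \<in> S"
    "a \<in> S \<Longrightarrow> - a \<in> S" "a \<in> S \<Longrightarrow> b \<in> S \<Longrightarrow> a + b \<in> S" "a \<in> S \<Longrightarrow> a ^ n \<in> S"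
proof -
  show 1: "1 \<in> S" and d: "a \<in> S \<Longrightarrow> b \<in> S \<Longrightarrow> a - b \<in> S"
    and m: "a \<in> S \<Longrightarrow> b \<in> S \<Longrightarrow> a * b \<in> S" for a b
    using assms by (auto simp: unital_subring_def)
  show 0: "0 \<in> S" using d[OF 1 1] by simp
  show neg: "- a \<in> S" if "a \<in> S" for a using d[OF 0 that] by simp
  show "a + b \<in> S" if "a \<in> S" "b \<in> S" using d[OF that(1) neg[OF that(2)]] by simp
  show "a ^ n \<in> S" if "a \<in> S" using that by (induction n) (auto intro: 1 m)
qed

definition ideal_of :: "'r::comm_ring_1 set \<Rightarrow> 'r set \<Rightarrow> bool" where
  "ideal_of S I \<longleftrightarrow> I \<subseteq> S \<and> 0 \<in> I \<and> (\<forall>a \<in> I. \<forall>b \<in> I. a + b \<in> I) \<and> (\<forall>s \<in> S. \<forall>a \<in> I. s * a \<in> I)"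

lemma ideal_ofD:
  assumes "ideal_of S I"
  shows "a \<in> I \<Longrightarrow> a \<in> S" "0 \<in> I" "a \<in> I \<Longrightarrow> b \<in> I \<Longrightarrow> a + b \<in> I"
    "s \<in> S \<Longrightarrow> a \<in> I \<Longrightarrow> s * a \<in> I"
  using assms by (auto simp: ideal_of_def)

lemma ideal_of_minus:
  assumes S: "unital_subring S" and I: "ideal_of S I" and "a \<in> I"
  shows "- a \<in> I"
  using ideal_ofD(4)[OF I unital_subringD(5)[OF S unital_subringD(1)[OF S]] assms(3)] by simp

lemma ideal_of_diff:
  assumes S: "unital_subring S" and I: "ideal_of S I" and "a \<in> I" "b \<in> I"
  shows "a - b \<in> I"
  using ideal_ofD(3)[OF I assms(3) ideal_of_minus[OF S I assms(4)]] by simp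

text \<open>Rings are subsets of a type: the polynomial functions in any number of variables share
  one type, so the basis theorem can be iterated without changing types.\<close>

definition noetherian_subring :: "'r::comm_ring_1 set \<Rightarrow> bool" where
  "noetherian_subring S \<longleftrightarrow> unital_subring S \<and>
     (\<forall>I::nat \<Rightarrow> 'r set. (\<forall>m. ideal_of S (I m)) \<and> incseq I \<longrightarrow> (\<exists>N. \<forall>m\<ge>N. I m = I N))"

section \<open>Hilbert's basis theorem\<close>

text \<open>Representations as polynomials in \<open>t\<close> need not be unique, as \<open>t\<close> may be algebraic over \<open>R\<close>.\<close>

primrec polys_below :: "'r::comm_ring_1 set \<Rightarrow> 'r \<Rightarrow> nat \<Rightarrow> 'r set" where
  "polys_below R t 0 = {0}"
| "polys_below R t (Suc d) = {c * t ^ d + g | c g. c \<in> R \<and> g \<in> polys_below R t d}"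

definition adjoin :: "'r::comm_ring_1 set \<Rightarrow> 'r \<Rightarrow> 'r set" where
  "adjoin R t = (\<Union>d. polys_below R t d)"

context
  fixes R :: "'r::comm_ring_1 set" and t :: 'r
  assumes R: "unital_subring R"
begin

lemma polys_below_0: "0 \<in> polys_below R t d"
proof (induction d)
  case (Suc d)
  then show ?case using unital_subringD(2)[OF R] by (auto intro!: exI[of _ 0])
qed simp

lemma polys_below_add: "f \<in> polys_below R t d \<Longrightarrow> g \<in> polys_below R t d \<Longrightarrow> f + g \<in> polys_below R t d"
proof (induction d arbitrary: f g)
  case (Suc d)
  from Suc.prems obtain c f' e g' where f: "f = c * t ^ d + f'" "c \<in> R" "f' \<in> polys_below R t d"
    and g: "g = e * t ^ d + g'" "e \<in> R" "g' \<in> polys_below R t d" by auto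
  have "f + g = (c + e) * t ^ d + (f' + g')" by (simp add: f g algebra_simps)
  then show ?case
    using Suc.IH[OF f(3) g(3)] unital_subringD(6)[OF R f(2) g(2)] by auto
qed simp

lemma polys_below_smult: "s \<in> R \<Longrightarrow> f \<in> polys_below R t d \<Longrightarrow> s * f \<in> polys_below R t d"
proof (induction d arbitrary: f)
  case (Suc d)
  from Suc.prems obtain c f' where f: "f = c * t ^ d + f'" "c \<in> R" "f' \<in> polys_below R t d" by auto
  have "s * f = (s * c) * t ^ d + s * f'" by (simp add: f algebra_simps)
  then show ?case
    using Suc.IH[OF Suc.prems(1) f(3)] unital_subringD(4)[OF R Suc.prems(1) f(2)] by auto
qed simp

lemma polys_below_mult_gen: "f \<in> polys_below R t d \<Longrightarrow> t * f \<in> polys_below R t (Suc d)"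
proof (induction d arbitrary: f)
  case 0
  then show ?case using unital_subringD(2)[OF R] by (auto intro!: exI[of _ 0])
next
  case (Suc d)
  from Suc.prems obtain c f' where f: "f = c * t ^ d + f'" "c \<in> R" "f' \<in> polys_below R t d" by auto
  have "t * f = c * t ^ Suc d + t * f'" by (simp add: f algebra_simps)
  then show ?case using Suc.IH[OF f(3)] f(2) polys_below.simps(2)[of R t "Suc d"] by blast
qed

lemma polys_below_Suc: "f \<in> polys_below R t d \<Longrightarrow> f \<in> polys_below R t (Suc d)"
proof -
  assume "f \<in> polys_below R t d"
  then have "\<exists>c g. f = c * t ^ d + g \<and> c \<in> R \<and> g \<in> polys_below R t d"
    using unital_subringD(2)[OF R] by (intro exI[of _ 0] exI[of _ f]) simp
  then show ?thesis by simp
qed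

lemma polys_below_mono: "d \<le> e \<Longrightarrow> f \<in> polys_below R t d \<Longrightarrow> f \<in> polys_below R t e"
  by (induction rule: dec_induct) (auto simp del: polys_below.simps intro: polys_below_Suc)

lemma adjoin_add: "f \<in> adjoin R t \<Longrightarrow> g \<in> adjoin R t \<Longrightarrow> f + g \<in> adjoin R t"
  unfolding adjoin_def
  by (auto intro!: polys_below_add intro: polys_below_mono[OF max.cobounded1] polys_below_mono[OF max.cobounded2])

lemma adjoin_power_mult: "f \<in> adjoin R t \<Longrightarrow> t ^ n * f \<in> adjoin R t"
proof (induction n)
  case (Suc n)
  then show ?case using polys_below_mult_gen by (auto simp: adjoin_def mult.assoc simp del: polys_below.simps)
qed simp

lemma adjoin_smult: "s \<in> R \<Longrightarrow> f \<in> adjoin R t \<Longrightarrow> s * f \<in> adjoin R t"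
  using polys_below_smult by (auto simp: adjoin_def)

lemma adjoin_mult:
  assumes "f \<in> adjoin R t" "g \<in> adjoin R t"
  shows "f * g \<in> adjoin R t"
proof -
  have "f * g \<in> adjoin R t" if "f \<in> polys_below R t d" for d
    using that
  proof (induction d arbitrary: f)
    case 0
    then show ?case using polys_below_0 by (auto simp: adjoin_def)
  next
    case (Suc d)
    then obtain c f' where f: "f = c * t ^ d + f'" "c \<in> R" "f' \<in> polys_below R t d" by auto
    have "f * g = c * (t ^ d * g) + f' * g" by (simp add: f algebra_simps)
    then show ?case
      using Suc.IH[OF f(3)] f(2) assms(2) by (auto intro!: adjoin_add adjoin_smult adjoin_power_mult)
  qed
  then show ?thesis using assms(1) by (auto simp: adjoin_def)
qed

lemma base_subset_adjoin: "R \<subseteq> adjoin R t"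
proof
  fix c assume "c \<in> R"
  then have "c \<in> polys_below R t (Suc 0)" by auto
  then show "c \<in> adjoin R t" unfolding adjoin_def by blast
qed

lemma gen_in_adjoin: "t \<in> adjoin R t"
  using adjoin_power_mult[of 1 1] base_subset_adjoin unital_subringD(1)[OF R] by auto

lemma unital_subring_adjoin: "unital_subring (adjoin R t)"
proof -
  have "- b \<in> adjoin R t" if "b \<in> adjoin R t" for b
    using adjoin_smult[of "-1" b] unital_subringD(5)[OF R unital_subringD(1)[OF R]] that by simp
  then have "a - b \<in> adjoin R t" if "a \<in> adjoin R t" "b \<in> adjoin R t" for a b
    using adjoin_add[of a "-b"] that by simp
  then show ?thesis
    unfolding unital_subring_def
    using base_subset_adjoin unital_subringD(1)[OF R] adjoin_mult by blast
qed

end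

text \<open>The diagonal \<open>L m m\<close> stabilises at some \<open>N\<close>, and each of the
  finitely many chains with fixed \<open>d \<le> N\<close> stabilises by itself. For
  \<open>d > N\<close> monotonicity squeezes \<open>L m d\<close> between \<open>L N N\<close> and a
  later diagonal term, and these are equal.\<close>

lemma incseq_stable:
  assumes "\<And>I. (\<And>m. P (I m)) \<Longrightarrow> incseq I \<Longrightarrow> \<exists>N. \<forall>m\<ge>N. I m = I N"
    and "\<And>m d. P (L m d)" "\<And>m m' d d'. m \<le> m' \<Longrightarrow> d \<le> d' \<Longrightarrow> L m d \<subseteq> L m' d'"
  shows "\<exists>N::nat. \<forall>m\<ge>N. \<forall>d::nat. L m d = L N d"
proof -
  have "\<exists>N. \<forall>m\<ge>N. L m m = L N N"
    using assms by (intro assms(1)) (auto simp: incseq_def)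
  then obtain N where N: "\<And>m. m \<ge> N \<Longrightarrow> L m m = L N N" by blast
  have "\<exists>n. \<forall>m\<ge>n. L m d = L n d" for d
    using assms by (intro assms(1)) (auto simp: incseq_def)
  then obtain n where n: "\<And>m d. m \<ge> n d \<Longrightarrow> L m d = L (n d) d" by metis
  define M where "M = Max (insert N (n ` {..N}))"
  have MN: "M \<ge> N" and Mn: "\<And>d. d \<le> N \<Longrightarrow> M \<ge> n d" 
    unfolding M_def by (simp, intro Max_ge, simp_all)
  have "L m d = L M d" if m: "m \<ge> M" for m d
  proof (cases "d \<le> N")
    case True
    then show ?thesis using n[of d m] n[of d M] Mn[OF True] m by simp
  next
    case False
    have "L N N \<subseteq> L M d" "L M d \<subseteq> L m d" "L m d \<subseteq> L (max m d) (max m d)"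
      using MN m False by (intro assms(3); simp)+
    moreover have "L (max m d) (max m d) = L N N" using N[of "max m d"] MN m by simp
    ultimately show ?thesis by blast
  qed
  then show ?thesis by blast
qed

text \<open>The ideals of leading coefficients stabilise uniformly in the degree. From then on a
  leading term of an element of \<open>I m\<close> can be cancelled by an element of
  \<open>I N\<close>, and the degree drops.\<close>

theorem Hilbert_basis:
  assumes "noetherian_subring R"
  shows "noetherian_subring (adjoin R t)"
proof -
  have R: "unital_subring R"
    and acc: "\<And>I::nat \<Rightarrow> _. (\<And>m. ideal_of R (I m)) \<Longrightarrow> incseq I \<Longrightarrow> \<exists>N. \<forall>m\<ge>N. I m = I N"
    using assms by (auto simp: noetherian_subring_def)
  note [simp del] = polys_below.simps
  have "\<exists>N. \<forall>m\<ge>N. I m = I N" if I: "\<And>m. ideal_of (adjoin R t) (I m)" and inc: "incseq I"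
    for I :: "nat \<Rightarrow> 'a set"
  proof -
    \<comment> \<open>Here \<open>c\<close> leads some presentation, with exponents up to
      \<open>d\<close>, of an element of \<open>I m\<close>. It may be \<open>0\<close>, and another
      presentation of the same element may have another leading coefficient.\<close>
    define L where "L m d = {c \<in> R. \<exists>g \<in> polys_below R t d. c * t ^ d + g \<in> I m}" for m d
    have ideal_L: "ideal_of R (L m d)" for m d
      unfolding ideal_of_def
    proof (intro conjI ballI)
      show "L m d \<subseteq> R" by (auto simp: L_def)
      show "0 \<in> L m d"
        using unital_subringD(2)[OF R] polys_below_0[OF R, of t d] ideal_ofD(2)[OF I]
        by (auto simp: L_def intro!: bexI[of _ 0])
    next
      fix a b assume "a \<in> L m d" "b \<in> L m d"
      then obtain f g where f: "a \<in> R" "f \<in> polys_below R t d" "a * t ^ d + f \<in> I m"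
        and g: "b \<in> R" "g \<in> polys_below R t d" "b * t ^ d + g \<in> I m" by (auto simp: L_def)
      have "(a + b) * t ^ d + (f + g) \<in> I m"
        using ideal_ofD(3)[OF I f(3) g(3)] by (simp add: algebra_simps)
      then show "a + b \<in> L m d"
        unfolding L_def using polys_below_add[OF R f(2) g(2)] unital_subringD(6)[OF R f(1) g(1)] by blast
    next
      fix s a assume s: "s \<in> R" and "a \<in> L m d"
      then obtain f where f: "a \<in> R" "f \<in> polys_below R t d" "a * t ^ d + f \<in> I m" by (auto simp: L_def)
      have "(s * a) * t ^ d + s * f \<in> I m"
        using ideal_ofD(4)[OF I _ f(3), of s] base_subset_adjoin[OF R] s
        by (auto simp: algebra_simps)
      then show "s * a \<in> L m d"
        unfolding L_def using polys_below_smult[OF R s f(2)] unital_subringD(4)[OF R s f(1)] by blast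
    qed
    have mono_d: "L m d \<subseteq> L m (Suc d)" for m d
    proof
      fix c assume "c \<in> L m d"
      then obtain f where f: "c \<in> R" "f \<in> polys_below R t d" "c * t ^ d + f \<in> I m" by (auto simp: L_def)
      have "c * t ^ Suc d + t * f \<in> I m"
        using ideal_ofD(4)[OF I gen_in_adjoin[OF R] f(3)] by (simp add: algebra_simps)
      then show "c \<in> L m (Suc d)"
        unfolding L_def using polys_below_mult_gen[OF R f(2)] f(1) by blast
    qed
    have "L m d \<subseteq> L m' d'" if "m \<le> m'" "d \<le> d'" for m m' d d'
    proof -
      have "L m d \<subseteq> L m d'" using lift_Suc_mono_le[of "L m", OF mono_d that(2)] .
      moreover have "L m d' \<subseteq> L m' d'"
        using incseqD[OF inc that(1)] by (auto simp: L_def)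
      ultimately show ?thesis by blast
    qed
    from incseq_stable[of "ideal_of R" L, OF acc ideal_L this]
    obtain N where N: "\<And>m d. m \<ge> N \<Longrightarrow> L m d = L N d" by blast
    have "I m \<subseteq> I N" if m: "m \<ge> N" for m
    proof -
      \<comment> \<open>Induction on the length of a presentation: \<open>h\<close> completes the
        leading term of \<open>f\<close> to an element of \<open>I N\<close>, and the difference
        \<open>g - h\<close> stays in \<open>I m\<close> but is shorter.\<close>
      have "f \<in> I N" if "f \<in> polys_below R t d" "f \<in> I m" for f d
        using that
      proof (induction d arbitrary: f)
        case 0
        then show ?case using ideal_ofD(2)[OF I] by (simp add: polys_below.simps)
      next
        case (Suc d)
        then obtain c g where f: "f = c * t ^ d + g" "c \<in> R" "g \<in> polys_below R t d"
          by (auto simp: polys_below.simps)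
        with Suc.prems have "c \<in> L m d" unfolding L_def by auto
        then have "c \<in> L N d" using N[OF m] by simp
        then obtain h where h: "h \<in> polys_below R t d" "c * t ^ d + h \<in> I N" by (auto simp: L_def)
        note AS = unital_subring_adjoin[OF R]
        have "g - h \<in> polys_below R t d"
          using polys_below_add[OF R f(3) polys_below_smult[OF R unital_subringD(5)[OF R unital_subringD(1)[OF R]] h(1)]]
          by simp
        moreover have "g - h \<in> I m"
        proof -
          have "c * t ^ d + h \<in> I m" using h(2) incseqD[OF inc m] by blast
          from ideal_of_diff[OF AS I Suc.prems(2) this] show ?thesis by (simp add: f)
        qed
        ultimately have "g - h \<in> I N" by (rule Suc.IH)
        from ideal_ofD(3)[OF I this h(2)] show ?case by (simp add: f algebra_simps)
      qed
      then show ?thesis using ideal_ofD(1)[OF I, of _ m] unfolding adjoin_def by blast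
    qed
    then have "I m = I N" if "m \<ge> N" for m
      using incseqD[OF inc that] that by (intro equalityI) simp_all
    then show ?thesis by blast
  qed
  then show ?thesis
    unfolding noetherian_subring_def using unital_subring_adjoin[OF R] by (intro conjI allI impI) simp_all
qed

section \<open>Krull's intersection theorem\<close>

inductive_set ideal_prod :: "'r::comm_ring_1 set \<Rightarrow> 'r set \<Rightarrow> 'r set" for A B where
  zero: "0 \<in> ideal_prod A B"
| step: "a \<in> A \<Longrightarrow> b \<in> B \<Longrightarrow> c \<in> ideal_prod A B \<Longrightarrow> a * b + c \<in> ideal_prod A B"

primrec ideal_power :: "'r::comm_ring_1 set \<Rightarrow> 'r set \<Rightarrow> nat \<Rightarrow> 'r set" where
  "ideal_power S I 0 = S"
| "ideal_power S I (Suc n) = ideal_prod I (ideal_power S I n)"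

lemma ideal_prod_mult: "a \<in> A \<Longrightarrow> b \<in> B \<Longrightarrow> a * b \<in> ideal_prod A B"
  using ideal_prod.step[OF _ _ ideal_prod.zero] by fastforce

lemma ideal_of_ideal_prod:
  assumes S: "unital_subring S" and A: "ideal_of S A" and B: "ideal_of S B"
  shows "ideal_of S (ideal_prod A B)"
  unfolding ideal_of_def
proof (intro conjI ballI subsetI)
  show "x \<in> S" if "x \<in> ideal_prod A B" for x
    using that by induction (auto intro: unital_subringD[OF S] ideal_ofD[OF A] ideal_ofD[OF B])
  show "0 \<in> ideal_prod A B" by (rule ideal_prod.zero)
  show "x + y \<in> ideal_prod A B" if "x \<in> ideal_prod A B" "y \<in> ideal_prod A B" for x y
    using that by induction (auto intro: ideal_prod.step simp: add.assoc)
  show "s * x \<in> ideal_prod A B" if "s \<in> S" "x \<in> ideal_prod A B" for s x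
    using that(2)
  proof induction
    case (step a b c)
    have "s * (a * b + c) = (s * a) * b + s * c" by (simp add: algebra_simps)
    then show ?case using step ideal_ofD(4)[OF A that(1) step(1)] by (simp add: ideal_prod.step)
  qed (simp add: ideal_prod.zero)
qed

lemma ideal_of_self: "unital_subring S \<Longrightarrow> ideal_of S S"
  by (auto simp: ideal_of_def intro: unital_subringD)

lemma ideal_of_ideal_power:
  "unital_subring S \<Longrightarrow> ideal_of S I \<Longrightarrow> ideal_of S (ideal_power S I n)"
  by (induction n) (auto intro: ideal_of_ideal_prod ideal_of_self)

definition gen_by :: "'r::comm_ring_1 set \<Rightarrow> nat \<Rightarrow> (nat \<Rightarrow> 'r) \<Rightarrow> 'r set" where
  "gen_by S n t = {\<Sum>i<n. t i * s i | s. \<forall>i<n. s i \<in> S}"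

text \<open>Pigeonhole for monomials, by induction on the sum of the exponents: once
  \<open>t i\<close> is split off, the rest has to lie in the ideal of all \<open>s\<close> with
  \<open>t i * s\<close> in \<open>K\<close>, for which the exponent of \<open>t i\<close> drops by
  one. The \<open>Suc\<close> covers \<open>n = 0\<close>, where \<open>I\<close> is
  \<open>{0}\<close> but its zeroth power is \<open>S\<close>.\<close>

lemma ideal_power_subset:
  assumes S: "unital_subring S" and I: "ideal_of S I" "I \<subseteq> gen_by S n t"
    and t: "\<And>i. i < n \<Longrightarrow> t i \<in> S" 
    and K: "ideal_of S K" "\<And>i. i < n \<Longrightarrow> t i ^ e i \<in> K"
  shows "ideal_power S I (Suc (\<Sum>i<n. e i)) \<subseteq> K"
proof -
  have "ideal_power S I (Suc m) \<subseteq> K" if "m = (\<Sum>i<n. e i)" for m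
    using that K
  proof (induction m arbitrary: e K)
    case 0
    show ?case
    proof (cases "n = 0")
      case True
      have "I = {0}" using I(2) ideal_ofD(2)[OF I(1)] True by (auto simp: gen_by_def)
      moreover have "x = 0" if "x \<in> ideal_prod {0} S" for x
        using that by induction auto
      ultimately show ?thesis using ideal_ofD(2)[OF "0.prems"(2)] by auto
    next
      case False
      then have "t 0 ^ e 0 \<in> K" "e 0 = 0" using 0 by auto
      then have "1 \<in> K" by simp
      then have "S \<subseteq> K" using ideal_ofD(4)[OF "0.prems"(2), of _ 1] by auto
      then show ?thesis using ideal_ofD(1)[OF ideal_of_ideal_power[OF S I(1)]] by blast
    qed
  next
    case (Suc m)
    have ti: "t i * w \<in> K" if i: "i < n" and w: "w \<in> ideal_power S I (Suc m)" for i w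
    proof (cases "e i")
      case 0
      then have "1 \<in> K" using Suc.prems(3)[OF i] by simp
      moreover have "w \<in> S" using ideal_ofD(1)[OF ideal_of_ideal_power[OF S I(1)] w] .
      ultimately show ?thesis
        using ideal_ofD(4)[OF Suc.prems(2), of "t i * w" 1] unital_subringD(4)[OF S t[OF i]] by auto
    next
      case (Suc k)
      let ?K = "{s \<in> S. t i * s \<in> K}"
      have "ideal_of S ?K"
        using unital_subringD[OF S] ideal_ofD[OF Suc.prems(2)]
        by (auto simp: ideal_of_def distrib_left mult.left_commute[of "t i"])
      moreover have "t j ^ (e(i := k)) j \<in> ?K" if j: "j < n" for j
      proof (cases "j = i")
        case True
        then show ?thesis using Suc.prems(3)[OF i] Suc unital_subringD(7)[OF S t[OF i]] by simp
      next
        case False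
        then show ?thesis
          using Suc.prems(3)[OF j] t[OF i] unital_subringD(7)[OF S t[OF j]] ideal_ofD(4)[OF Suc.prems(2) t[OF i]] by auto
      qed
      moreover have "m = (\<Sum>j<n. (e(i := k)) j)"
      proof -
        have "(\<Sum>j<n. e j) = e i + (\<Sum>j\<in>{..<n} - {i}. e j)"
          using i by (simp add: sum.remove)
        moreover have "(\<Sum>j<n. (e(i := k)) j) = k + (\<Sum>j\<in>{..<n} - {i}. e j)"
          using i by (subst sum.remove[of _ i]) (auto intro!: sum.cong)
        ultimately show ?thesis using Suc.prems(1) Suc by simp
      qed
      ultimately have "w \<in> ?K" using Suc.IH[of "e(i := k)" ?K] w by blast
      then show ?thesis by simp
    qed
    show ?case
    proof
      fix x assume "x \<in> ideal_power S I (Suc (Suc m))"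
      then have "x \<in> ideal_prod I (ideal_power S I (Suc m))" by simp
      then show "x \<in> K"
      proof induction
        case zero
        show ?case using ideal_ofD(2)[OF Suc.prems(2)] .
      next
        case (step a b c)
        then obtain s where s: "a = (\<Sum>i<n. t i * s i)" "\<forall>i<n. s i \<in> S"
          using I(2) by (auto simp: gen_by_def)
        have "a * b = (\<Sum>i<n. t i * (s i * b))" by (simp add: s sum_distrib_right mult.assoc)
        also have "\<dots> \<in> K"
        proof -
          have "(\<Sum>i\<in>F. t i * (s i * b)) \<in> K" if "finite F" "F \<subseteq> {..<n}" for F
            using that
          proof induction
            case empty
            then show ?case using ideal_ofD(2)[OF Suc.prems(2)] by simp
          next
            case (insert i F)
            then have "s i * b \<in> ideal_power S I (Suc m)"
              using s(2) step(2) ideal_ofD(4)[OF ideal_of_ideal_power[OF S I(1)], of "s i" b "Suc m"] by auto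
            then have "t i * (s i * b) \<in> K" using insert ti by auto
            then show ?case using insert ideal_ofD(3)[OF Suc.prems(2)] by simp
          qed
          then show ?thesis by blast
        qed
        finally show ?case using step.IH ideal_ofD(3)[OF Suc.prems(2)] by blast
      qed
    qed
  qed
  then show ?thesis by blast
qed

text \<open>Krull's theorem for a localisation of the quotient by \<open>J\<close>, stated without
  fractions: the factors \<open>c + i\<close> are units modulo \<open>I\<close>, and
  \<open>1 - i\<close> in the conclusion becomes invertible at the point. Instead of the Artin-Rees
  lemma, the proof takes an ideal that is maximal among those that contain \<open>J\<close> and
  \<open>p I\<close> but not \<open>p\<close>, and shows that it contains a power of
  \<open>I\<close>.\<close>

theorem Krull_intersection:
  assumes S: "noetherian_subring S" and I: "ideal_of S I" "I \<subseteq> gen_by S n t"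
    and t: "\<And>i. i < n \<Longrightarrow> t i \<in> I"
    and J: "ideal_of S J" and p: "p \<in> S"
    and powers: "\<And>N. \<exists>c u i j. c \<in> S \<and> u \<in> S \<and> u * c = 1 \<and> i \<in> I \<and> j \<in> J \<and>
       p * (c + i) - j \<in> ideal_power S I N"
  shows "\<exists>i \<in> I. p - p * i \<in> J"
proof (rule ccontr)
  assume neg: "\<not> (\<exists>i \<in> I. p - p * i \<in> J)"
  have R: "unital_subring S" using S by (simp add: noetherian_subring_def)
  define F where "F = {K. ideal_of S K \<and> J \<subseteq> K \<and> (\<forall>i \<in> I. p * i \<in> K) \<and> p \<notin> K}"
  \<comment> \<open>The least candidate, \<open>p I + J\<close>. It omits \<open>p\<close> because
    the conclusion is assumed to fail.\<close>
  let ?K0 = "{p * i + j | i j. i \<in> I \<and> j \<in> J}"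
  have "?K0 \<in> F"
    unfolding F_def
  proof (rule CollectI, intro conjI ballI)
    show "ideal_of S ?K0"
      unfolding ideal_of_def
    proof (intro conjI ballI)
      show "?K0 \<subseteq> S"
        using ideal_ofD[OF I(1)] ideal_ofD[OF J] p by (auto intro!: unital_subringD[OF R])
      show "0 \<in> ?K0" using ideal_ofD(2)[OF I(1)] ideal_ofD(2)[OF J] by (auto intro!: exI[of _ 0])
    next
      fix a b assume "a \<in> ?K0" "b \<in> ?K0"
      then obtain i j i' j' where "a = p * i + j" "i \<in> I" "j \<in> J" "b = p * i' + j'" "i' \<in> I" "j' \<in> J" by auto
      then have "a + b = p * (i + i') + (j + j')" "i + i' \<in> I" "j + j' \<in> J"
        using ideal_ofD(3)[OF I(1)] ideal_ofD(3)[OF J] by (auto simp: algebra_simps)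
      then show "a + b \<in> ?K0" by blast
    next
      fix s a assume s: "s \<in> S" and "a \<in> ?K0"
      then obtain i j where "a = p * i + j" "i \<in> I" "j \<in> J" by auto
      then have "s * a = p * (s * i) + s * j" "s * i \<in> I" "s * j \<in> J"
        using ideal_ofD(4)[OF I(1) s] ideal_ofD(4)[OF J s] by (simp_all add: distrib_left mult.left_commute)
      then show "s * a \<in> ?K0" by blast
    qed
    show "J \<subseteq> ?K0"
    proof
      fix j assume "j \<in> J"
      moreover have "j = p * 0 + j" by simp
      ultimately show "j \<in> ?K0" using ideal_ofD(2)[OF I(1)] by blast
    qed
    show "p * i \<in> ?K0" if "i \<in> I" for i
    proof -
      have "p * i = p * i + 0" by simp
      then show ?thesis using that ideal_ofD(2)[OF J] by blast
    qed
    show "p \<notin> ?K0"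
    proof
      assume "p \<in> ?K0"
      then obtain i j where "p = p * i + j" "i \<in> I" "j \<in> J" by auto
      then have "p - p * i \<in> J" by (metis add_diff_cancel_left')
      with neg \<open>i \<in> I\<close> show False by blast
    qed
  qed
  have "\<Union>C \<in> F" if C: "C \<noteq> {}" "subset.chain F C" for C
  proof -
    have CF: "K \<in> C \<Longrightarrow> K \<in> F" for K using C(2) by (auto simp: subset.chain_def)
    have CI: "ideal_of S K" if "K \<in> C" for K using CF[OF that] by (simp add: F_def)
    have "ideal_of S (\<Union>C)"
      unfolding ideal_of_def
    proof (intro conjI ballI)
      show "\<Union>C \<subseteq> S" using CI by (auto dest: ideal_ofD(1))
      show "0 \<in> \<Union>C" using CI C(1) by (auto intro: ideal_ofD(2))
      show "s * a \<in> \<Union>C" if "s \<in> S" "a \<in> \<Union>C" for s a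
        using CI that by (auto intro: ideal_ofD(4))
      show "a + b \<in> \<Union>C" if ab: "a \<in> \<Union>C" "b \<in> \<Union>C" for a b
      proof -
        from ab obtain K K' where K: "K \<in> C" "K' \<in> C" "a \<in> K" "b \<in> K'" by blast
        then have "K \<subseteq> K' \<or> K' \<subseteq> K" using C(2) unfolding subset.chain_def by blast
        then obtain K'' where "K'' \<in> C" "a \<in> K''" "b \<in> K''" using K by blast
        then show ?thesis using CI[of K''] by (auto intro: ideal_ofD(3))
      qed
    qed
    then show ?thesis using CF C(1) unfolding F_def by blast
  qed
  from subset_Zorn_nonempty[OF _ this] \<open>?K0 \<in> F\<close>
  obtain K where K: "K \<in> F" and max: "\<And>K'. K' \<in> F \<Longrightarrow> K \<subseteq> K' \<Longrightarrow> K' = K" by blast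
  have ideal_K: "ideal_of S K" and JK: "J \<subseteq> K" and pI: "\<And>i. i \<in> I \<Longrightarrow> p * i \<in> K" and pK: "p \<notin> K"
    using K by (auto simp: F_def)
  have "\<exists>e. t i ^ e \<in> K" if i: "i < n" for i
  proof -
    note ti = ideal_ofD(1)[OF I(1) t[OF i]]
    \<comment> \<open>The ideals of elements carried into \<open>K\<close> by \<open>t i ^ e\<close>
      increase with \<open>e\<close>; where they stop, one more factor \<open>t i\<close> gains
      nothing.\<close>
    let ?Q = "\<lambda>e. {s \<in> S. t i ^ e * s \<in> K}"
    have "\<exists>N. \<forall>m\<ge>N. ?Q m = ?Q N"
    proof -
      have "ideal_of S (?Q e)" for e
        using unital_subringD[OF R] ideal_ofD[OF ideal_K]
        by (auto simp: ideal_of_def distrib_left mult.left_commute[of "t i ^ e"])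
      moreover have "incseq ?Q"
        by (rule incseq_SucI) (auto simp: mult.assoc intro: ideal_ofD(4)[OF ideal_K ti])
      ultimately show ?thesis using S unfolding noetherian_subring_def by meson
    qed
    then obtain e where e: "?Q (Suc e) = ?Q e" by (meson le_SucI order_refl)
    show ?thesis
    proof (rule ccontr)
      assume "\<not> ?thesis"
      then have te: "t i ^ e \<notin> K" by blast
      let ?K' = "{k + t i ^ e * s | k s. k \<in> K \<and> s \<in> S}"
      have te_S: "t i ^ e \<in> S" using unital_subringD(7)[OF R ti] .
      have KK': "K \<subseteq> ?K'"
      proof
        fix k assume "k \<in> K"
        moreover have "k = k + t i ^ e * 0" by simp
        ultimately show "k \<in> ?K'" using unital_subringD(2)[OF R] by blast
      qed
      have "t i ^ e = 0 + t i ^ e * 1" by simp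
      then have "t i ^ e \<in> ?K'"
        using ideal_ofD(2)[OF ideal_K] unital_subringD(1)[OF R] by blast
      then have "?K' \<noteq> K" using te by blast
      with max[OF _ KK'] have "?K' \<notin> F" by blast
      moreover have "ideal_of S ?K'"
        unfolding ideal_of_def
      proof (intro conjI ballI)
        show "?K' \<subseteq> S" using ideal_ofD(1)[OF ideal_K] te_S by (auto intro!: unital_subringD[OF R])
        show "0 \<in> ?K'" using KK' ideal_ofD(2)[OF ideal_K] by blast
      next
        fix a b assume "a \<in> ?K'" "b \<in> ?K'"
        then obtain k s k' s' where "a = k + t i ^ e * s" "k \<in> K" "s \<in> S" "b = k' + t i ^ e * s'" "k' \<in> K" "s' \<in> S"
          by auto
        then have "a + b = (k + k') + t i ^ e * (s + s')" "k + k' \<in> K" "s + s' \<in> S"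
          using ideal_ofD(3)[OF ideal_K] unital_subringD(6)[OF R] by (auto simp: algebra_simps)
        then show "a + b \<in> ?K'" by blast
      next
        fix r a assume r: "r \<in> S" and "a \<in> ?K'"
        then obtain k s where "a = k + t i ^ e * s" "k \<in> K" "s \<in> S" by auto
        then have "r * a = r * k + t i ^ e * (r * s)" "r * k \<in> K" "r * s \<in> S"
          using ideal_ofD(4)[OF ideal_K r] unital_subringD(4)[OF R r] by (simp_all add: distrib_left mult.left_commute)
        then show "r * a \<in> ?K'" by blast
      qed
      ultimately have "p \<in> ?K'" using KK' JK pI unfolding F_def by blast
      \<comment> \<open>Maximality of \<open>K\<close> has forced \<open>p\<close> into
        \<open>K + t i ^ e S\<close>. As \<open>p * t i\<close> lies in \<open>K\<close>, so does
        \<open>t i ^ Suc e * s\<close>; by the choice of \<open>e\<close> also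
        \<open>t i ^ e * s\<close>, and then \<open>p\<close> itself.\<close>
      then obtain k s where p_eq: "p = k + t i ^ e * s" and k: "k \<in> K" and s: "s \<in> S" by auto
      have "t i ^ Suc e * s = p * t i - t i * k" by (simp add: p_eq algebra_simps)
      also have "\<dots> \<in> K"
        by (rule ideal_of_diff[OF R ideal_K pI[OF t[OF i]] ideal_ofD(4)[OF ideal_K ti k]])
      finally have "s \<in> ?Q (Suc e)" using s by simp
      then have "t i ^ e * s \<in> K" unfolding e by simp
      then have "p \<in> K" unfolding p_eq by (rule ideal_ofD(3)[OF ideal_K k])
      with pK show False by blast
    qed
  qed
  then obtain e where "\<And>i. i < n \<Longrightarrow> t i ^ e i \<in> K" by metis
  from ideal_power_subset[OF R I ideal_ofD(1)[OF I(1) t] ideal_K this]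
  obtain N where N: "ideal_power S I N \<subseteq> K" by blast
  from powers[of N] obtain c u i j where cu: "c \<in> S" "u \<in> S" "u * c = 1" and ij: "i \<in> I" "j \<in> J"
    and "p * (c + i) - j \<in> ideal_power S I N" by blast
  then have "p * (c + i) - j \<in> K" using N by blast
  from ideal_ofD(3)[OF ideal_K this, of j] have "p * (c + i) \<in> K" using ij JK by auto
  from ideal_of_diff[OF R ideal_K this pI[OF ij(1)]] have "p * c \<in> K" by (simp add: algebra_simps)
  from ideal_ofD(4)[OF ideal_K cu(2) this] have "p \<in> K"
    using cu(3) by (metis mult.left_commute mult.right_neutral)
  with pK show False by blast
qed

section \<open>Embedding finitely generated rings into the complex numbers\<close>

text \<open>The graph of an isomorphism between a subring of one field and a subring of the other:
  together with closure under differences, the last clause makes the relation single-valued and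
  injective.\<close>

definition partial_iso :: "('a::field \<times> 'b::field) set \<Rightarrow> bool" where
  "partial_iso \<Phi> \<longleftrightarrow> (1, 1) \<in> \<Phi> \<and>
     (\<forall>(a, c) \<in> \<Phi>. \<forall>(a', c') \<in> \<Phi>. (a - a', c - c') \<in> \<Phi> \<and> (a * a', c * c') \<in> \<Phi>) \<and>
     (\<forall>(a, c) \<in> \<Phi>. a = 0 \<longleftrightarrow> c = 0)"

definition rel_poly :: "('a::field \<times> 'b::field) set \<Rightarrow> 'a poly \<Rightarrow> 'b poly \<Rightarrow> bool" where
  "rel_poly \<Phi> f g \<longleftrightarrow> (\<forall>i. (coeff f i, coeff g i) \<in> \<Phi>)"

context
  fixes \<Phi> :: "('a::field \<times> 'b::field) set"
  assumes \<Phi>: "partial_iso \<Phi>"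
begin

lemma partial_iso_one: "(1, 1) \<in> \<Phi>"
  and partial_iso_diff: "(a, c) \<in> \<Phi> \<Longrightarrow> (a', c') \<in> \<Phi> \<Longrightarrow> (a - a', c - c') \<in> \<Phi>"
  and partial_iso_mult: "(a, c) \<in> \<Phi> \<Longrightarrow> (a', c') \<in> \<Phi> \<Longrightarrow> (a * a', c * c') \<in> \<Phi>"
  and partial_iso_zero_iff: "(a, c) \<in> \<Phi> \<Longrightarrow> a = 0 \<longleftrightarrow> c = 0"
  using \<Phi> unfolding partial_iso_def by blast+

lemma partial_iso_zero: "(0, 0) \<in> \<Phi>"
  using partial_iso_diff[OF partial_iso_one partial_iso_one] by simp

lemma partial_iso_add: "(a, c) \<in> \<Phi> \<Longrightarrow> (a', c') \<in> \<Phi> \<Longrightarrow> (a + a', c + c') \<in> \<Phi>"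
  using partial_iso_diff[of a c "- a'" "- c'"] partial_iso_diff[OF partial_iso_zero, of a' c'] by simp

lemma partial_iso_sum:
  "(\<And>i. i \<in> I \<Longrightarrow> (u i, v i) \<in> \<Phi>) \<Longrightarrow> (sum u I, sum v I) \<in> \<Phi>"
  by (induction I rule: infinite_finite_induct) (auto intro: partial_iso_zero partial_iso_add)

lemma rel_poly_diff: "rel_poly \<Phi> f f' \<Longrightarrow> rel_poly \<Phi> g g' \<Longrightarrow> rel_poly \<Phi> (f - g) (f' - g')"
  by (auto simp: rel_poly_def intro: partial_iso_diff)

lemma rel_poly_add: "rel_poly \<Phi> f f' \<Longrightarrow> rel_poly \<Phi> g g' \<Longrightarrow> rel_poly \<Phi> (f + g) (f' + g')"
  by (auto simp: rel_poly_def intro: partial_iso_add)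

lemma rel_poly_mult: "rel_poly \<Phi> f f' \<Longrightarrow> rel_poly \<Phi> g g' \<Longrightarrow> rel_poly \<Phi> (f * g) (f' * g')"
  by (auto simp: rel_poly_def coeff_mult intro!: partial_iso_sum partial_iso_mult)

lemma rel_poly_monom: "(a, c) \<in> \<Phi> \<Longrightarrow> rel_poly \<Phi> (monom a n) (monom c n)"
  by (auto simp: rel_poly_def partial_iso_zero)

lemma rel_poly_const: "(a, c) \<in> \<Phi> \<Longrightarrow> rel_poly \<Phi> [:a:] [:c:]"
  using rel_poly_monom[of a c 0] by (simp add: monom_0)

lemma rel_poly_coeff_zero_iff: "rel_poly \<Phi> f f' \<Longrightarrow> coeff f i = 0 \<longleftrightarrow> coeff f' i = 0"
  using partial_iso_zero_iff[of "coeff f i" "coeff f' i"] by (simp add: rel_poly_def)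

lemma rel_poly_zero_iff: "rel_poly \<Phi> f f' \<Longrightarrow> f = 0 \<longleftrightarrow> f' = 0"
  by (simp add: poly_eq_iff rel_poly_coeff_zero_iff)

lemma rel_poly_degree: "rel_poly \<Phi> f f' \<Longrightarrow> degree f = degree f'"
  by (simp add: degree_def rel_poly_coeff_zero_iff)

lemma rel_poly_lead_coeff: "rel_poly \<Phi> f f' \<Longrightarrow> (lead_coeff f, lead_coeff f') \<in> \<Phi>"
  using rel_poly_degree by (auto simp: rel_poly_def)

text \<open>The coefficients range over subrings, not fields, so \<open>f\<close> is multiplied by
  the leading coefficient of \<open>q\<close> before its leading term is cancelled. Doing the same
  on the other side keeps the remainders and multipliers related.\<close>

lemma pseudo_division_step:
  assumes f: "rel_poly \<Phi> f f'" "f \<noteq> 0" and q: "rel_poly \<Phi> q q'" "q \<noteq> 0" and le: "degree q \<le> degree f"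
  obtains r r' m m' where "rel_poly \<Phi> r r'" "rel_poly \<Phi> m m'"
    "smult (lead_coeff q) f = r + m * q" "smult (lead_coeff q') f' = r' + m' * q'"
    "r = 0 \<or> degree r < degree f"
proof -
  define d where "d = degree f - degree q"
  define m where "m = monom (lead_coeff f) d"
  define m' where "m' = monom (lead_coeff f') d"
  define r where "r = smult (lead_coeff q) f - m * q"
  define r' where "r' = smult (lead_coeff q') f' - m' * q'"
  have m: "rel_poly \<Phi> m m'"
    unfolding m_def m'_def by (intro rel_poly_monom rel_poly_lead_coeff f)
  have "rel_poly \<Phi> (smult (lead_coeff q) f) (smult (lead_coeff q') f')"
    using rel_poly_mult[OF rel_poly_const[OF rel_poly_lead_coeff[OF q(1)]] f(1)] by simp
  then have r: "rel_poly \<Phi> r r'"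
    unfolding r_def r'_def by (intro rel_poly_diff rel_poly_mult m q)
  have dm: "degree (m * q) = degree f"
    using f(2) q(2) le by (simp add: m_def d_def degree_mult_eq degree_monom_eq monom_eq_0_iff)
  have "degree r \<le> degree f"
    unfolding r_def using dm by (intro degree_diff_le) auto
  moreover have "coeff r (degree f) = 0"
  proof -
    have "coeff (m * q) (degree f) = lead_coeff (m * q)" by (simp add: dm)
    also have "\<dots> = lead_coeff f * lead_coeff q" by (simp only: lead_coeff_mult) (simp add: m_def degree_monom_eq f(2))
    finally show ?thesis by (simp add: r_def)
  qed
  ultimately have "r = 0 \<or> degree r < degree f"
    by (metis le_neq_implies_less leading_coeff_0_iff)
  then show ?thesis
    using that[OF r m] by (simp add: r_def r'_def)
qed

text \<open>Pseudo-division by \<open>q\<close> leaves a remainder that again vanishes at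
  \<open>b\<close>, so induction on the degree applies. The nonzero leading coefficient of
  \<open>q'\<close> cancels at the end.\<close>

lemma minimal_root_transfer:
  assumes q: "rel_poly \<Phi> q q'" "q \<noteq> 0" "poly q b = 0" "poly q' c = 0"
    and min: "\<And>f f'. rel_poly \<Phi> f f' \<Longrightarrow> f \<noteq> 0 \<Longrightarrow> poly f b = 0 \<Longrightarrow> degree q \<le> degree f"
    and f: "rel_poly \<Phi> f f'" "poly f b = 0"
  shows "poly f' c = 0"
  using f
proof (induction "degree f" arbitrary: f f' rule: less_induct)
  case less
  show ?case
  proof (cases "f = 0")
    case True
    then show ?thesis using rel_poly_zero_iff[OF less.prems(1)] by simp
  next
    case False
    obtain r r' m m' where r: "rel_poly \<Phi> r r'"
      "smult (lead_coeff q) f = r + m * q" "smult (lead_coeff q') f' = r' + m' * q'"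
      "r = 0 \<or> degree r < degree f"
      using pseudo_division_step[OF less.prems(1) False q(1,2) min[OF less.prems(1) False less.prems(2)]] by metis
    have "poly r b = 0"
      using arg_cong[OF r(2), of "\<lambda>p. poly p b"] q(3) less.prems(2) by simp
    then have "poly r' c = 0"
      using less.hyps[of r r'] r(1,4) rel_poly_zero_iff[OF r(1)] by auto
    then have "lead_coeff q' * poly f' c = 0"
      using arg_cong[OF r(3), of "\<lambda>p. poly p c"] q(4) by simp
    then show ?thesis using rel_poly_zero_iff[OF q(1)] q(2) by simp
  qed
qed

text \<open>The mirror image, with minimality measured at \<open>c\<close>: \<open>f\<close> divides
  \<open>h\<close> up to a nonzero factor, as it would over the field of fractions.\<close>

lemma minimal_root_dvd:
  assumes f: "rel_poly \<Phi> f f'" "f \<noteq> 0" "poly f' c = 0"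
    and min: "\<And>h h'. rel_poly \<Phi> h h' \<Longrightarrow> h \<noteq> 0 \<Longrightarrow> poly h' c = 0 \<Longrightarrow> degree f \<le> degree h"
    and h: "rel_poly \<Phi> h h'" "poly h' c = 0"
  shows "\<exists>a a' g g'. a \<noteq> 0 \<and> (a, a') \<in> \<Phi> \<and> rel_poly \<Phi> g g' \<and> smult a h = f * g"
  using h
proof (induction "degree h" arbitrary: h h' rule: less_induct)
  case less
  show ?case
  proof (cases "h = 0")
    case True
    then show ?thesis
      by (intro exI[of _ 1] exI[of _ 0]) (simp add: rel_poly_def partial_iso_zero partial_iso_one)
  next
    case False
    obtain r r' m m' where r: "rel_poly \<Phi> r r'" "rel_poly \<Phi> m m'"
      "smult (lead_coeff f) h = r + m * f" "smult (lead_coeff f') h' = r' + m' * f'"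
      "r = 0 \<or> degree r < degree h"
      using pseudo_division_step[OF less.prems(1) False f(1,2) min[OF less.prems(1) False less.prems(2)]] .
    have "poly r' c = 0"
      using arg_cong[OF r(4), of "\<lambda>p. poly p c"] f(3) less.prems(2) by simp
    have "\<exists>a a' g g'. a \<noteq> 0 \<and> (a, a') \<in> \<Phi> \<and> rel_poly \<Phi> g g' \<and> smult a r = f * g"
    proof (cases "r = 0")
      case True
      then show ?thesis
        by (intro exI[of _ 1] exI[of _ 0]) (simp add: rel_poly_def partial_iso_zero partial_iso_one)
    next
      case False
      then show ?thesis using less.hyps[of r r'] r(1,5) \<open>poly r' c = 0\<close> by auto
    qed
    then obtain a a' g g' where a: "a \<noteq> 0" "(a, a') \<in> \<Phi>" "rel_poly \<Phi> g g'" "smult a r = f * g"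
      by blast
    have "smult (a * lead_coeff f) h = smult a (smult (lead_coeff f) h)" by simp
    also have "\<dots> = f * (g + [:a:] * m)"
      unfolding r(3) by (simp add: smult_add_right a(4) algebra_simps)
    finally have "smult (a * lead_coeff f) h = f * (g + [:a:] * m)" .
    moreover have "rel_poly \<Phi> (g + [:a:] * m) (g' + [:a':] * m')"
      by (intro rel_poly_add rel_poly_mult rel_poly_const a r)
    moreover have "(a * lead_coeff f, a' * lead_coeff f') \<in> \<Phi>"
      by (intro partial_iso_mult a rel_poly_lead_coeff f)
    ultimately show ?thesis using a(1) f(2) by (metis leading_coeff_0_iff mult_eq_0_iff)
  qed
qed

text \<open>Let \<open>q\<close> have least degree among the polynomials that vanish at
  \<open>b\<close>, and let \<open>c\<close> be any root of its partner. If some \<open>h\<close>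
  vanished only on the side of \<open>c\<close>, a polynomial \<open>f\<close> of least degree there
  would divide both \<open>h\<close> and \<open>q\<close> up to factors. It would not vanish at
  \<open>b\<close>, so the cofactor in \<open>q\<close> would, and minimality of \<open>q\<close>
  would make \<open>f\<close> constant.\<close>

lemma algebraic_extension:
  assumes "rel_poly \<Phi> f0 f0'" "f0 \<noteq> 0" "poly f0 b = 0"
    and closed: "\<And>p :: 'b poly. degree p > 0 \<Longrightarrow> \<exists>c. poly p c = 0"
  shows "\<exists>c. \<forall>f f'. rel_poly \<Phi> f f' \<longrightarrow> (poly f b = 0 \<longleftrightarrow> poly f' c = 0)"
proof -
  define P where "P f \<longleftrightarrow> (\<exists>f'. rel_poly \<Phi> f f') \<and> f \<noteq> 0 \<and> poly f b = 0" for f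
  have "P f0" using assms by (auto simp: P_def)
  then obtain q where "P q" and min: "\<And>f. P f \<Longrightarrow> degree q \<le> degree f"
    using ex_has_least_nat[of P f0 degree] by blast
  then obtain q' where q: "rel_poly \<Phi> q q'" "q \<noteq> 0" "poly q b = 0" by (auto simp: P_def)
  have "degree q \<noteq> 0" using q(2,3) by (metis degree_eq_zeroE pCons_0_0 poly_pCons poly_0 mult_zero_right add.right_neutral)
  then obtain c where c: "poly q' c = 0" using closed[of q'] rel_poly_degree[OF q(1)] by auto
  have 1: "poly f' c = 0" if "rel_poly \<Phi> f f'" "poly f b = 0" for f f'
    using minimal_root_transfer[OF q c _ that] min by (auto simp: P_def)
  have 2: "poly h b = 0" if h: "rel_poly \<Phi> h h'" "poly h' c = 0" for h h'
  proof (rule ccontr)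
    assume hb: "poly h b \<noteq> 0"
    define Q where "Q f \<longleftrightarrow> (\<exists>f'. rel_poly \<Phi> f f' \<and> f \<noteq> 0 \<and> poly f' c = 0)" for f
    have "Q q" using q c by (auto simp: Q_def)
    then obtain f where "Q f" and minf: "\<And>g. Q g \<Longrightarrow> degree f \<le> degree g"
      using ex_has_least_nat[of Q q degree] by blast
    then obtain f' where f: "rel_poly \<Phi> f f'" "f \<noteq> 0" "poly f' c = 0" by (auto simp: Q_def)
    have minf': "degree f \<le> degree g" if "rel_poly \<Phi> g g'" "g \<noteq> 0" "poly g' c = 0" for g g'
      using minf that by (auto simp: Q_def)
    have dvd: "\<exists>a a' g g'. a \<noteq> 0 \<and> (a, a') \<in> \<Phi> \<and> rel_poly \<Phi> g g' \<and> smult a k = f * g"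
      if "rel_poly \<Phi> k k'" "poly k' c = 0" for k k'
      by (rule minimal_root_dvd[OF f _ that]) (rule minf')
    from dvd[OF h] obtain a a' g g' where "a \<noteq> 0" "(a, a') \<in> \<Phi>" "rel_poly \<Phi> g g'" "smult a h = f * g" by blast
    then have fb: "poly f b \<noteq> 0" using hb by (metis mult_eq_0_iff poly_mult poly_smult)
    from dvd[OF q(1) c] obtain a a' g g' where
      "a \<noteq> 0" "(a, a') \<in> \<Phi>" "rel_poly \<Phi> g g'" "smult a q = f * g" by blast
    then have g: "a \<noteq> 0" "rel_poly \<Phi> g g'" "smult a q = f * g" by blast+
    have "poly g b = 0" using arg_cong[OF g(3), of "\<lambda>p. poly p b"] q(3) fb by simp
    moreover have "g \<noteq> 0" using g q(2) by auto
    ultimately have "degree q \<le> degree g" using min[of g] g(2) by (auto simp: P_def)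
    moreover have "degree q = degree f + degree g"
      using arg_cong[OF g(3), of degree] g(1) f(2) \<open>g \<noteq> 0\<close> by (simp add: degree_mult_eq)
    moreover have "degree f \<noteq> 0"
    proof
      assume "degree f = 0"
      then obtain e where "f' = [:e:]" using rel_poly_degree[OF f(1)] by (metis degree_eq_zeroE)
      then show False using f rel_poly_zero_iff[OF f(1)] by simp
    qed
    ultimately show False by simp
  qed
  show ?thesis using 1 2 by blast
qed

text \<open>Countably many nonzero polynomials have only countably many roots, so an uncountable
  field contains an element \<open>c\<close> that avoids all of them.\<close>

lemma transcendental_extension:
  assumes "countable \<Phi>" "uncountable (UNIV :: 'b set)"
    and b: "\<And>f f'. rel_poly \<Phi> f f' \<Longrightarrow> poly f b = 0 \<Longrightarrow> f = 0"
  shows "\<exists>c. \<forall>f f'. rel_poly \<Phi> f f' \<longrightarrow> (poly f b = 0 \<longleftrightarrow> poly f' c = 0)"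
proof -
  define Z where "Z = (\<Union>f' \<in> Poly ` lists (snd ` \<Phi>) - {0}. {c. poly f' c = 0})"
  have "countable Z"
    unfolding Z_def using assms(1) by (intro countable_UN) (auto intro: countable_finite poly_roots_finite)
  then obtain c where c: "c \<notin> Z" using assms(2) by (metis UNIV_eq_I)
  have "f' \<in> Poly ` lists (snd ` \<Phi>)" if f: "rel_poly \<Phi> f f'" for f f'
  proof (rule image_eqI)
    show "f' = Poly (coeffs f')" by simp
    have "\<forall>i. coeff f' i \<in> snd ` \<Phi>" using f by (force simp: rel_poly_def)
    then show "coeffs f' \<in> lists (snd ` \<Phi>)" by (auto simp: coeffs_def)
  qed
  then have "poly f' c \<noteq> 0" if "rel_poly \<Phi> f f'" "f' \<noteq> 0" for f f'
    using c that unfolding Z_def by blast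
  then have "poly f b = 0 \<longleftrightarrow> poly f' c = 0" if "rel_poly \<Phi> f f'" for f f'
    using b[OF that] rel_poly_zero_iff[OF that] that by (cases "f = 0") auto
  then show ?thesis by blast
qed

lemma extend_partial_iso:
  assumes "countable \<Phi>" "uncountable (UNIV :: 'b set)"
    and closed: "\<And>p :: 'b poly. degree p > 0 \<Longrightarrow> \<exists>c. poly p c = 0"
  shows "\<exists>\<Psi>. partial_iso \<Psi> \<and> countable \<Psi> \<and> \<Phi> \<subseteq> \<Psi> \<and> b \<in> Domain \<Psi>"
proof -
  have "\<exists>c. \<forall>f f'. rel_poly \<Phi> f f' \<longrightarrow> (poly f b = 0 \<longleftrightarrow> poly f' c = 0)"
  proof (cases "\<exists>f f'. rel_poly \<Phi> f f' \<and> f \<noteq> 0 \<and> poly f b = 0")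
    case True
    then show ?thesis using algebraic_extension[OF _ _ _ closed] by metis
  next
    case False
    then show ?thesis by (intro transcendental_extension assms(1,2)) blast
  qed
  then obtain c where c: "\<And>f f'. rel_poly \<Phi> f f' \<Longrightarrow> poly f b = 0 \<longleftrightarrow> poly f' c = 0" by blast
  \<comment> \<open>The extended graph evaluates related polynomials at \<open>b\<close> and at
    \<open>c\<close>; the choice of \<open>c\<close> says exactly that zeros still
    correspond.\<close>
  define \<Psi> where "\<Psi> = {(poly f b, poly f' c) | f f'. rel_poly \<Phi> f f'}"
  have sub: "(u, v) \<in> \<Psi>" if uv: "(u, v) \<in> \<Phi>" for u v
    unfolding \<Psi>_def using rel_poly_const[OF uv]
    by (auto intro!: exI[of _ "[:u:]"] exI[of _ "[:v:]"])
  have "partial_iso \<Psi>"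
    unfolding partial_iso_def
  proof (intro conjI ballI)
    show "(1, 1) \<in> \<Psi>" using sub partial_iso_one .
    show "case x of (a, c) \<Rightarrow> a = 0 \<longleftrightarrow> c = 0" if "x \<in> \<Psi>" for x
      using that c by (auto simp: \<Psi>_def)
    fix x assume "x \<in> \<Psi>"
    then obtain f f' where x: "x = (poly f b, poly f' c)" "rel_poly \<Phi> f f'" by (auto simp: \<Psi>_def)
    have "(poly f b - poly g b, poly f' c - poly g' c) \<in> \<Psi> \<and> (poly f b * poly g b, poly f' c * poly g' c) \<in> \<Psi>"
      if g: "rel_poly \<Phi> g g'" for g g'
      using rel_poly_diff[OF x(2) g] rel_poly_mult[OF x(2) g]
      unfolding \<Psi>_def by (metis (mono_tags, lifting) mem_Collect_eq poly_diff poly_mult)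
    then show "case x of (a, c) \<Rightarrow> \<forall>(a', c') \<in> \<Psi>. (a - a', c - c') \<in> \<Psi> \<and> (a * a', c * c') \<in> \<Psi>"
      unfolding x by (auto simp: \<Psi>_def)
  qed
  moreover have "countable \<Psi>"
  proof -
    let ?P = "Poly ` lists (fst ` \<Phi>)" and ?P' = "Poly ` lists (snd ` \<Phi>)"
    have "\<Psi> \<subseteq> (\<lambda>(f, f'). (poly f b, poly f' c)) ` (?P \<times> ?P')"
    proof
      fix x assume "x \<in> \<Psi>"
      then obtain f f' where x: "x = (poly f b, poly f' c)" "rel_poly \<Phi> f f'" by (auto simp: \<Psi>_def)
      have "\<forall>i. coeff f i \<in> fst ` \<Phi>" "\<forall>i. coeff f' i \<in> snd ` \<Phi>" using x(2) by (force simp: rel_poly_def)+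
      then have "coeffs f \<in> lists (fst ` \<Phi>)" "coeffs f' \<in> lists (snd ` \<Phi>)" by (auto simp: coeffs_def)
      then have "f \<in> ?P" "f' \<in> ?P'" by (metis Poly_coeffs image_eqI)+
      then show "x \<in> (\<lambda>(f, f'). (poly f b, poly f' c)) ` (?P \<times> ?P')" using x(1) by force
    qed
    moreover have "countable (?P \<times> ?P')" using assms(1) by auto
    ultimately show ?thesis by (meson countable_image countable_subset)
  qed
  moreover have "b \<in> Domain \<Psi>"
  proof -
    have "rel_poly \<Phi> [:0, 1:] [:0, 1:]"
      using rel_poly_monom[OF partial_iso_one, of "Suc 0"] by (simp add: monom_Suc monom_0)
    then have "(poly [:0, 1:] b, poly [:0, 1:] c) \<in> \<Psi>" unfolding \<Psi>_def by blast
    then show ?thesis by auto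
  qed
  moreover have "\<Phi> \<subseteq> \<Psi>" using sub by (rule subrelI)
  ultimately show ?thesis by blast
qed

end

text \<open>The elements of \<open>F\<close> are adjoined one at a time to the integers.
  Countability is carried along so that a transcendental image remains available at every
  stage.\<close>

theorem embed_finite_in_complex:
  fixes F :: "'k::field_char_0 set"
  assumes "finite F"
  obtains A and \<phi> :: "'k \<Rightarrow> complex" where "unital_subring A" "F \<subseteq> A" "inj_on \<phi> A" "\<phi> 1 = 1"
    "\<And>a b. a \<in> A \<Longrightarrow> b \<in> A \<Longrightarrow> \<phi> (a + b) = \<phi> a + \<phi> b"
    "\<And>a b. a \<in> A \<Longrightarrow> b \<in> A \<Longrightarrow> \<phi> (a * b) = \<phi> a * \<phi> b"
proof -
  have "\<exists>\<Phi> :: ('k \<times> complex) set. partial_iso \<Phi> \<and> countable \<Phi> \<and> F \<subseteq> Domain \<Phi>"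
    using assms
  proof induction
    case empty
    \<comment> \<open>Characteristic zero enters here: an integer is zero in \<open>'k\<close> if
      and only if it is zero in the complex numbers.\<close>
    let ?I = "range (\<lambda>z::int. (of_int z :: 'k, of_int z :: complex))"
    have "(of_int z - of_int w, of_int z - of_int w) \<in> ?I" for z w
      by (rule image_eqI[of _ _ "z - w"]) simp_all
    moreover have "(of_int z * of_int w, of_int z * of_int w) \<in> ?I" for z w
      by (rule image_eqI[of _ _ "z * w"]) simp_all
    moreover have "(1, 1) \<in> ?I" by (auto intro!: image_eqI[of _ _ 1])
    ultimately have "partial_iso ?I" unfolding partial_iso_def by auto
    then show ?case by blast
  next
    case (insert b F)
    then obtain \<Phi> :: "('k \<times> complex) set" where \<Phi>: "partial_iso \<Phi>" "countable \<Phi>" "F \<subseteq> Domain \<Phi>" by blast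
    have "\<exists>c. poly p c = 0" if "degree p > 0" for p :: "complex poly"
      using fundamental_theorem_of_algebra[of p] that by (metis constant_degree less_irrefl)
    from extend_partial_iso[OF \<Phi>(1,2) uncountable_UNIV_complex this, where b = b]
    obtain \<Psi> where "partial_iso \<Psi>" "countable \<Psi>" "\<Phi> \<subseteq> \<Psi>" "b \<in> Domain \<Psi>" by blast
    then show ?case using \<Phi>(3) by blast
  qed
  then obtain \<Phi> :: "('k \<times> complex) set" where \<Phi>: "partial_iso \<Phi>" "F \<subseteq> Domain \<Phi>" by blast
  define \<phi> where "\<phi> a = (SOME c. (a, c) \<in> \<Phi>)" for a
  have uniq: "c = c'" if "(a, c) \<in> \<Phi>" "(a, c') \<in> \<Phi>" for a c c'
    using partial_iso_zero_iff[OF \<Phi>(1) partial_iso_diff[OF \<Phi>(1) that]] by simp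
  have \<phi>: "\<phi> a = c" if "(a, c) \<in> \<Phi>" for a c
    unfolding \<phi>_def using that uniq by (metis someI)
  show ?thesis
  proof (rule that[of "Domain \<Phi>" \<phi>])
    show "unital_subring (Domain \<Phi>)"
      unfolding unital_subring_def using partial_iso_one[OF \<Phi>(1)] partial_iso_diff[OF \<Phi>(1)] partial_iso_mult[OF \<Phi>(1)] by blast
    show "F \<subseteq> Domain \<Phi>" by (rule \<Phi>(2))
    show "\<phi> 1 = 1" using \<phi> partial_iso_one[OF \<Phi>(1)] .
    show "inj_on \<phi> (Domain \<Phi>)"
    proof (rule inj_onI)
      fix a b assume "a \<in> Domain \<Phi>" "b \<in> Domain \<Phi>" and eq: "\<phi> a = \<phi> b"
      then obtain c d where cd: "(a, c) \<in> \<Phi>" "(b, d) \<in> \<Phi>" by blast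
      then have "c = d" using \<phi> eq by metis
      then show "a = b" using partial_iso_zero_iff[OF \<Phi>(1) partial_iso_diff[OF \<Phi>(1) cd]] by simp
    qed
    fix a b assume "a \<in> Domain \<Phi>" "b \<in> Domain \<Phi>"
    then obtain c d where cd: "(a, c) \<in> \<Phi>" "(b, d) \<in> \<Phi>" by blast
    show "\<phi> (a + b) = \<phi> a + \<phi> b" "\<phi> (a * b) = \<phi> a * \<phi> b"
      using \<phi>[OF cd(1)] \<phi>[OF cd(2)] \<phi>[OF partial_iso_add[OF \<Phi>(1) cd]] \<phi>[OF partial_iso_mult[OF \<Phi>(1) cd]]
      by simp_all
  qed
qed

section \<open>Jordan's theorem for complex matrices\<close>

text \<open>Read \<open>B u r\<close> as: the norm of \<open>u\<close> is at most \<open>r\<close>.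
  A relation is enough, and an operator norm fits it directly without being computed as a
  supremum.\<close>

definition gauge_bound :: "(('q \<Rightarrow> complex) \<Rightarrow> real \<Rightarrow> bool) \<Rightarrow> bool" where
  "gauge_bound B \<longleftrightarrow>
     (\<forall>u w r s. B u r \<and> B w s \<longrightarrow> B (\<lambda>q. u q + w q) (r + s)) \<and>
     (\<forall>u r t. B u r \<longrightarrow> B (\<lambda>q. t * u q) (cmod t * r)) \<and>
     (\<forall>u r s. B u r \<and> r \<le> s \<longrightarrow> B u s)"

lemma cell_estimate:
  fixes z w :: complex
  assumes M: "M > 0" and "\<lfloor>M * Re z\<rfloor> = \<lfloor>M * Re w\<rfloor>" "\<lfloor>M * Im z\<rfloor> = \<lfloor>M * Im w\<rfloor>"
  shows "cmod (z - w) \<le> 2 / M"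
proof -
  have "\<bar>M * Re z - M * Re w\<bar> \<le> 1" "\<bar>M * Im z - M * Im w\<bar> \<le> 1"
    using assms(2,3) by linarith+
  then have "M * \<bar>Re (z - w)\<bar> \<le> 1" "M * \<bar>Im (z - w)\<bar> \<le> 1"
    using M by (simp_all add: abs_mult flip: right_diff_distrib)
  then have "M * cmod (z - w) \<le> 2"
    using cmod_le[of "z - w"] mult_left_mono[OF cmod_le[of "z - w"], of M] M by (simp add: distrib_left)
  then show ?thesis using M by (simp add: field_simps)
qed

text \<open>Gaussian elimination with pivoting: subtracting multiples of a vector whose \<open>q\<close>-entry is
  maximal keeps the coefficients in the unit disc, so the bound at most doubles with each pivot.\<close>

lemma packing:
  assumes "\<epsilon> > 0" "R \<ge> 0"
  shows "\<exists>N::nat. \<forall>(B :: ('q \<Rightarrow> complex) \<Rightarrow> real \<Rightarrow> bool) (I :: 'i set) v Q.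
    gauge_bound B \<and> finite I \<and> finite Q \<and> card Q \<le> d \<and> card I > N \<and>
    (\<forall>i \<in> I. B (v i) R \<and> (\<forall>q. q \<notin> Q \<longrightarrow> v i q = 0)) \<longrightarrow>
    (\<exists>i \<in> I. \<exists>j \<in> I. i \<noteq> j \<and> B (\<lambda>q. v i q - v j q) \<epsilon>)"
  using assms
proof (induction d arbitrary: \<epsilon> R)
  case 0
  show ?case
  proof (intro exI[of _ 1] allI impI)
    fix B :: "('q \<Rightarrow> complex) \<Rightarrow> real \<Rightarrow> bool" and I :: "'i set" and v Q
    assume H: "gauge_bound B \<and> finite I \<and> finite Q \<and> card Q \<le> 0 \<and> card I > 1 \<and>
      (\<forall>i \<in> I. B (v i) R \<and> (\<forall>q. q \<notin> Q \<longrightarrow> v i q = 0))"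
    then obtain i j where ij: "i \<in> I" "j \<in> I" "i \<noteq> j"
      by (metis card_le_Suc0_iff_eq less_le_not_le One_nat_def)
    have "B (\<lambda>q. 0 * v i q) (cmod 0 * R)" using H ij(1) unfolding gauge_bound_def by blast
    moreover have "v i q = 0" "v j q = 0" for q using H ij by auto
    ultimately have "B (\<lambda>q. v i q - v j q) 0" by simp
    then have "B (\<lambda>q. v i q - v j q) \<epsilon>" using H "0.prems" unfolding gauge_bound_def by (meson less_imp_le)
    then show "\<exists>i \<in> I. \<exists>j \<in> I. i \<noteq> j \<and> B (\<lambda>q. v i q - v j q) \<epsilon>" using ij by blast
  qed
next
  case (Suc d)
  have "\<epsilon> / 2 > 0" "2 * R \<ge> 0" using Suc.prems by simp_all
  from Suc.IH[OF this] obtain N1 where N1: "\<forall>(B :: ('q \<Rightarrow> complex) \<Rightarrow> real \<Rightarrow> bool) (I :: 'i set) v Q.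
      gauge_bound B \<and> finite I \<and> finite Q \<and> card Q \<le> d \<and> card I > N1 \<and>
      (\<forall>i \<in> I. B (v i) (2 * R) \<and> (\<forall>q. q \<notin> Q \<longrightarrow> v i q = 0)) \<longrightarrow>
      (\<exists>i \<in> I. \<exists>j \<in> I. i \<noteq> j \<and> B (\<lambda>q. v i q - v j q) (\<epsilon> / 2))"
    by (rule exE)
  \<comment> \<open>The pivot coefficients are sorted into cells of side \<open>1 / M\<close>.
    Coefficients in one cell differ by at most \<open>2 / M\<close>, which costs at most
    \<open>\<epsilon> / 2\<close> by this choice of \<open>M\<close>; the other
    \<open>\<epsilon> / 2\<close> is left for the remainders.\<close>
  obtain M0 :: nat where "real M0 \<ge> 4 * R / \<epsilon> + 1" using real_arch_simple by blast
  moreover define M where "M = real M0"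
  moreover have "4 * R / \<epsilon> \<ge> 0" using Suc.prems by simp
  ultimately have M: "M > 0" "4 * R / \<epsilon> \<le> M" by linarith+
  define T where "T = {- int M0..int M0} \<times> {- int M0..int M0}"
  have T: "finite T" "card T > 0" by (auto simp: T_def card_gt_0_iff)
  show ?case
  proof (intro exI[of _ "card T * N1"] allI impI)
    fix B :: "('q \<Rightarrow> complex) \<Rightarrow> real \<Rightarrow> bool" and I :: "'i set" and v Q
    assume H: "gauge_bound B \<and> finite I \<and> finite Q \<and> card Q \<le> Suc d \<and> card I > card T * N1 \<and>
      (\<forall>i \<in> I. B (v i) R \<and> (\<forall>q. q \<notin> Q \<longrightarrow> v i q = 0))"
    have Badd: "B u r \<Longrightarrow> B w s \<Longrightarrow> B (\<lambda>q. u q + w q) (r + s)"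
      and Bscale: "B u r \<Longrightarrow> B (\<lambda>q. t * u q) (cmod t * r)"
      and Bmono: "B u r \<Longrightarrow> r \<le> s \<Longrightarrow> B u s" for u w r s t
      using H by (auto simp: gauge_bound_def)
    have BI: "B (v i) R" if "i \<in> I" for i using H that by blast
    have "I \<noteq> {}" using H by auto
    obtain q i0 Q' where Q': "finite Q'" "card Q' \<le> d" and i0: "i0 \<in> I"
      and max: "\<And>i. i \<in> I \<Longrightarrow> cmod (v i q) \<le> cmod (v i0 q)"
      and supp: "\<And>i p. i \<in> I \<Longrightarrow> p \<notin> Q' \<Longrightarrow> p \<noteq> q \<Longrightarrow> v i p = 0"
    proof -
      obtain q Q' where Q': "finite Q'" "card Q' \<le> d" "Q \<subseteq> insert q Q'"
      proof (cases "Q = {}")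
        case True
        then show ?thesis using that[of "{}"] by auto
      next
        case False
        then obtain q where "q \<in> Q" by blast
        moreover have "card (Q - {q}) \<le> d"
          using card_Diff_singleton[OF \<open>q \<in> Q\<close>] H by linarith
        ultimately show ?thesis using that[of "Q - {q}" q] H by blast
      qed
      have fin: "finite ((\<lambda>i. cmod (v i q)) ` I)" using H by blast
      then have "Max ((\<lambda>i. cmod (v i q)) ` I) \<in> (\<lambda>i. cmod (v i q)) ` I"
        using \<open>I \<noteq> {}\<close> by (intro Max_in) auto
      then obtain i0 where i0: "i0 \<in> I" "Max ((\<lambda>i. cmod (v i q)) ` I) = cmod (v i0 q)" by auto
      show ?thesis
      proof (rule that[OF Q'(1,2) i0(1)])
        show "cmod (v i q) \<le> cmod (v i0 q)" if "i \<in> I" for i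
          using Max_ge[OF fin, of "cmod (v i q)"] i0(2) that by auto
        show "v i p = 0" if "i \<in> I" "p \<notin> Q'" "p \<noteq> q" for i p
          using H that Q'(3) by blast
      qed
    qed
    \<comment> \<open>If the pivot entry is \<open>0\<close>, maximality makes every
      \<open>q\<close>-entry \<open>0\<close>, and division by zero gives \<open>c i = 0\<close>, so
      the elimination is still correct.\<close>
    define c where "c i = v i q / v i0 q" for i
    define r where "r i p = v i p - c i * v i0 p" for i p
    have c1: "cmod (c i) \<le> 1" if "i \<in> I" for i
      using max[OF that] by (cases "v i0 q = 0") (simp_all add: c_def norm_divide divide_le_eq_1)
    have rB: "B (r i) (2 * R)" if "i \<in> I" for i
    proof -
      have "B (\<lambda>p. v i p + (- c i) * v i0 p) (R + cmod (- c i) * R)"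
        by (intro Badd Bscale BI that i0)
      moreover have "R + cmod (- c i) * R \<le> 2 * R"
        using mult_right_mono[OF c1[OF that] Suc.prems(2)] by simp
      ultimately show ?thesis using Bmono by (simp add: r_def[abs_def])
    qed
    have rsupp: "r i p = 0" if "i \<in> I" "p \<notin> Q'" for i p
    proof (cases "p = q")
      case True
      show ?thesis
        using max[OF that(1)] by (cases "v i0 q = 0") (simp_all add: r_def c_def True)
    next
      case False
      then show ?thesis using supp that i0 by (simp add: r_def)
    qed
    define cell where "cell i = (\<lfloor>M * Re (c i)\<rfloor>, \<lfloor>M * Im (c i)\<rfloor>)" for i
    have "cell i \<in> T" if "i \<in> I" for i
    proof -
      have fl: "\<lfloor>M * x\<rfloor> \<in> {- int M0..int M0}" if x: "\<bar>x\<bar> \<le> 1" for x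
      proof -
        have "M * x \<le> M * 1" "M * (- 1) \<le> M * x" using x M(1) by (intro mult_left_mono; simp)+
        then show ?thesis unfolding M_def by (auto simp: floor_le_iff le_floor_iff)
      qed
      show ?thesis
        unfolding cell_def T_def
        using fl abs_Re_le_cmod[of "c i"] abs_Im_le_cmod[of "c i"] c1[OF that] by (simp del: atLeastAtMost_iff)
    qed
    then have cellT: "cell \<in> I \<rightarrow> T" by blast
    have "\<exists>y \<in> T. card {i \<in> I. cell i = y} > N1"
    proof (rule ccontr)
      assume "\<not> ?thesis"
      then have le: "card {i \<in> I. cell i = y} \<le> N1" if "y \<in> T" for y using that by (meson not_le)
      have "I = (\<Union>y\<in>T. {i \<in> I. cell i = y})" using cellT by blast
      then have "card I \<le> (\<Sum>y\<in>T. card {i \<in> I. cell i = y})"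
        using card_UN_le[OF T(1), of "\<lambda>y. {i \<in> I. cell i = y}"] by simp
      also have "\<dots> \<le> card T * N1" using sum_bounded_above[of T, OF le] by simp
      finally show False using H by simp
    qed
    then obtain y where y: "card {i \<in> I. cell i = y} > N1" by blast
    have "\<exists>i \<in> {i \<in> I. cell i = y}. \<exists>j \<in> {i \<in> I. cell i = y}. i \<noteq> j \<and> B (\<lambda>p. r i p - r j p) (\<epsilon> / 2)"
      using H by (intro N1[rule_format, of _ _ Q'] conjI ballI allI impI)
        (auto intro: rB rsupp Q' y simp del: mult_2)
    then obtain i j where ij: "i \<in> I" "j \<in> I" "cell i = y" "cell j = y" "i \<noteq> j"
      "B (\<lambda>p. r i p - r j p) (\<epsilon> / 2)" by blast
    have "cmod (c i - c j) \<le> 2 / M"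
      using cell_estimate[OF M(1), of "c i" "c j"] ij(3,4) by (simp add: cell_def prod_eq_iff)
    then have "cmod (c i - c j) * R \<le> 2 / M * R" using Suc.prems by (intro mult_right_mono)
    also have "\<dots> \<le> \<epsilon> / 2" using M Suc.prems by (simp add: field_simps)
    finally have "\<epsilon> / 2 + cmod (c i - c j) * R \<le> \<epsilon>" by simp
    moreover have "B (\<lambda>p. (r i p - r j p) + (c i - c j) * v i0 p) (\<epsilon> / 2 + cmod (c i - c j) * R)"
      by (intro Badd ij(6) Bscale BI i0)
    ultimately have "B (\<lambda>p. (r i p - r j p) + (c i - c j) * v i0 p) \<epsilon>" using Bmono by blast
    then have "B (\<lambda>p. v i p - v j p) \<epsilon>" by (simp add: r_def algebra_simps)
    then show "\<exists>i \<in> I. \<exists>j \<in> I. i \<noteq> j \<and> B (\<lambda>q. v i q - v j q) \<epsilon>" using ij by blast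
  qed
qed

section \<open>Commuting generators and cosets\<close>

lemma (in group) centralizer_subgroup:
  assumes "S \<subseteq> carrier G"
  shows "subgroup {g \<in> carrier G. \<forall>s \<in> S. g \<otimes> s = s \<otimes> g} G" (is "subgroup ?C G")
proof (rule subgroupI)
  show "?C \<noteq> {}"
    using assms by (auto simp: subset_iff intro!: exI[of _ \<one>])
next
  fix a assume a: "a \<in> ?C"
  have "inv a \<otimes> s = s \<otimes> inv a" if "s \<in> S" for s
  proof -
    have s: "s \<in> carrier G" and as: "a \<otimes> s = s \<otimes> a" using that assms a by auto
    have "inv a \<otimes> s = inv a \<otimes> (s \<otimes> a) \<otimes> inv a" using a s by (simp add: m_assoc)
    also have "\<dots> = (inv a \<otimes> a) \<otimes> s \<otimes> inv a"
      unfolding as[symmetric] using a s by (simp flip: m_assoc)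
    also have "\<dots> = s \<otimes> inv a" using a s by simp
    finally show ?thesis .
  qed
  then show "inv a \<in> ?C" using a by auto
next
  fix a b assume ab: "a \<in> ?C" "b \<in> ?C"
  have "(a \<otimes> b) \<otimes> s = s \<otimes> (a \<otimes> b)" if "s \<in> S" for s
  proof -
    have s: "s \<in> carrier G" "a \<otimes> s = s \<otimes> a" "b \<otimes> s = s \<otimes> b" using that assms ab by auto
    have "(a \<otimes> b) \<otimes> s = a \<otimes> (s \<otimes> b)" using ab s by (simp add: m_assoc)
    also have "\<dots> = s \<otimes> (a \<otimes> b)" using ab s by (simp flip: m_assoc)
    finally show ?thesis .
  qed
  then show "a \<otimes> b \<in> ?C" using ab by auto
qed auto

text \<open>The centralizer of \<open>S\<close> contains \<open>S\<close>, hence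
  \<open>generate G S\<close>. So \<open>S\<close> lies in the centralizer of
  \<open>generate G S\<close>, and the subgroup generated by \<open>S\<close> follows.\<close>

lemma (in group) generate_commute:
  assumes S: "S \<subseteq> carrier G" and comm: "\<And>a b. a \<in> S \<Longrightarrow> b \<in> S \<Longrightarrow> a \<otimes> b = b \<otimes> a"
    and "x \<in> generate G S" "y \<in> generate G S"
  shows "x \<otimes> y = y \<otimes> x"
proof -
  let ?C = "\<lambda>S. {g \<in> carrier G. \<forall>s \<in> S. g \<otimes> s = s \<otimes> g}"
  have "generate G S \<subseteq> ?C S"
    using S comm by (intro generate_subgroup_incl centralizer_subgroup) auto
  moreover have gS: "generate G S \<subseteq> carrier G" using S by (rule generate_incl)
  ultimately have "S \<subseteq> ?C (generate G S)" using S by fastforce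
  then have "generate G S \<subseteq> ?C (generate G S)"
    by (rule generate_subgroup_incl[OF _ centralizer_subgroup[OF gS]])
  then show ?thesis using assms(3,4) by blast
qed

lemma (in group) coset_eq_of_quotient:
  assumes A: "subgroup A G" and "g \<in> carrier G" "h \<in> carrier G" "g \<otimes> inv h \<in> A"
  shows "A #> g = A #> h"
proof -
  have "g = (g \<otimes> inv h) \<otimes> h" using assms by (simp add: m_assoc)
  then have "g \<in> A #> h" using assms(4) unfolding r_coset_def by blast
  then show ?thesis using repr_independence[OF _ assms(3) A] by simp
qed

section \<open>Invariant norms, distance to the identity and commutators\<close>

definition vecs :: "nat \<Rightarrow> (nat \<Rightarrow> complex) set" where
  "vecs n = {v. \<forall>i\<ge>n. v i = 0}"

text \<open>The indices come as a pair because \<open>packing\<close> treats a whole matrix as one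
  vector.\<close>

definition mat_act :: "nat \<Rightarrow> (nat \<times> nat \<Rightarrow> complex) \<Rightarrow> (nat \<Rightarrow> complex) \<Rightarrow> nat \<Rightarrow> complex" where
  "mat_act n a v = (\<lambda>i. if i < n then \<Sum>j<n. a (i, j) * v j else 0)"

lemma mat_act_vecs: "mat_act n a v \<in> vecs n"
  by (simp add: mat_act_def vecs_def)

lemma mat_act_add: "mat_act n a (v + w) = mat_act n a v + mat_act n a w"
  by (auto simp: mat_act_def algebra_simps sum.distrib)

lemma mat_act_diff: "mat_act n a (v - w) = mat_act n a v - mat_act n a w"
  by (auto simp: mat_act_def algebra_simps sum_subtractf)

lemma vecs_diff: "v \<in> vecs n \<Longrightarrow> w \<in> vecs n \<Longrightarrow> v - w \<in> vecs n"
  by (simp add: vecs_def)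

text \<open>The matrix entries of \<open>\<rho> g\<close> outside \<open>{..<n} \<times> {..<n}\<close> are irrelevant.\<close>

locale faithful_rep = group G for G (structure) +
  fixes n :: nat and \<rho> :: "'g \<Rightarrow> nat \<Rightarrow> nat \<Rightarrow> 'k::field"
  assumes finite_G: "finite (carrier G)"
    and rep_mult: "\<lbrakk>g \<in> carrier G; h \<in> carrier G; i < n; j < n\<rbrakk>
      \<Longrightarrow> \<rho> (g \<otimes> h) i j = (\<Sum>l<n. \<rho> g i l * \<rho> h l j)"
    and rep_one: "\<lbrakk>i < n; j < n\<rbrakk> \<Longrightarrow> \<rho> \<one> i j = (if i = j then 1 else 0)"
    and rep_faithful: "\<lbrakk>g \<in> carrier G; \<And>i j. i < n \<Longrightarrow> j < n \<Longrightarrow> \<rho> g i j = (if i = j then 1 else 0)\<rbrakk>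
      \<Longrightarrow> g = \<one>"

locale complex_rep = faithful_rep G n \<rho>
  for G (structure) and n and \<rho> :: "'g \<Rightarrow> nat \<Rightarrow> nat \<Rightarrow> complex"
begin

definition T :: "'g \<Rightarrow> (nat \<Rightarrow> complex) \<Rightarrow> nat \<Rightarrow> complex" where
  "T g = mat_act n (\<lambda>(i, j). \<rho> g i j)"

lemma T_vecs: "T g v \<in> vecs n"
  by (simp add: T_def mat_act_vecs)

lemma T_diff: "T g (v - w) = T g v - T g w"
  by (simp add: T_def mat_act_diff)

lemma T_mult:
  assumes "g \<in> carrier G" "h \<in> carrier G"
  shows "T (g \<otimes> h) v = T g (T h v)"
proof
  fix i
  have "(\<Sum>j<n. (\<Sum>l<n. \<rho> g i l * \<rho> h l j) * v j) = (\<Sum>l<n. \<rho> g i l * (\<Sum>j<n. \<rho> h l j * v j))"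
    unfolding sum_distrib_left sum_distrib_right by (subst sum.swap) (simp add: mult.assoc)
  then show "T (g \<otimes> h) v i = T g (T h v) i"
    using assms by (simp add: T_def mat_act_def rep_mult)
qed

lemma T_one: "v \<in> vecs n \<Longrightarrow> T \<one> v = v"
  by (auto simp: T_def mat_act_def rep_one vecs_def if_distrib[of "\<lambda>x. x * _"] cong: if_cong)

text \<open>The sum over the group makes the l1 norm invariant; the argument needs isometries only,
  not an inner product.\<close>

definition nu :: "(nat \<Rightarrow> complex) \<Rightarrow> real" where
  "nu v = (\<Sum>g\<in>carrier G. \<Sum>i<n. cmod (T g v i))"

lemma nu_nonneg: "nu v \<ge> 0"
  by (simp add: nu_def sum_nonneg)

lemma nu_add_pointwise: "nu (\<lambda>i. v i + w i) \<le> nu v + nu w"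
  unfolding nu_def sum.distrib[symmetric]
  by (intro sum_mono) (use mat_act_add[of n _ v w] in \<open>simp add: T_def norm_triangle_ineq plus_fun_def\<close>)

lemma nu_add: "nu (v + w) \<le> nu v + nu w"
  using nu_add_pointwise[of v w] by (simp add: plus_fun_def)

lemma nu_scale: "nu (\<lambda>i. t * v i) = cmod t * nu v"
proof -
  have "T g (\<lambda>i. t * v i) i = t * T g v i" for g i
    by (simp add: T_def mat_act_def sum_distrib_left mult.left_commute)
  then show ?thesis by (simp add: nu_def norm_mult sum_distrib_left)
qed

lemma nu_uminus: "nu (- v) = nu v"
  using nu_scale[of "-1" v] by (simp add: fun_Compl_def)

lemma nu_diff: "nu (v - w) \<le> nu v + nu w"
  using nu_add[of v "- w"] by (simp add: nu_uminus)

lemma nu_invariant: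
  assumes "h \<in> carrier G"
  shows "nu (T h v) = nu v"
proof -
  have "nu (T h v) = (\<Sum>g\<in>carrier G. \<Sum>i<n. cmod (T (g \<otimes> h) v i))"
    unfolding nu_def by (intro sum.cong refl) (simp add: T_mult assms)
  also have "\<dots> = nu v"
    unfolding nu_def using assms
    by (intro sum.reindex_bij_witness[of _ "\<lambda>g. g \<otimes> inv h" "\<lambda>g. g \<otimes> h"]) (auto simp: m_assoc)
  finally show ?thesis .
qed

lemma nu_eq_0:
  assumes v: "v \<in> vecs n" and "nu v = 0"
  shows "v = 0"
proof -
  have "(\<Sum>i<n. cmod (T \<one> v i)) = 0"
    using assms(2) finite_G unfolding nu_def by (subst (asm) sum_nonneg_eq_0_iff) (auto simp: sum_nonneg)
  then have "\<forall>i<n. v i = 0"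
    using T_one[OF v] by (subst (asm) sum_nonneg_eq_0_iff) auto
  then show ?thesis using v by (auto simp: vecs_def fun_eq_iff not_less) (meson not_less)
qed

text \<open>The operator norm of \<open>T g - 1\<close>.\<close>

definition dev_bounds :: "'g \<Rightarrow> real set" where
  "dev_bounds g = {c. 0 \<le> c \<and> (\<forall>v \<in> vecs n. nu (T g v - v) \<le> c * nu v)}"

definition dev :: "'g \<Rightarrow> real" where
  "dev g = Inf (dev_bounds g)"

lemma dev_le:
  assumes "0 \<le> c" "\<And>v. v \<in> vecs n \<Longrightarrow> nu (T g v - v) \<le> c * nu v"
  shows "dev g \<le> c"
  unfolding dev_def using assms by (intro cInf_lower bdd_belowI[of _ 0]) (auto simp: dev_bounds_def)

text \<open>The infimum that defines \<open>dev\<close> is thus taken over a nonempty set. The value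
  \<open>2\<close> comes from the triangle inequality, as \<open>T g\<close> preserves
  \<open>nu\<close>.\<close>

lemma two_in_dev_bounds:
  assumes "g \<in> carrier G"
  shows "2 \<in> dev_bounds g"
proof -
  have "nu (T g v - v) \<le> 2 * nu v" for v
    using nu_diff[of "T g v" v] nu_invariant[OF assms, of v] by simp
  then show ?thesis by (simp add: dev_bounds_def)
qed

lemma dev_nonneg: "g \<in> carrier G \<Longrightarrow> dev g \<ge> 0"
  unfolding dev_def using two_in_dev_bounds[of g]
  by (intro cInf_greatest) (force, simp add: dev_bounds_def)

lemma nu_dev:
  assumes g: "g \<in> carrier G" and v: "v \<in> vecs n"
  shows "nu (T g v - v) \<le> dev g * nu v"
proof (cases "nu v = 0")
  case True
  then have "v = 0" using nu_eq_0 v by blast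
  then have "T g v - v = 0" by (simp add: T_def mat_act_def fun_eq_iff)
  then show ?thesis using True \<open>v = 0\<close> by simp
next
  case False
  then have pos: "nu v > 0" using nu_nonneg[of v] by simp
  have "nu (T g v - v) / nu v \<le> dev g"
    unfolding dev_def
  proof (rule cInf_greatest)
    show "dev_bounds g \<noteq> {}" using two_in_dev_bounds[OF g] by blast
  qed (use v pos in \<open>simp add: dev_bounds_def divide_le_eq\<close>)
  then show ?thesis using pos by (simp add: field_simps)
qed

lemma dev_eq_0:
  assumes g: "g \<in> carrier G" and "dev g \<le> 0"
  shows "g = \<one>"
proof (rule rep_faithful[OF g])
  fix i j assume ij: "i < n" "j < n"
  let ?e = "\<lambda>l. if l = j then 1 else 0 :: complex"
  have e: "?e \<in> vecs n" using ij by (auto simp: vecs_def)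
  have "nu (T g ?e - ?e) = 0"
    using nu_dev[OF g e] nu_nonneg[of "T g ?e - ?e"] mult_right_mono[OF assms(2) nu_nonneg[of ?e]] by simp
  then have "T g ?e = ?e" using nu_eq_0[OF vecs_diff[OF T_vecs e]] by (simp add: fun_eq_iff)
  then have "T g ?e i = ?e i" by simp
  then show "\<rho> g i j = (if i = j then 1 else 0)"
    using ij by (simp add: T_def mat_act_def if_distrib[of "\<lambda>x. _ * x"] cong: if_cong)
qed

text \<open>The inverse is taken of \<open>b \<otimes> a\<close> as a whole: with
  \<open>w = T (inv (b \<otimes> a)) v\<close> the displacement of \<open>v\<close> by the
  commutator becomes \<open>T a (T b w) - T b (T a w)\<close>, and \<open>w\<close> is as long as
  \<open>v\<close>.\<close>

definition commutator :: "'g \<Rightarrow> 'g \<Rightarrow> 'g" where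
  "commutator a b = (a \<otimes> b) \<otimes> inv (b \<otimes> a)"

lemma commutator_closed: "a \<in> carrier G \<Longrightarrow> b \<in> carrier G \<Longrightarrow> commutator a b \<in> carrier G"
  by (simp add: commutator_def)

lemma commutator_mult: "a \<in> carrier G \<Longrightarrow> b \<in> carrier G \<Longrightarrow> commutator a b \<otimes> (b \<otimes> a) = a \<otimes> b"
  by (simp add: commutator_def m_assoc)

lemma commutator_eq_one: "a \<in> carrier G \<Longrightarrow> b \<in> carrier G \<Longrightarrow> commutator a b = \<one> \<longleftrightarrow> a \<otimes> b = b \<otimes> a"
  by (metis commutator_mult commutator_def l_one m_closed r_inv)

text \<open>Both bounds rewrite \<open>a b - b a\<close>: as
  \<open>(a - 1) (b - 1) - (b - 1) (a - 1)\<close> for the first and as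
  \<open>a (b - 1) - (b - 1) a\<close> for the second. The second does not involve
  \<open>dev a\<close>, so it applies to arbitrary powers of \<open>a\<close>.\<close>

lemma commutator_dev:
  assumes a: "a \<in> carrier G" and b: "b \<in> carrier G"
  shows "dev (commutator a b) \<le> 2 * dev a * dev b" "dev (commutator a b) \<le> 2 * dev b"
proof -
  have *: "\<exists>w \<in> vecs n. nu w = nu v \<and> T (commutator a b) v - v = T a (T b w) - T b (T a w)"
    if v: "v \<in> vecs n" for v
  proof (intro bexI conjI)
    define w where "w = T (inv (b \<otimes> a)) v"
    show "T (inv (b \<otimes> a)) v \<in> vecs n" by (rule T_vecs)
    show "nu (T (inv (b \<otimes> a)) v) = nu v" using a b by (simp add: nu_invariant)
    have "v = T ((b \<otimes> a) \<otimes> inv (b \<otimes> a)) v" using a b v by (simp add: T_one)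
    also have "\<dots> = T (b \<otimes> a) w" unfolding w_def using a b by (intro T_mult) auto
    also have "\<dots> = T b (T a w)" using b a by (rule T_mult)
    finally have "v = T b (T a w)" .
    moreover have "T (commutator a b) v = T a (T b w)"
      using a b by (simp add: commutator_def T_mult w_def)
    ultimately show "T (commutator a b) v - v = T a (T b (T (inv (b \<otimes> a)) v)) - T b (T a (T (inv (b \<otimes> a)) v))"
      by (simp add: w_def)
  qed
  show "dev (commutator a b) \<le> 2 * dev a * dev b"
  proof (rule dev_le)
    show "0 \<le> 2 * dev a * dev b" using dev_nonneg a b by simp
    fix v assume "v \<in> vecs n"
    from *[OF this] obtain w where w: "w \<in> vecs n" "nu w = nu v"
      "T (commutator a b) v - v = T a (T b w) - T b (T a w)" by blast
    have "T a (T b w) - T b (T a w) =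
      (T a (T b w - w) - (T b w - w)) - (T b (T a w - w) - (T a w - w))"
      by (simp add: T_diff)
    then have "nu (T (commutator a b) v - v) \<le>
      nu (T a (T b w - w) - (T b w - w)) + nu (T b (T a w - w) - (T a w - w))"
      unfolding w(3) by (metis nu_diff)
    also have "\<dots> \<le> dev a * nu (T b w - w) + dev b * nu (T a w - w)"
      by (intro add_mono nu_dev a b vecs_diff T_vecs w)
    also have "\<dots> \<le> dev a * (dev b * nu w) + dev b * (dev a * nu w)"
      by (intro add_mono mult_left_mono nu_dev a b dev_nonneg w)
    finally show "nu (T (commutator a b) v - v) \<le> 2 * dev a * dev b * nu v"
      by (simp add: w(2) algebra_simps)
  qed
  show "dev (commutator a b) \<le> 2 * dev b"
  proof (rule dev_le)
    show "0 \<le> 2 * dev b" using dev_nonneg b by simp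
    fix v assume "v \<in> vecs n"
    from *[OF this] obtain w where w: "w \<in> vecs n" "nu w = nu v"
      "T (commutator a b) v - v = T a (T b w) - T b (T a w)" by blast
    have "T a (T b w) - T b (T a w) = T a (T b w - w) - (T b (T a w) - T a w)"
      by (simp add: T_diff)
    then have "nu (T (commutator a b) v - v) \<le> nu (T b w - w) + nu (T b (T a w) - T a w)"
      unfolding w(3) by (metis nu_diff nu_invariant[OF a])
    also have "\<dots> \<le> dev b * nu w + dev b * nu (T a w)"
      by (intro add_mono nu_dev b w T_vecs)
    finally show "nu (T (commutator a b) v - v) \<le> 2 * dev b * nu v"
      by (simp add: nu_invariant a w(2))
  qed
qed

text \<open>\<open>2 (g - 1) = (g^2 - 1) - (g - 1)^2\<close>, and the last square costs at most a
  quarter of \<open>g - 1\<close>; hence \<open>7/4 = 2 - 1/4\<close>.\<close>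

lemma dev_square:
  assumes g: "g \<in> carrier G" and small: "dev g \<le> 1/4"
  shows "7/4 * dev g \<le> dev (g \<otimes> g)"
proof -
  have gg: "g \<otimes> g \<in> carrier G" using g by simp
  have "dev g \<le> dev (g \<otimes> g) * (4/7)"
  proof (rule dev_le)
    show "0 \<le> dev (g \<otimes> g) * (4/7)" using dev_nonneg gg by simp
    fix v assume v: "v \<in> vecs n"
    define u where "u = T g v - v"
    have u: "u \<in> vecs n" unfolding u_def by (intro vecs_diff T_vecs v)
    have "(\<lambda>i. 2 * u i) = (T (g \<otimes> g) v - v) - (T g u - u)"
      by (simp add: u_def T_diff T_mult g fun_eq_iff)
    then have "2 * nu u \<le> nu (T (g \<otimes> g) v - v) + nu (T g u - u)"
      using nu_scale[of 2 u] nu_diff[of "T (g \<otimes> g) v - v" "T g u - u"] by simp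
    moreover have "nu (T g u - u) \<le> 1/4 * nu u"
      using nu_dev[OF g u] mult_right_mono[OF small nu_nonneg[of u]] by linarith
    ultimately have "7/4 * nu u \<le> dev (g \<otimes> g) * nu v" using nu_dev[OF gg v] by simp
    then show "nu (T g v - v) \<le> dev (g \<otimes> g) * (4/7) * nu v" by (simp add: u_def)
  qed
  then show ?thesis by simp
qed

text \<open>Written as \<open>a b = c b a\<close>: moving one factor \<open>a\<close> past
  \<open>b\<close> costs one factor \<open>c\<close>, and these factors collect because
  \<open>a\<close> commutes with \<open>c\<close>.\<close>

lemma pow_commutator:
  assumes a: "a \<in> carrier G" and b: "b \<in> carrier G"
    and comm: "a \<otimes> commutator a b = commutator a b \<otimes> a"
  shows "commutator (a [^] m) b = commutator a b [^] (m::nat)"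
proof (induction m)
  case 0
  then show ?case using b by (simp add: commutator_def)
next
  case (Suc m)
  let ?c = "commutator a b"
  have c: "?c \<in> carrier G" using a b by (rule commutator_closed)
  have "?c [^] Suc m \<otimes> (b \<otimes> a [^] Suc m) = ?c [^] Suc m \<otimes> (b \<otimes> (a [^] m \<otimes> a))" by simp
  also have "\<dots> = ?c \<otimes> ((?c [^] m \<otimes> (b \<otimes> a [^] m)) \<otimes> a)"
    using a b c nat_pow_Suc2[OF c] by (simp add: m_assoc del: nat_pow_Suc)
  also have "\<dots> = ?c \<otimes> (a [^] m \<otimes> (b \<otimes> a))"
    using a b commutator_mult[of "a [^] m" b] by (simp add: Suc[symmetric] m_assoc)
  also have "\<dots> = a [^] m \<otimes> (?c \<otimes> (b \<otimes> a))"
  proof -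
    have "a [^] k \<otimes> ?c = ?c \<otimes> a [^] k" for k :: nat
      using a c comm by (induction k) (simp_all add: m_assoc, simp flip: m_assoc)
    then show ?thesis using a b c by (simp flip: m_assoc)
  qed
  also have "\<dots> = a [^] Suc m \<otimes> b" using a b by (simp add: commutator_mult m_assoc)
  finally have "?c [^] Suc m \<otimes> (b \<otimes> a [^] Suc m) = a [^] Suc m \<otimes> b" .
  then have "(?c [^] Suc m \<otimes> (b \<otimes> a [^] Suc m)) \<otimes> inv (b \<otimes> a [^] Suc m) = commutator (a [^] Suc m) b"
    by (simp add: commutator_def)
  moreover have "(?c [^] Suc m \<otimes> (b \<otimes> a [^] Suc m)) \<otimes> inv (b \<otimes> a [^] Suc m) = ?c [^] Suc m"
    using nat_pow_closed[OF c] m_closed[OF b nat_pow_closed[OF a]]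
    by (simp only: m_assoc inv_closed r_inv r_one)
  ultimately show ?case by simp
qed

text \<open>All powers of \<open>c\<close> are commutators with \<open>b\<close>, hence near the identity; but squaring nearly
  doubles the distance to the identity.\<close>

lemma commutator_trivial:
  assumes a: "a \<in> carrier G" and b: "b \<in> carrier G" and small: "dev b \<le> 1/8"
    and comm: "a \<otimes> commutator a b = commutator a b \<otimes> a"
  shows "commutator a b = \<one>"
proof -
  let ?c = "commutator a b"
  have c: "?c \<in> carrier G" using a b by (rule commutator_closed)
  define P where "P = range (\<lambda>m::nat. ?c [^] m)"
  have PG: "P \<subseteq> carrier G" using c by (auto simp: P_def)
  then have fin: "finite (dev ` P)" using finite_G finite_subset by blast
  have "Max (dev ` P) \<in> dev ` P" by (rule Max_in[OF fin]) (simp add: P_def)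
  \<comment> \<open>A power of \<open>?c\<close> farthest from the identity: its square is again a
    power of \<open>?c\<close>, hence no farther, which the expansion factor \<open>7/4\<close>
    permits only at distance \<open>0\<close>.\<close>
  then obtain g where g: "g \<in> P" "dev g = Max (dev ` P)" by auto
  then obtain m where m: "g = ?c [^] (m::nat)" by (auto simp: P_def)
  have "dev g \<le> 1/4"
    using commutator_dev(2)[of "a [^] m" b] a b small by (simp add: m pow_commutator[OF a b comm])
  then have "7/4 * dev g \<le> dev (g \<otimes> g)" using g PG by (intro dev_square) auto
  moreover have "g \<otimes> g = ?c [^] (m + m)" by (simp add: m nat_pow_mult[OF c])
  then have "dev (g \<otimes> g) \<le> dev g" unfolding g(2) using fin by (intro Max_ge) (auto simp: P_def)
  moreover have "?c \<in> P" unfolding P_def using c by (auto intro!: image_eqI[of _ _ 1])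
  then have "dev ?c \<le> dev g" unfolding g(2) using fin by (intro Max_ge) auto
  ultimately show ?thesis using dev_eq_0[OF c] by simp
qed

text \<open>The constant \<open>1/8\<close> serves twice. Commutators of two such elements are at
  most \<open>2 * 1/8\<close> times as far from the identity as the second one, and commutators of
  such an element with an arbitrary one stay within \<open>2 * 1/8 = 1/4\<close>, the range of
  \<open>dev_square\<close>.\<close>

definition near_one :: "'g set" where
  "near_one = {g \<in> carrier G. dev g \<le> 1/8}"

text \<open>Take \<open>b\<close> nearest to the identity among the elements of
  \<open>near_one\<close> that fail to commute with \<open>a\<close>. The commutator of
  \<open>a\<close> and \<open>b\<close> is nearer still, so it commutes with \<open>a\<close>, and
  \<open>commutator_trivial\<close> applies.\<close>

lemma near_one_commute:
  assumes "a \<in> near_one" "b \<in> near_one"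
  shows "a \<otimes> b = b \<otimes> a"
proof (rule ccontr)
  assume "a \<otimes> b \<noteq> b \<otimes> a"
  define P where "P = {b \<in> near_one. a \<otimes> b \<noteq> b \<otimes> a}"
  have "finite (dev ` P)" "P \<noteq> {}"
    using finite_G assms(2) \<open>a \<otimes> b \<noteq> b \<otimes> a\<close> by (auto simp: P_def near_one_def)
  then have "Min (dev ` P) \<in> dev ` P" by (intro Min_in) auto
  then obtain b where b: "b \<in> P" "dev b = Min (dev ` P)" by auto
  have a': "a \<in> carrier G" "dev a \<le> 1/8" and b': "b \<in> carrier G" "dev b \<le> 1/8"
    and ne: "commutator a b \<noteq> \<one>"
    using assms(1) b(1) commutator_eq_one by (auto simp: P_def near_one_def)
  let ?c = "commutator a b"
  have c: "?c \<in> carrier G" using a' b' by (intro commutator_closed)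
  have "b \<noteq> \<one>" using ne a' commutator_eq_one[of a b] b' by auto
  then have pos: "dev b > 0" using dev_eq_0 b'(1) by force
  have "dev ?c \<le> 2 * dev a * dev b" by (rule commutator_dev(1)[OF a'(1) b'(1)])
  also have "\<dots> \<le> 2 * (1/8) * dev b" using a' pos by (intro mult_right_mono) auto
  finally have lt: "dev ?c < dev b" using pos by simp
  then have "?c \<notin> P" using Min_le[OF \<open>finite (dev ` P)\<close>, of "dev ?c"] b(2) by auto
  moreover have "?c \<in> near_one" using c lt b'(2) by (simp add: near_one_def)
  ultimately have "a \<otimes> ?c = ?c \<otimes> a" by (simp add: P_def)
  from commutator_trivial[OF a'(1) b' this] ne show False by blast
qed

definition bounded_by :: "(nat \<times> nat \<Rightarrow> complex) \<Rightarrow> real \<Rightarrow> bool" where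
  "bounded_by a c \<longleftrightarrow> (\<forall>w \<in> vecs n. nu (mat_act n a w) \<le> c * nu w)"

lemma gauge_bound_bounded_by: "gauge_bound bounded_by"
  unfolding gauge_bound_def
proof (intro conjI allI impI)
  fix a b :: "nat \<times> nat \<Rightarrow> complex" and r s
  assume ab: "bounded_by a r \<and> bounded_by b s"
  show "bounded_by (\<lambda>q. a q + b q) (r + s)"
    unfolding bounded_by_def
  proof
    fix w assume w: "w \<in> vecs n"
    have "mat_act n (\<lambda>q. a q + b q) w = mat_act n a w + mat_act n b w"
      by (auto simp: mat_act_def fun_eq_iff algebra_simps sum.distrib)
    then have "nu (mat_act n (\<lambda>q. a q + b q) w) \<le> nu (mat_act n a w) + nu (mat_act n b w)"
      by (simp add: nu_add)
    also have "\<dots> \<le> r * nu w + s * nu w" using ab w by (intro add_mono) (auto simp: bounded_by_def)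
    finally show "nu (mat_act n (\<lambda>q. a q + b q) w) \<le> (r + s) * nu w" by (simp add: algebra_simps)
  qed
next
  fix a :: "nat \<times> nat \<Rightarrow> complex" and r t
  assume a: "bounded_by a r"
  have "mat_act n (\<lambda>q. t * a q) w = (\<lambda>i. t * mat_act n a w i)" for w
    by (auto simp: mat_act_def fun_eq_iff sum_distrib_left mult.assoc)
  then show "bounded_by (\<lambda>q. t * a q) (cmod t * r)"
    using a by (auto simp: bounded_by_def nu_scale mult.assoc intro!: mult_left_mono)
next
  fix a :: "nat \<times> nat \<Rightarrow> complex" and r s :: real
  assume "bounded_by a r \<and> r \<le> s"
  then show "bounded_by a s"
    unfolding bounded_by_def by (meson mult_right_mono nu_nonneg order_trans)
qed

text \<open>Representatives of the cosets have operator norm at most one. Among more than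
  \<open>N\<close> of them, two differ by at most \<open>1/8\<close>; by invariance their quotient
  is near the identity, so their cosets coincide. The packing statement is a hypothesis so that
  \<open>N\<close> can be chosen before the group.\<close>

lemma abelian_subgroup_bounded_index:
  assumes N: "\<And>(B :: (nat \<times> nat \<Rightarrow> complex) \<Rightarrow> real \<Rightarrow> bool) (I :: 'g set) v Q.
    gauge_bound B \<and> finite I \<and> finite Q \<and> card Q \<le> n * n \<and> card I > N \<and>
    (\<forall>i \<in> I. B (v i) 1 \<and> (\<forall>q. q \<notin> Q \<longrightarrow> v i q = 0)) \<longrightarrow>
    (\<exists>i \<in> I. \<exists>j \<in> I. i \<noteq> j \<and> B (\<lambda>q. v i q - v j q) (1/8))"
  shows "\<exists>A. subgroup A G \<and> (\<forall>a \<in> A. \<forall>b \<in> A. a \<otimes> b = b \<otimes> a) \<and> card (rcosets A) \<le> N"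
proof -
  define A where "A = generate G near_one"
  have near: "near_one \<subseteq> carrier G" by (auto simp: near_one_def)
  have A: "subgroup A G" unfolding A_def by (rule generate_is_subgroup[OF near])
  have "\<exists>r. \<forall>c \<in> rcosets A. r c \<in> carrier G \<and> c = A #> r c"
    unfolding RCOSETS_def by (intro bchoice) auto
  then obtain r where r: "\<And>c. c \<in> rcosets A \<Longrightarrow> r c \<in> carrier G" "\<And>c. c \<in> rcosets A \<Longrightarrow> c = A #> r c"
    by blast
  have inj: "inj_on r (rcosets A)" using r(2) by (metis inj_onI)
  have "card (rcosets A) \<le> N"
  proof (rule ccontr)
    assume "\<not> card (rcosets A) \<le> N"
    then have card: "card (r ` (rcosets A)) > N" by (simp add: card_image[OF inj])
    \<comment> \<open>Irrelevant entries are cut off to obtain the support of size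
      \<open>n * n\<close> that the packing statement asks for.\<close>
    define v where "v g q = (case q of (i, j) \<Rightarrow> if i < n \<and> j < n then \<rho> g i j else 0)" for g q
    have act: "mat_act n (v g) w = T g w" for g w
      by (simp add: mat_act_def T_def v_def fun_eq_iff)
    have "bounded_by (v g) 1" if "g \<in> carrier G" for g
      by (simp add: bounded_by_def act nu_invariant[OF that])
    then have hyp: "\<forall>g \<in> r ` (rcosets A). bounded_by (v g) 1 \<and> (\<forall>q. q \<notin> {..<n} \<times> {..<n} \<longrightarrow> v g q = 0)"
      using r(1) by (auto simp: v_def)
    have "finite (r ` (rcosets A))" using finite_G r(1) by (meson finite_subset image_subsetI)
    then have "\<exists>g \<in> r ` (rcosets A). \<exists>h \<in> r ` (rcosets A). g \<noteq> h \<and> bounded_by (\<lambda>q. v g q - v h q) (1/8)"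
      using gauge_bound_bounded_by hyp card
      by (intro N[rule_format, of bounded_by "r ` (rcosets A)" "{..<n} \<times> {..<n}" v]) auto
    then obtain c d where cd: "c \<in> rcosets A" "d \<in> rcosets A" "r c \<noteq> r d"
      and bd: "bounded_by (\<lambda>q. v (r c) q - v (r d) q) (1/8)" by blast
    let ?g = "r c" and ?h = "r d"
    have gh: "?g \<in> carrier G" "?h \<in> carrier G" using r(1) cd by auto
    have "dev (?g \<otimes> inv ?h) \<le> 1/8"
    proof (rule dev_le)
      fix u assume u: "u \<in> vecs n"
      let ?w = "T (inv ?h) u"
      have "mat_act n (\<lambda>q. v ?g q - v ?h q) ?w = T ?g ?w - T ?h ?w"
        unfolding act[symmetric] by (auto simp: mat_act_def fun_eq_iff algebra_simps sum_subtractf)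
      also have "T ?g ?w = T (?g \<otimes> inv ?h) u" using gh by (simp add: T_mult)
      also have "T ?h ?w = T (?h \<otimes> inv ?h) u" using gh T_mult[of ?h "inv ?h"] by simp
      also have "\<dots> = u" using gh u by (simp add: T_one)
      finally have "nu (T (?g \<otimes> inv ?h) u - u) \<le> 1/8 * nu ?w"
        using bd T_vecs unfolding bounded_by_def by metis
      then show "nu (T (?g \<otimes> inv ?h) u - u) \<le> 1/8 * nu u" using gh by (simp add: nu_invariant)
    qed simp
    then have "?g \<otimes> inv ?h \<in> near_one" using gh by (simp add: near_one_def)
    then have "?g \<otimes> inv ?h \<in> A" unfolding A_def by (rule generate.incl)
    then have "A #> ?g = A #> ?h" using coset_eq_of_quotient[OF A gh] by blast
    then have "c = d" using r(2) cd by metis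
    with cd show False by simp
  qed
  moreover have "a \<otimes> b = b \<otimes> a" if "a \<in> A" "b \<in> A" for a b
    using generate_commute[OF near near_one_commute] that unfolding A_def by blast
  ultimately show ?thesis using A by blast
qed

end

theorem Jordan_complex:
  "\<exists>J::nat. \<forall>(G :: ('g, 'z) monoid_scheme) \<rho>. complex_rep G n \<rho> \<longrightarrow>
     (\<exists>A. subgroup A G \<and> (\<forall>a \<in> A. \<forall>b \<in> A. a \<otimes>\<^bsub>G\<^esub> b = b \<otimes>\<^bsub>G\<^esub> a) \<and> card (rcosets\<^bsub>G\<^esub> A) \<le> J)"
proof -
  obtain N :: nat where N: "\<forall>(B :: (nat \<times> nat \<Rightarrow> complex) \<Rightarrow> real \<Rightarrow> bool) (I :: 'g set) v Q.
    gauge_bound B \<and> finite I \<and> finite Q \<and> card Q \<le> n * n \<and> card I > N \<and>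
    (\<forall>i \<in> I. B (v i) 1 \<and> (\<forall>q. q \<notin> Q \<longrightarrow> v i q = 0)) \<longrightarrow>
    (\<exists>i \<in> I. \<exists>j \<in> I. i \<noteq> j \<and> B (\<lambda>q. v i q - v j q) (1/8))"
    by (rule exE[OF packing[of "1/8" 1 "n * n"]]; (assumption | simp))
  show ?thesis
    by (intro exI[of _ N] allI impI complex_rep.abelian_subgroup_bounded_index N[rule_format])
qed

section \<open>Jordan's theorem in characteristic zero\<close>

text \<open>An injective ring homomorphism applied to the entries respects matrix products and
  detects the identity matrix, so faithfulness survives.\<close>

lemma faithful_rep_complex:
  fixes \<rho> :: "'g \<Rightarrow> nat \<Rightarrow> nat \<Rightarrow> 'k::field_char_0"
  assumes "faithful_rep G n \<rho>"
  obtains \<sigma> where "complex_rep G n \<sigma>"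
proof -
  interpret faithful_rep G n \<rho> by (rule assms)
  let ?F = "(\<lambda>(g, i, j). \<rho> g i j) ` (carrier G \<times> {..<n} \<times> {..<n})"
  have "finite ?F" using finite_G by simp
  then obtain A and \<phi> :: "'k \<Rightarrow> complex" where A: "unital_subring A" "?F \<subseteq> A" and inj: "inj_on \<phi> A"
    and one: "\<phi> 1 = 1" and add: "\<And>a b. a \<in> A \<Longrightarrow> b \<in> A \<Longrightarrow> \<phi> (a + b) = \<phi> a + \<phi> b"
    and mult: "\<And>a b. a \<in> A \<Longrightarrow> b \<in> A \<Longrightarrow> \<phi> (a * b) = \<phi> a * \<phi> b"
    by (rule embed_finite_in_complex) (rule that)
  have inA: "\<rho> g i j \<in> A" if "g \<in> carrier G" "i < n" "j < n" for g i j
  proof -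
    have "\<rho> g i j \<in> ?F" by (rule image_eqI[of _ _ "(g, i, j)"]) (use that in auto)
    then show ?thesis using A(2) by blast
  qed
  have zero: "\<phi> 0 = 0"
    using add[OF unital_subringD(2,2)[OF A(1)]] by simp
  have sum: "\<phi> (sum f I) = (\<Sum>i\<in>I. \<phi> (f i)) \<and> sum f I \<in> A"
    if "finite I" "\<And>i. i \<in> I \<Longrightarrow> f i \<in> A" for f :: "nat \<Rightarrow> 'k" and I
    using that
    by (induction I) (auto simp: zero add unital_subringD(2)[OF A(1)] intro: unital_subringD(6)[OF A(1)])
  have "complex_rep G n (\<lambda>g i j. \<phi> (\<rho> g i j))"
  proof (unfold_locales)
    show "finite (carrier G)" by (rule finite_G)
  next
    fix g h i j assume g: "g \<in> carrier G" and h: "h \<in> carrier G" and ij: "i < n" "j < n"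
    have prod: "\<rho> g i l * \<rho> h l j \<in> A" if "l \<in> {..<n}" for l
      using unital_subringD(4)[OF A(1) inA[OF g] inA[OF h]] ij that by simp
    have "\<phi> (\<rho> (g \<otimes>\<^bsub>G\<^esub> h) i j) = (\<Sum>l<n. \<phi> (\<rho> g i l * \<rho> h l j))"
      using sum[of "{..<n}" "\<lambda>l. \<rho> g i l * \<rho> h l j", OF _ prod] by (simp add: rep_mult g h ij)
    also have "\<dots> = (\<Sum>l<n. \<phi> (\<rho> g i l) * \<phi> (\<rho> h l j))"
      by (intro sum.cong refl mult inA g h ij) auto
    finally show "\<phi> (\<rho> (g \<otimes>\<^bsub>G\<^esub> h) i j) = (\<Sum>l<n. \<phi> (\<rho> g i l) * \<phi> (\<rho> h l j))" .
  next
    fix i j assume "i < n" "j < n"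
    then show "\<phi> (\<rho> \<one>\<^bsub>G\<^esub> i j) = (if i = j then 1 else 0)" by (simp add: rep_one one zero)
  next
    fix g assume g: "g \<in> carrier G"
      and eq: "\<And>i j. i < n \<Longrightarrow> j < n \<Longrightarrow> \<phi> (\<rho> g i j) = (if i = j then 1 else 0)"
    show "g = \<one>\<^bsub>G\<^esub>"
    proof (rule rep_faithful[OF g])
      fix i j assume ij: "i < n" "j < n"
      have "\<phi> (\<rho> g i j) = \<phi> (if i = j then 1 else 0)" using eq[OF ij] by (simp add: one zero)
      moreover have "(if i = j then 1 else 0 :: 'k) \<in> A" using unital_subringD(1,2)[OF A(1)] by simp
      ultimately show "\<rho> g i j = (if i = j then 1 else 0)" by (rule inj_onD[OF inj _ inA[OF g ij]])
    qed
  qed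
  then show ?thesis by (rule that)
qed

text \<open>\<open>N\<close> is the kernel of the action on the right cosets of \<open>A\<close>. It
  fixes the coset \<open>A\<close>, so it lies in \<open>A\<close>; and its own cosets are told
  apart by the maps that they induce on the cosets of \<open>A\<close>, which gives the
  bound.\<close>

lemma (in group) core_bounded_index:
  assumes fin: "finite (carrier G)" and A: "subgroup A G"
  obtains N where "N \<lhd> G" "N \<subseteq> A" "card (rcosets N) \<le> card (rcosets A) ^ card (rcosets A)"
proof -
  define Q where "Q = rcosets A"
  have AG: "A \<subseteq> carrier G" using A subgroup.subset by blast
  have Q_sub: "c \<subseteq> carrier G" if "c \<in> Q" for c
    using that AG unfolding Q_def RCOSETS_def by (auto dest: r_coset_subset_G)
  have Q_act: "c #> g \<in> Q" if c: "c \<in> Q" and g: "g \<in> carrier G" for c g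
  proof -
    obtain x where x: "x \<in> carrier G" "c = A #> x" using c by (auto simp: Q_def RCOSETS_def)
    then have "c #> g = A #> (x \<otimes> g)" using g AG by (simp add: coset_mult_assoc)
    then show ?thesis using x g unfolding Q_def RCOSETS_def by blast
  qed
  have act: "c #> (g \<otimes> h) = (c #> g) #> h" if "c \<in> Q" "g \<in> carrier G" "h \<in> carrier G" for c g h
    using that Q_sub by (simp add: coset_mult_assoc)
  have act1: "c #> \<one> = c" if "c \<in> Q" for c
    using that Q_sub by (simp add: coset_mult_one)
  define N where "N = {g \<in> carrier G. \<forall>c \<in> Q. c #> g = c}"
  have inv: "c #> inv g = d" if "d \<in> Q" "g \<in> carrier G" "d #> g = c" for c d g
    using act[OF that(1,2) inv_closed[OF that(2)]] act1[OF that(1)] that by simp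
  have N: "subgroup N G"
  proof (rule subgroupI)
    show "N \<noteq> {}" using act1 by (auto simp: N_def)
    show "inv a \<in> N" if "a \<in> N" for a using that inv by (auto simp: N_def)
    show "a \<otimes> b \<in> N" if "a \<in> N" "b \<in> N" for a b using that by (auto simp: N_def act)
  qed (auto simp: N_def)
  have "N \<lhd> G"
    unfolding normal_inv_iff
  proof (intro conjI ballI N)
    fix x h assume x: "x \<in> carrier G" and h: "h \<in> N"
    have hG: "h \<in> carrier G" using h by (simp add: N_def)
    have "c #> (x \<otimes> h \<otimes> inv x) = c" if c: "c \<in> Q" for c
    proof -
      have "c #> (x \<otimes> h \<otimes> inv x) = ((c #> x) #> h) #> inv x"
        using c x hG by (simp add: act Q_act)
      also have "(c #> x) #> h = c #> x" using h Q_act[OF c x] by (simp add: N_def)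
      also have "(c #> x) #> inv x = c" using inv[OF c x refl] .
      finally show ?thesis .
    qed
    then show "x \<otimes> h \<otimes> inv x \<in> N" using x hG by (simp add: N_def)
  qed
  moreover have "N \<subseteq> A"
  proof
    fix g assume g: "g \<in> N"
    have "A \<in> Q" unfolding Q_def using subgroup.subgroup_in_rcosets[OF A is_group] .
    then have "A #> g = A" using g by (simp add: N_def)
    then show "g \<in> A" using coset_join1[OF _ _ A] g by (simp add: N_def)
  qed
  moreover have "card (rcosets N) \<le> card Q ^ card Q"
  proof -
    have finQ: "finite Q" unfolding Q_def RCOSETS_def using fin by simp
    have "\<exists>r. \<forall>c \<in> rcosets N. r c \<in> carrier G \<and> c = N #> r c"
      unfolding RCOSETS_def by (intro bchoice) auto
    then obtain r where r: "\<And>c. c \<in> rcosets N \<Longrightarrow> r c \<in> carrier G" "\<And>c. c \<in> rcosets N \<Longrightarrow> c = N #> r c"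
      by blast
    define f where "f d = (\<lambda>c \<in> Q. c #> r d)" for d
    have "inj_on f (rcosets N)"
    proof (rule inj_onI)
      fix d e assume d: "d \<in> rcosets N" and e: "e \<in> rcosets N" and eq: "f d = f e"
      have "c #> (r d \<otimes> inv r e) = c" if c: "c \<in> Q" for c
      proof -
        have "c #> r d = c #> r e" using fun_cong[OF eq, of c] c by (simp add: f_def)
        then show ?thesis using act[OF c r(1)[OF d] inv_closed[OF r(1)[OF e]]] inv[OF c r(1)[OF e] refl] by simp
      qed
      then have "r d \<otimes> inv r e \<in> N" using r(1) d e by (simp add: N_def)
      then have "N #> r d = N #> r e" using coset_eq_of_quotient[OF N] r(1) d e by blast
      then show "d = e" using r(2) d e by metis
    qed
    moreover have "f ` (rcosets N) \<subseteq> Q \<rightarrow>\<^sub>E Q" using r(1) Q_act by (auto simp: f_def)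
    moreover have "finite (Q \<rightarrow>\<^sub>E Q)" using finQ by (intro finite_PiE) auto
    ultimately have "card (rcosets N) \<le> card (Q \<rightarrow>\<^sub>E Q)" by (rule card_inj_on_le)
    also have "\<dots> = card Q ^ card Q" using finQ by (simp add: card_PiE)
    finally show ?thesis .
  qed
  ultimately show ?thesis using that unfolding Q_def by blast
qed

theorem Jordan_virtually_linear:
  "\<exists>J::nat. J > 0 \<and> (\<forall>(G :: ('g, 'z) monoid_scheme) H (\<rho> :: 'g \<Rightarrow> nat \<Rightarrow> nat \<Rightarrow> 'k::field_char_0).
     group G \<and> finite (carrier G) \<and> subgroup H G \<and> card (carrier G) \<le> c * card H \<and>
     faithful_rep (G\<lparr>carrier := H\<rparr>) n \<rho> \<longrightarrow>
     (\<exists>A. A \<lhd> G \<and> comm_group (G\<lparr>carrier := A\<rparr>) \<and> card (rcosets\<^bsub>G\<^esub> A) \<le> J))"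
proof -
  from Jordan_complex[of n] obtain J :: nat where
    J: "\<And>(G :: ('g, 'z) monoid_scheme) \<rho>. complex_rep G n \<rho> \<Longrightarrow>
      \<exists>A. subgroup A G \<and> (\<forall>a \<in> A. \<forall>b \<in> A. a \<otimes>\<^bsub>G\<^esub> b = b \<otimes>\<^bsub>G\<^esub> a) \<and> card (rcosets\<^bsub>G\<^esub> A) \<le> J"
    by meson
  \<comment> \<open>By Lagrange's theorem \<open>c * J\<close> bounds the index in \<open>G\<close>
    of the abelian subgroup of \<open>H\<close>. The successor keeps the base positive, so that
    powers are monotone in the exponent and the final bound is positive.\<close>
  define M where "M = Suc (c * J)"
  have "\<exists>A. A \<lhd> G \<and> comm_group (G\<lparr>carrier := A\<rparr>) \<and> card (rcosets\<^bsub>G\<^esub> A) \<le> M ^ M"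
    if G: "group G" and fin: "finite (carrier G)" and H: "subgroup H G"
      and card: "card (carrier G) \<le> c * card H" and rep: "faithful_rep (G\<lparr>carrier := H\<rparr>) n \<rho>"
    for G :: "('g, 'z) monoid_scheme" and H and \<rho> :: "'g \<Rightarrow> nat \<Rightarrow> nat \<Rightarrow> 'k"
  proof -
    interpret group G by (rule G)
    interpret H: group "G\<lparr>carrier := H\<rparr>" using subgroup_imp_group[OF H] .
    obtain \<sigma> where "complex_rep (G\<lparr>carrier := H\<rparr>) n \<sigma>" using faithful_rep_complex[OF rep] .
    from J[OF this] obtain A where A: "subgroup A (G\<lparr>carrier := H\<rparr>)"
      and comm: "\<And>a b. a \<in> A \<Longrightarrow> b \<in> A \<Longrightarrow> a \<otimes>\<^bsub>G\<^esub> b = b \<otimes>\<^bsub>G\<^esub> a"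
      and index: "card (rcosets\<^bsub>G\<lparr>carrier := H\<rparr>\<^esub> A) \<le> J" by auto
    have AG: "subgroup A G" using incl_subgroup[OF H A] .
    have finA: "finite A" using finite_subset[OF subgroup.subset[OF AG] fin] .
    have Apos: "card A > 0" using subgroup.one_closed[OF AG] finA by (auto simp: card_gt_0_iff)
    have "card H \<le> J * card A"
      using H.lagrange[OF A] index by (simp add: order_def) (metis mult_le_mono1)
    then have "card (carrier G) \<le> c * J * card A"
      using order_trans[OF card mult_le_mono2[of "card H" "J * card A" c]] by (simp add: mult.assoc)
    then have "card (rcosets\<^bsub>G\<^esub> A) * card A \<le> c * J * card A"
      using lagrange[OF AG] by (simp add: order_def)
    then have m: "card (rcosets\<^bsub>G\<^esub> A) \<le> M" using Apos by (simp add: M_def)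
    obtain N where N: "N \<lhd> G" "N \<subseteq> A"
      "card (rcosets\<^bsub>G\<^esub> N) \<le> card (rcosets\<^bsub>G\<^esub> A) ^ card (rcosets\<^bsub>G\<^esub> A)"
      using core_bounded_index[OF fin AG] .
    have "card (rcosets\<^bsub>G\<^esub> A) ^ card (rcosets\<^bsub>G\<^esub> A) \<le> M ^ card (rcosets\<^bsub>G\<^esub> A)"
      using m by (rule power_mono) simp
    also have "\<dots> \<le> M ^ M" using m by (intro power_increasing) (simp_all add: M_def)
    finally have "card (rcosets\<^bsub>G\<^esub> N) \<le> M ^ M" using N(3) by simp
    moreover have "comm_group (G\<lparr>carrier := N\<rparr>)"
    proof -
      have "subgroup N G" using N(1) by (simp add: normal_imp_subgroup)
      from subgroup_imp_group[OF this] show ?thesis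
        using comm N(2) by (intro group.group_comm_groupI) auto
    qed
    ultimately show ?thesis using N(1) by blast
  qed
  moreover have "M ^ M > 0" by (simp add: M_def)
  ultimately show ?thesis by (intro exI[of _ "M ^ M"] conjI allI impI) (assumption, elim conjE)
qed

section \<open>Polynomial functions\<close>

lemma poly_functions_unital_subring: "unital_subring (poly_functions n :: ((nat \<Rightarrow> 'k::field) \<Rightarrow> 'k) set)"
proof -
  have m: "(\<lambda>x. c * p x) \<in> poly_functions n" if "p \<in> poly_functions n" for c and p :: "(nat \<Rightarrow> 'k) \<Rightarrow> 'k"
    by (intro poly_functions.mult poly_functions.const that)
  have "(\<lambda>x. p x + - 1 * q x) \<in> poly_functions n" if "p \<in> poly_functions n" "q \<in> poly_functions n"
    for p q :: "(nat \<Rightarrow> 'k) \<Rightarrow> 'k"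
    by (intro poly_functions.add m that)
  then show ?thesis
    by (auto simp: unital_subring_def one_fun_def fun_diff_def times_fun_def
        intro: poly_functions.const poly_functions.mult)
qed

lemma poly_functions_0: "poly_functions 0 = range (\<lambda>c (x :: nat \<Rightarrow> 'k::field). c)"
proof
  show "poly_functions 0 \<subseteq> range (\<lambda>c (x :: nat \<Rightarrow> 'k). c)"
  proof
    fix p :: "(nat \<Rightarrow> 'k) \<Rightarrow> 'k" assume "p \<in> poly_functions 0"
    then show "p \<in> range (\<lambda>c x. c)" by induction auto
  qed
qed (auto intro: poly_functions.const)

lemma poly_functions_mono: "p \<in> poly_functions n \<Longrightarrow> p \<in> poly_functions (Suc n)"
  by (induction rule: poly_functions.induct) (auto intro: poly_functions.intros)

lemma poly_functions_Suc:
  "poly_functions (Suc n) = adjoin (poly_functions n) (\<lambda>x :: nat \<Rightarrow> 'k::field. x n)"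
proof
  let ?A = "adjoin (poly_functions n) (\<lambda>x :: nat \<Rightarrow> 'k. x n)"
  note R = poly_functions_unital_subring
  have A: "unital_subring ?A" by (rule unital_subring_adjoin[OF R])
  show "poly_functions (Suc n) \<subseteq> ?A"
  proof
    fix p :: "(nat \<Rightarrow> 'k) \<Rightarrow> 'k" assume "p \<in> poly_functions (Suc n)"
    then show "p \<in> ?A"
    proof induction
      case (const c)
      then show ?case using base_subset_adjoin[OF R] poly_functions.const by blast
    next
      case (coord i)
      then show ?case
        using base_subset_adjoin[OF R] poly_functions.coord[of i n] gen_in_adjoin[OF R]
        by (cases "i = n") auto
    next
      case (add p q)
      then show ?case using unital_subringD(6)[OF A, of p q] by (simp add: plus_fun_def)
    next
      case (mult p q)
      then show ?case using unital_subringD(4)[OF A, of p q] by (simp add: times_fun_def)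
    qed
  qed
  note R' = poly_functions_unital_subring[of "Suc n"]
  have "f \<in> poly_functions (Suc n)" if "f \<in> polys_below (poly_functions n) (\<lambda>x :: nat \<Rightarrow> 'k. x n) d" for f d
    using that
  proof (induction d arbitrary: f)
    case 0
    then show ?case by (simp add: zero_fun_def poly_functions.const)
  next
    case (Suc d)
    then obtain c g where "f = c * (\<lambda>x. x n) ^ d + g" "c \<in> poly_functions n"
      "g \<in> polys_below (poly_functions n) (\<lambda>x. x n) d" by auto
    then show ?case
      by (simp only:) (intro unital_subringD(4,6,7)[OF R'] poly_functions_mono poly_functions.coord Suc.IH lessI)
  qed
  then show "?A \<subseteq> poly_functions (Suc n)" by (auto simp: adjoin_def)
qed

text \<open>Without variables the ring is the field of constants, where one nonzero element already
  makes an ideal the whole ring.\<close>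

lemma noetherian_poly_functions: "noetherian_subring (poly_functions n :: ((nat \<Rightarrow> 'k::field) \<Rightarrow> 'k) set)"
proof (induction n)
  case 0
  let ?S = "poly_functions 0 :: ((nat \<Rightarrow> 'k) \<Rightarrow> 'k) set"
  have "\<exists>N. \<forall>m\<ge>N. I m = I N" if I: "\<And>m::nat. ideal_of ?S (I m)" and inc: "incseq I" for I
  proof (cases "\<exists>N. \<exists>f \<in> I N. f \<noteq> 0")
    case True
    then obtain N f where f: "f \<in> I N" "f \<noteq> 0" by blast
    then obtain c where c: "f = (\<lambda>x. c)" using ideal_ofD(1)[OF I f(1)] by (auto simp: poly_functions_0)
    then have "c \<noteq> 0" using f(2) by (auto simp: zero_fun_def)
    then have one: "1 = (\<lambda>x. inverse c) * f" by (simp add: c fun_eq_iff)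
    have "?S = I m" if "m \<ge> N" for m
    proof
      have "f \<in> I m" using incseqD[OF inc that] f(1) by blast
      then have "1 \<in> I m" unfolding one by (rule ideal_ofD(4)[OF I poly_functions.const])
      then show "?S \<subseteq> I m" using ideal_ofD(4)[OF I, of _ 1 m] by auto
      show "I m \<subseteq> ?S" using ideal_ofD(1)[OF I] by blast
    qed
    then show ?thesis by (metis order_refl)
  next
    case False
    then have "I m = {0}" for m using ideal_ofD(2)[OF I] by blast
    then show ?thesis by simp
  qed
  then show ?case
    unfolding noetherian_subring_def using poly_functions_unital_subring by (intro conjI allI impI) simp_all
next
  case (Suc n)
  show ?case unfolding poly_functions_Suc by (rule Hilbert_basis[OF Suc])
qed

lemma ideal_of_gen_by:
  assumes S: "unital_subring S" and t: "\<And>i. i < n \<Longrightarrow> t i \<in> S"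
  shows "ideal_of S (gen_by S n t)"
  unfolding ideal_of_def
proof (intro conjI ballI)
  have "(\<Sum>i\<in>F. t i * s i) \<in> S" if "finite F" "F \<subseteq> {..<n}" "\<forall>i<n. s i \<in> S" for F s
    using that by (induction F) (auto intro: t unital_subringD[OF S])
  then show "gen_by S n t \<subseteq> S" by (auto simp: gen_by_def)
  show "0 \<in> gen_by S n t"
    unfolding gen_by_def using unital_subringD(2)[OF S] by (auto intro!: exI[of _ "\<lambda>_. 0"])
next
  fix a b assume "a \<in> gen_by S n t" "b \<in> gen_by S n t"
  then obtain s s' where "a = (\<Sum>i<n. t i * s i)" "\<forall>i<n. s i \<in> S" "b = (\<Sum>i<n. t i * s' i)" "\<forall>i<n. s' i \<in> S"
    by (auto simp: gen_by_def)
  then have "a + b = (\<Sum>i<n. t i * (s i + s' i))" "\<forall>i<n. s i + s' i \<in> S"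
    using unital_subringD(6)[OF S] by (auto simp: distrib_left sum.distrib)
  then show "a + b \<in> gen_by S n t"
    unfolding gen_by_def by (intro CollectI exI[of _ "\<lambda>i. s i + s' i"]) simp
next
  fix r a assume r: "r \<in> S" and "a \<in> gen_by S n t"
  then obtain s where "a = (\<Sum>i<n. t i * s i)" "\<forall>i<n. s i \<in> S" by (auto simp: gen_by_def)
  then have "r * a = (\<Sum>i<n. t i * (r * s i))" "\<forall>i<n. r * s i \<in> S"
    using unital_subringD(4)[OF S r] by (auto simp: sum_distrib_left mult.left_commute)
  then show "r * a \<in> gen_by S n t"
    unfolding gen_by_def by (intro CollectI exI[of _ "\<lambda>i. r * s i"]) simp
qed

section \<open>The maximal ideal of a point of affine space\<close>

definition coord_at :: "(nat \<Rightarrow> 'k::field) \<Rightarrow> nat \<Rightarrow> (nat \<Rightarrow> 'k) \<Rightarrow> 'k" where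
  "coord_at a i = (\<lambda>x. x i - a i)"

lemma coord_at_poly: "i < n \<Longrightarrow> coord_at a i \<in> poly_functions n"
  using poly_functions.add[OF poly_functions.coord[of i n] poly_functions.const[of "- a i"]]
  by (simp add: coord_at_def)

definition vanishing_at :: "nat \<Rightarrow> (nat \<Rightarrow> 'k::field) \<Rightarrow> ((nat \<Rightarrow> 'k) \<Rightarrow> 'k) set" where
  "vanishing_at n a = {p \<in> poly_functions n. p a = 0}"

lemma ideal_of_vanishing_at: "ideal_of (poly_functions n) (vanishing_at n a)"
  using unital_subringD[OF poly_functions_unital_subring[of n]]
  by (auto simp: ideal_of_def vanishing_at_def)

text \<open>Induction on \<open>p\<close> shows that \<open>p - p a\<close> lies in the ideal
  generated by the shifted coordinates; for products use
  \<open>p q - p a * q a = q (p - p a) + p a * (q - q a)\<close>.\<close>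

lemma vanishing_at_gen_by: "vanishing_at n a \<subseteq> gen_by (poly_functions n) n (coord_at a)"
proof
  let ?S = "poly_functions n" and ?G = "gen_by (poly_functions n) n (coord_at a)"
  note S = poly_functions_unital_subring[of n]
  have G: "ideal_of ?S ?G" by (rule ideal_of_gen_by[OF S coord_at_poly])
  fix p assume p: "p \<in> vanishing_at n a"
  have "p - (\<lambda>_. p a) \<in> ?G" if "p \<in> poly_functions n" for p
    using that
  proof induction
    case (const c)
    then show ?case using ideal_ofD(2)[OF G] by (simp add: fun_diff_def zero_fun_def)
  next
    case (coord i)
    have "coord_at a i = (\<Sum>j<n. coord_at a j * (if j = i then 1 else 0))"
      using coord by (simp add: if_distrib[of "\<lambda>x. _ * x"] cong: if_cong)
    then have "coord_at a i \<in> ?G"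
      unfolding gen_by_def using unital_subringD(1,2)[OF S]
      by (auto intro!: exI[of _ "\<lambda>j. if j = i then 1 else 0"])
    moreover have "(\<lambda>x. x i) - (\<lambda>_. a i) = coord_at a i" by (simp add: coord_at_def fun_eq_iff)
    ultimately show ?case by (simp only:)
  next
    case (add p q)
    have "(\<lambda>x. p x + q x) - (\<lambda>_. p a + q a) = (p - (\<lambda>_. p a)) + (q - (\<lambda>_. q a))"
      by (simp add: fun_eq_iff)
    then show ?case using ideal_ofD(3)[OF G add.IH] by (simp only:)
  next
    case (mult p q)
    have "(\<lambda>x. p x * q x) - (\<lambda>_. p a * q a) = q * (p - (\<lambda>_. p a)) + (\<lambda>_. p a) * (q - (\<lambda>_. q a))"
      by (simp add: fun_eq_iff algebra_simps)
    then show ?case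
      using ideal_ofD(3)[OF G ideal_ofD(4)[OF G mult.hyps(2) mult.IH(1)] ideal_ofD(4)[OF G poly_functions.const mult.IH(2)]]
      by (simp only:)
  qed
  moreover have "p \<in> poly_functions n" using p by (simp add: vanishing_at_def)
  ultimately have "p - (\<lambda>_. p a) \<in> ?G" by blast
  moreover have "p - (\<lambda>_. p a) = p" using p by (simp add: vanishing_at_def fun_eq_iff)
  ultimately show "p \<in> ?G" by (simp only:)
qed

lemma ideal_power_mult:
  assumes S: "unital_subring S" and I: "ideal_of S I"
    and "p \<in> ideal_power S I i" "q \<in> ideal_power S I j"
  shows "p * q \<in> ideal_power S I (i + j)"
  using assms(3)
proof (induction i arbitrary: p)
  case 0
  then show ?case using ideal_ofD(4)[OF ideal_of_ideal_power[OF S I]] assms(4) by simp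
next
  case (Suc i)
  from Suc.prems have "p \<in> ideal_prod I (ideal_power S I i)" by simp
  then have "p * q \<in> ideal_prod I (ideal_power S I (i + j))"
  proof induction
    case (step a b c)
    then show ?case using Suc.IH[OF step(2)] by (auto simp: distrib_right mult.assoc intro: ideal_prod.step)
  qed (simp add: ideal_prod.zero)
  then show ?case by simp
qed

lemma ideal_power_Suc_subset:
  assumes S: "unital_subring S" and I: "ideal_of S I"
  shows "ideal_power S I (Suc n) \<subseteq> ideal_power S I n"
proof
  note P = ideal_of_ideal_power[OF S I, of n]
  fix x assume "x \<in> ideal_power S I (Suc n)"
  then have "x \<in> ideal_prod I (ideal_power S I n)" by simp
  then show "x \<in> ideal_power S I n"
    by induction (auto intro: ideal_ofD[OF P] ideal_ofD(1)[OF I])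
qed

section \<open>Affine charts\<close>

lemma openin_zariski_nonzero:
  assumes "q \<in> poly_functions n"
  shows "openin (zariski_topology n) {y \<in> affine_space n. q y \<noteq> 0}"
proof -
  have "affine_space n - {y \<in> affine_space n. q y \<noteq> 0} = zero_locus n {q}"
    by (auto simp: zero_locus_def)
  then show ?thesis
    using assms unfolding openin_zariski_topology algebraic_set_def by blast
qed

lemma algebraic_set_subset: "algebraic_set n V \<Longrightarrow> V \<subseteq> affine_space n"
  by (auto simp: algebraic_set_def zero_locus_def)

lemma points_affine_variety: "algebraic_set n V \<Longrightarrow> points (affine_variety n V) = V"
  using algebraic_set_subset[of n V] by (auto simp: affine_variety_def topspace_zariski_topology)

lemma regular_affine_variety_iff:
  "f \<in> regular (affine_variety n V) D \<longleftrightarrow> (\<forall>x \<in> D. \<exists>W p q.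
     openin (space_top (affine_variety n V)) W \<and> x \<in> W \<and> W \<subseteq> D \<and>
     p \<in> poly_functions n \<and> q \<in> poly_functions n \<and> (\<forall>y \<in> W. q y \<noteq> 0 \<and> f y = p y / q y))"
  by (simp add: affine_variety_def)

text \<open>The chart is fixed once so that regular functions become, locally, fractions of
  polynomials in the ambient coordinates.\<close>

locale affine_chart = space_with_functions X for X :: "('a, 'k::field) fn_space" +
  fixes U n V \<phi> \<psi>
  assumes open_U: "openin (space_top X) U"
    and alg: "algebraic_set n V"
    and mor: "morphism (open_subspace X U) (affine_variety n V) \<phi>"
    and mor_inv: "morphism (affine_variety n V) (open_subspace X U) \<psi>"
    and left_inv: "z \<in> U \<Longrightarrow> \<psi> (\<phi> z) = z"
begin

lemma points_U: "points (open_subspace X U) = U"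
  using openin_subset[OF open_U] by (auto simp: open_subspace_def)

lemma chart_into: "z \<in> U \<Longrightarrow> \<phi> z \<in> V"
  using mor by (auto simp: morphism_def continuous_map_def points_U points_affine_variety[OF alg])

lemma openin_chart_preimage:
  assumes "openin (space_top (affine_variety n V)) D"
  shows "openin (space_top X) {z \<in> U. \<phi> z \<in> D}"
proof -
  have "openin (space_top (open_subspace X U)) {z \<in> points (open_subspace X U). \<phi> z \<in> D}"
    using mor assms by (auto simp: morphism_def intro: openin_continuous_map_preimage)
  then show ?thesis
    unfolding points_U using openin_open_subtopology[OF open_U] by (simp add: open_subspace_def)
qed

lemma openin_chart_nonzero:
  assumes "q \<in> poly_functions n"
  shows "openin (space_top X) {z \<in> U. q (\<phi> z) \<noteq> 0}"
proof -
  let ?D = "{y \<in> V. q y \<noteq> 0}"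
  have "?D = {y \<in> affine_space n. q y \<noteq> 0} \<inter> V" using algebraic_set_subset[OF alg] by blast
  then have "openin (space_top (affine_variety n V)) ?D"
    using openin_zariski_nonzero[OF assms] by (auto simp: affine_variety_def openin_subtopology)
  from openin_chart_preimage[OF this] show ?thesis
    using chart_into by (simp add: conj_commute cong: conj_cong)
qed

lemma chart_fraction_regular:
  assumes p: "p \<in> poly_functions n" and q: "q \<in> poly_functions n"
  shows "(\<lambda>z. p (\<phi> z) / q (\<phi> z)) \<in> regular X {z \<in> U. q (\<phi> z) \<noteq> 0}"
proof -
  let ?D = "{y \<in> V. q y \<noteq> 0}"
  have "?D = {y \<in> affine_space n. q y \<noteq> 0} \<inter> V" using algebraic_set_subset[OF alg] by blast
  then have D: "openin (space_top (affine_variety n V)) ?D"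
    using openin_zariski_nonzero[OF q] by (auto simp: affine_variety_def openin_subtopology)
  have "(\<lambda>y. p y / q y) \<in> regular (affine_variety n V) ?D"
    unfolding regular_affine_variety_iff
    by (rule ballI, rule exI[of _ ?D], rule exI[of _ p], rule exI[of _ q]) (use D p q in simp)
  then have "(\<lambda>y. p y / q y) \<circ> \<phi> \<in> regular (open_subspace X U) {z \<in> U. \<phi> z \<in> ?D}"
    using mor D unfolding morphism_def points_U by blast
  moreover have "{z \<in> U. \<phi> z \<in> ?D} = {z \<in> U. q (\<phi> z) \<noteq> 0}" using chart_into by blast
  ultimately show ?thesis by (simp add: open_subspace_def comp_def)
qed

lemma regular_local_fraction:
  assumes W: "openin (space_top X) W" and f: "f \<in> regular X W" and x: "x \<in> W" "x \<in> U"
  shows "\<exists>p q W'. p \<in> poly_functions n \<and> q \<in> poly_functions n \<and> openin (space_top X) W' \<and> x \<in> W' \<and>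
    W' \<subseteq> W \<inter> U \<and> (\<forall>z \<in> W'. q (\<phi> z) \<noteq> 0 \<and> f z * q (\<phi> z) = p (\<phi> z))"
proof -
  let ?Y = "affine_variety n V"
  have WU: "openin (space_top X) (W \<inter> U)" using W open_U by blast
  then have "f \<in> regular (open_subspace X U) (W \<inter> U)"
    using regular_subset[OF W WU _ f] by (simp add: open_subspace_def)
  moreover have "openin (space_top (open_subspace X U)) (W \<inter> U)"
    using W by (auto simp: open_subspace_def openin_subtopology)
  ultimately have reg: "f \<circ> \<psi> \<in> regular ?Y {y \<in> V. \<psi> y \<in> W \<inter> U}"
    using mor_inv unfolding morphism_def points_affine_variety[OF alg] by blast
  have "\<phi> x \<in> {y \<in> V. \<psi> y \<in> W \<inter> U}" using x chart_into left_inv by simp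
  from bspec[OF reg[unfolded regular_affine_variety_iff] this] obtain D p q where
    D: "openin (space_top ?Y) D" "\<phi> x \<in> D" "D \<subseteq> {y \<in> V. \<psi> y \<in> W \<inter> U}"
    and pq: "p \<in> poly_functions n" "q \<in> poly_functions n" "\<forall>y \<in> D. q y \<noteq> 0 \<and> (f \<circ> \<psi>) y = p y / q y"
    by (elim exE conjE)
  have "\<forall>z \<in> {z \<in> U. \<phi> z \<in> D}. q (\<phi> z) \<noteq> 0 \<and> f z * q (\<phi> z) = p (\<phi> z)"
    using pq(3) left_inv by (auto simp: field_simps)
  moreover have "{z \<in> U. \<phi> z \<in> D} \<subseteq> W \<inter> U" using D(3) left_inv by fastforce
  ultimately show ?thesis
    using openin_chart_preimage[OF D(1)] D(2) x(2) pq(1,2) by blast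
qed

end

section \<open>The order filtration at a point\<close>

locale pointed_chart = affine_chart X U n V \<phi> \<psi>
  for X :: "('a, 'k::field) fn_space" and U n V \<phi> \<psi> +
  fixes x :: 'a
  assumes x_in_U: "x \<in> U"
begin

text \<open>This is the ring of ambient polynomial functions, not the coordinate ring of
  \<open>V\<close>. Polynomials that vanish on the variety near \<open>x\<close> are accounted for
  by the ideal \<open>J\<close> in \<open>ord_ge_infinite\<close>.\<close>

abbreviation "S \<equiv> poly_functions n :: ((nat \<Rightarrow> 'k) \<Rightarrow> 'k) set"
abbreviation "I \<equiv> vanishing_at n (\<phi> x)"

lemmas S_ring = poly_functions_unital_subring[of n, where ?'k = 'k]
lemmas I_ideal = ideal_of_vanishing_at[of n "\<phi> x"]
lemmas I_power_ideal = ideal_of_ideal_power[OF S_ring I_ideal]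

text \<open>Equality of germs at \<open>x\<close> for total functions: sums, products and composites
  can then be formed pointwise, without domains.\<close>

definition near :: "('a \<Rightarrow> 'k) \<Rightarrow> ('a \<Rightarrow> 'k) \<Rightarrow> bool" where
  "near f g \<longleftrightarrow> (\<exists>W. openin (space_top X) W \<and> x \<in> W \<and> (\<forall>z \<in> W. f z = g z))"

definition chart_frac :: "('a \<Rightarrow> 'k) \<Rightarrow> ((nat \<Rightarrow> 'k) \<Rightarrow> 'k) \<Rightarrow> ((nat \<Rightarrow> 'k) \<Rightarrow> 'k) \<Rightarrow> bool" where
  "chart_frac f P Q \<longleftrightarrow> (\<exists>W. openin (space_top X) W \<and> x \<in> W \<and> W \<subseteq> U \<and>
     (\<forall>z \<in> W. Q (\<phi> z) \<noteq> 0 \<and> f z * Q (\<phi> z) = P (\<phi> z)))"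

text \<open>\<open>ord_ge N\<close> is the preimage of \<open>M\<^sup>N\<close> in the ring of functions that are regular near \<open>x\<close>,
  where \<open>M\<close> is the maximal ideal of the local ring at \<open>x\<close>.\<close>

definition ord_ge :: "nat \<Rightarrow> ('a \<Rightarrow> 'k) set" where
  "ord_ge N = {f. \<exists>P Q. P \<in> ideal_power S I N \<and> Q \<in> S \<and> chart_frac f P Q}"

lemma near_refl: "near f f"
  unfolding near_def using x_in_U open_U by blast

lemma near_combine:
  assumes "near f g" "near f' g'"
    and "\<And>z. f z = g z \<Longrightarrow> f' z = g' z \<Longrightarrow> h z = h' z"
  shows "near h h'"
proof -
  from assms(1,2) obtain W W' where "openin (space_top X) W" "x \<in> W" "\<forall>z \<in> W. f z = g z"
    "openin (space_top X) W'" "x \<in> W'" "\<forall>z \<in> W'. f' z = g' z" by (auto simp: near_def)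
  then show ?thesis
    unfolding near_def using assms(3) by (intro exI[of _ "W \<inter> W'"]) auto
qed

lemma chart_frac_near: "chart_frac f P Q \<Longrightarrow> near f g \<Longrightarrow> chart_frac g P Q"
proof -
  assume "chart_frac f P Q" "near f g"
  then obtain W W' where "openin (space_top X) W" "x \<in> W" "W \<subseteq> U"
    "\<forall>z \<in> W. Q (\<phi> z) \<noteq> 0 \<and> f z * Q (\<phi> z) = P (\<phi> z)"
    "openin (space_top X) W'" "x \<in> W'" "\<forall>z \<in> W'. f z = g z" by (auto simp: chart_frac_def near_def)
  then show "chart_frac g P Q"
    unfolding chart_frac_def by (intro exI[of _ "W \<inter> W'"]) auto
qed

lemma chart_frac_combine:
  assumes "chart_frac f P Q" "chart_frac f' P' Q'"
    and "\<And>z. z \<in> U \<Longrightarrow> Q (\<phi> z) \<noteq> 0 \<Longrightarrow> f z * Q (\<phi> z) = P (\<phi> z) \<Longrightarrow>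
      Q' (\<phi> z) \<noteq> 0 \<Longrightarrow> f' z * Q' (\<phi> z) = P' (\<phi> z) \<Longrightarrow>
      Q'' (\<phi> z) \<noteq> 0 \<and> h z * Q'' (\<phi> z) = P'' (\<phi> z)"
  shows "chart_frac h P'' Q''"
proof -
  from assms(1,2) obtain W W' where "openin (space_top X) W" "x \<in> W" "W \<subseteq> U"
    "\<forall>z \<in> W. Q (\<phi> z) \<noteq> 0 \<and> f z * Q (\<phi> z) = P (\<phi> z)"
    "openin (space_top X) W'" "x \<in> W'" "\<forall>z \<in> W'. Q' (\<phi> z) \<noteq> 0 \<and> f' z * Q' (\<phi> z) = P' (\<phi> z)"
    by (auto simp: chart_frac_def)
  then show ?thesis
    unfolding chart_frac_def using assms(3) by (intro exI[of _ "W \<inter> W'"]) auto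
qed

lemma chart_frac_poly: "P \<in> S \<Longrightarrow> chart_frac (\<lambda>z. P (\<phi> z)) P 1"
  unfolding chart_frac_def using open_U x_in_U by (intro exI[of _ U]) auto

lemma ord_ge_near: "f \<in> ord_ge N \<Longrightarrow> near f g \<Longrightarrow> g \<in> ord_ge N"
  unfolding ord_ge_def using chart_frac_near by blast

lemma ideal_power_S: "P \<in> ideal_power S I N \<Longrightarrow> P \<in> S"
  using ideal_ofD(1)[OF I_power_ideal] .

lemma ord_ge_poly: "P \<in> ideal_power S I N \<Longrightarrow> (\<lambda>z. P (\<phi> z)) \<in> ord_ge N"
  unfolding ord_ge_def using chart_frac_poly[OF ideal_power_S] unital_subringD(1)[OF S_ring] by blast

lemma ord_ge_add:
  assumes "f \<in> ord_ge N" "g \<in> ord_ge N"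
  shows "f + g \<in> ord_ge N"
proof -
  from assms obtain P Q P' Q' where f: "P \<in> ideal_power S I N" "Q \<in> S" "chart_frac f P Q"
    and g: "P' \<in> ideal_power S I N" "Q' \<in> S" "chart_frac g P' Q'" by (auto simp: ord_ge_def)
  have "chart_frac (f + g) (Q' * P + Q * P') (Q * Q')"
    by (rule chart_frac_combine[OF f(3) g(3)]) (auto simp: algebra_simps)
  moreover have "Q' * P + Q * P' \<in> ideal_power S I N"
    by (intro ideal_ofD[OF I_power_ideal] f g)
  moreover have "Q * Q' \<in> S" by (intro unital_subringD(4)[OF S_ring] f g)
  ultimately show ?thesis unfolding ord_ge_def by blast
qed

lemma ord_ge_mult:
  assumes "f \<in> ord_ge N" "g \<in> ord_ge N'"
  shows "f * g \<in> ord_ge (N + N')"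
proof -
  from assms obtain P Q P' Q' where f: "P \<in> ideal_power S I N" "Q \<in> S" "chart_frac f P Q"
    and g: "P' \<in> ideal_power S I N'" "Q' \<in> S" "chart_frac g P' Q'" by (auto simp: ord_ge_def)
  have "chart_frac (f * g) (P * P') (Q * Q')"
  proof (rule chart_frac_combine[OF f(3) g(3)])
    fix z assume "Q (\<phi> z) \<noteq> 0" "f z * Q (\<phi> z) = P (\<phi> z)" "Q' (\<phi> z) \<noteq> 0" "g z * Q' (\<phi> z) = P' (\<phi> z)"
    moreover have "(f z * g z) * (Q (\<phi> z) * Q' (\<phi> z)) = (f z * Q (\<phi> z)) * (g z * Q' (\<phi> z))"
      by (simp add: mult_ac)
    ultimately show "(Q * Q') (\<phi> z) \<noteq> 0 \<and> (f * g) z * (Q * Q') (\<phi> z) = (P * P') (\<phi> z)" by simp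
  qed
  moreover have "P * P' \<in> ideal_power S I (N + N')"
    by (rule ideal_power_mult[OF S_ring I_ideal f(1) g(1)])
  moreover have "Q * Q' \<in> S" by (intro unital_subringD(4)[OF S_ring] f g)
  ultimately show ?thesis unfolding ord_ge_def by blast
qed

lemma const_ord_ge: "(\<lambda>_. c) \<in> ord_ge 0"
  using ord_ge_poly[of "\<lambda>_. c" 0] by (simp add: poly_functions.const)

lemma ord_ge_scale: "f \<in> ord_ge N \<Longrightarrow> (\<lambda>_. c) * f \<in> ord_ge N"
  using ord_ge_mult[OF const_ord_ge] by simp

lemma ord_ge_diff:
  assumes "f \<in> ord_ge N" "g \<in> ord_ge N"
  shows "f - g \<in> ord_ge N"
proof -
  have "f - g = f + (\<lambda>_. - 1) * g" by (simp add: fun_eq_iff)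
  then show ?thesis using ord_ge_add[OF assms(1) ord_ge_scale[OF assms(2)]] by (simp only:)
qed

lemma ord_ge_zero: "0 \<in> ord_ge N"
proof -
  have "0 \<in> ideal_power S I N" by (rule ideal_ofD(2)[OF I_power_ideal])
  from ord_ge_poly[OF this] show ?thesis by (simp add: zero_fun_def)
qed

lemma ord_ge_sum: "(\<And>i. i \<in> A \<Longrightarrow> f i \<in> ord_ge N) \<Longrightarrow> (\<Sum>i\<in>A. f i) \<in> ord_ge N"
  by (induction A rule: infinite_finite_induct) (simp_all only: sum.infinite sum.empty sum.insert ord_ge_zero ord_ge_add insert_iff simp_thms)

lemma ord_ge_Suc: "ord_ge (Suc N) \<subseteq> ord_ge N"
  unfolding ord_ge_def using ideal_power_Suc_subset[OF S_ring I_ideal] by blast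

lemma ideal_power_one: "ideal_power S I (Suc 0) = I"
proof -
  have "p \<in> I" if "p \<in> ideal_prod I S" for p
    using that
  proof induction
    case (step a b c)
    then show ?case using ideal_ofD(3)[OF I_ideal ideal_ofD(4)[OF I_ideal, of b a]] by (simp only: mult.commute)
  qed (rule ideal_ofD(2)[OF I_ideal])
  moreover have "p \<in> ideal_prod I S" if "p \<in> I" for p
    using ideal_prod_mult[OF that unital_subringD(1)[OF S_ring]] by (simp only: mult_1_right)
  ultimately show ?thesis by auto
qed

lemma chart_frac_at_point: "chart_frac f P Q \<Longrightarrow> Q (\<phi> x) \<noteq> 0 \<and> f x * Q (\<phi> x) = P (\<phi> x)"
  unfolding chart_frac_def by blast

text \<open>With \<open>ord_ge_0_iff\<close>, this describes the order filtration in degrees zero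
  and one without the chart, so that morphisms fixing \<open>x\<close> visibly respect it.\<close>

lemma ord_ge_one_iff: "f \<in> ord_ge (Suc 0) \<longleftrightarrow> f \<in> ord_ge 0 \<and> f x = 0"
proof
  assume "f \<in> ord_ge (Suc 0)"
  then obtain P Q where "P \<in> I" "chart_frac f P Q" unfolding ord_ge_def ideal_power_one by blast
  moreover then have "f x = 0" using chart_frac_at_point[of f P Q] by (auto simp: vanishing_at_def)
  ultimately show "f \<in> ord_ge 0 \<and> f x = 0" using ord_ge_Suc \<open>f \<in> ord_ge (Suc 0)\<close> by blast
next
  assume f: "f \<in> ord_ge 0 \<and> f x = 0"
  then obtain P Q where PQ: "P \<in> S" "Q \<in> S" "chart_frac f P Q" unfolding ord_ge_def by auto
  then have "P \<in> I" using chart_frac_at_point[OF PQ(3)] f by (simp add: vanishing_at_def)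
  then show "f \<in> ord_ge (Suc 0)" unfolding ord_ge_def ideal_power_one using PQ by blast
qed

definition chart_coord :: "nat \<Rightarrow> 'a \<Rightarrow> 'k" where
  "chart_coord i z = \<phi> z i - \<phi> x i"

lemma chart_coord_ord_ge: "i < n \<Longrightarrow> chart_coord i \<in> ord_ge (Suc 0)"
proof -
  assume "i < n"
  then have "coord_at (\<phi> x) i \<in> I" using coord_at_poly by (simp add: vanishing_at_def coord_at_def)
  then have "(\<lambda>z. coord_at (\<phi> x) i (\<phi> z)) \<in> ord_ge (Suc 0)"
    using ord_ge_poly[of _ "Suc 0"] unfolding ideal_power_one by blast
  then show ?thesis by (simp add: coord_at_def chart_coord_def[abs_def])
qed

text \<open>In a numerator written in the shifted coordinates, each coefficient may be replaced by a
  constant multiple of the denominator with the same value at the point, at the cost of a term in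
  the square of \<open>I\<close>.\<close>

lemma cotangent_span:
  assumes "f \<in> ord_ge (Suc 0)"
  shows "\<exists>c. f - (\<Sum>i<n. (\<lambda>_. c i) * chart_coord i) \<in> ord_ge 2"
proof -
  obtain P Q where PQ: "P \<in> I" "Q \<in> S" "chart_frac f P Q"
    using assms unfolding ord_ge_def ideal_power_one by blast
  then obtain s where s: "P = (\<Sum>i<n. coord_at (\<phi> x) i * s i)" "\<forall>i<n. s i \<in> S"
    using vanishing_at_gen_by[of n "\<phi> x"] unfolding gen_by_def by blast
  \<comment> \<open>This constant is chosen to make \<open>s i - c i * Q\<close> vanish at
    \<open>\<phi> x\<close>, so that its product with a shifted coordinate lies in the square of
    \<open>I\<close>.\<close>
  define c where "c i = s i (\<phi> x) / Q (\<phi> x)" for i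
  define r where "r i = s i - (\<lambda>_. c i) * Q" for i
  define P' where "P' = (\<Sum>i<n. coord_at (\<phi> x) i * r i)"
  have Qx: "Q (\<phi> x) \<noteq> 0" using chart_frac_at_point[OF PQ(3)] by blast
  have r: "r i \<in> I" if "i < n" for i
  proof -
    have "r i \<in> S" unfolding r_def
      using s(2) that by (intro unital_subringD(3,4)[OF S_ring] poly_functions.const PQ) auto
    moreover have "r i (\<phi> x) = 0" using Qx by (simp add: r_def c_def)
    ultimately show ?thesis by (simp add: vanishing_at_def)
  qed
  have two: "ideal_power S I 2 = ideal_prod I I"
    using ideal_power_one by (simp add: numeral_2_eq_2)
  have "P' \<in> ideal_prod I I"
  proof -
    have id: "ideal_of S (ideal_prod I I)" using I_power_ideal[of 2] unfolding two .
    have "(\<Sum>i\<in>F. coord_at (\<phi> x) i * r i) \<in> ideal_prod I I" if "finite F" "F \<subseteq> {..<n}" for F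
      using that
    proof induction
      case empty
      show ?case using ideal_ofD(2)[OF id] by (simp only: sum.empty)
    next
      case (insert i F)
      then have "coord_at (\<phi> x) i \<in> I" "r i \<in> I"
        using r coord_at_poly by (auto simp: vanishing_at_def coord_at_def)
      then have "coord_at (\<phi> x) i * r i \<in> ideal_prod I I" by (rule ideal_prod_mult)
      then show ?case
        using insert ideal_ofD(3)[OF id] by (simp only: sum.insert insert_subset simp_thms)
    qed
    then show ?thesis unfolding P'_def by simp
  qed
  moreover have "chart_frac (f - (\<Sum>i<n. (\<lambda>_. c i) * chart_coord i)) P' Q"
  proof (rule chart_frac_combine[OF PQ(3) PQ(3)])
    fix z assume "Q (\<phi> z) \<noteq> 0" "f z * Q (\<phi> z) = P (\<phi> z)"
    have sum_app: "(\<Sum>i<n. h i) y = (\<Sum>i<n. h i y)" for h :: "nat \<Rightarrow> 'b \<Rightarrow> 'k" and y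
      by (induction n) auto
    have "(f - (\<Sum>i<n. (\<lambda>_. c i) * chart_coord i)) z * Q (\<phi> z)
        = P (\<phi> z) - (\<Sum>i<n. c i * chart_coord i z) * Q (\<phi> z)"
      using \<open>f z * Q (\<phi> z) = P (\<phi> z)\<close> by (simp add: sum_app left_diff_distrib)
    also have "\<dots> = P' (\<phi> z)"
      by (simp add: s(1) P'_def sum_app r_def coord_at_def chart_coord_def algebra_simps
          sum_subtractf sum_distrib_left sum_distrib_right)
    finally show "Q (\<phi> z) \<noteq> 0 \<and> (f - (\<Sum>i<n. (\<lambda>_. c i) * chart_coord i)) z * Q (\<phi> z) = P' (\<phi> z)"
      using \<open>Q (\<phi> z) \<noteq> 0\<close> by simp
  qed
  ultimately show ?thesis unfolding ord_ge_def two using PQ(2) by blast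
qed

text \<open>Krull's theorem is applied to the numerator \<open>p\<close> of one presentation of
  \<open>f\<close>, relative to the polynomials that vanish near \<open>x\<close>. A presentation
  \<open>P / Q\<close> of order \<open>N\<close> gives \<open>p * Q = q * P\<close> near
  \<open>x\<close>, and \<open>Q\<close> is a nonzero constant plus an element of
  \<open>I\<close>.\<close>

lemma ord_ge_infinite:
  assumes f: "\<And>N. f \<in> ord_ge N"
  shows "near f 0"
proof -
  define J where "J = {j \<in> S. near (\<lambda>z. j (\<phi> z)) 0}"
  have J: "ideal_of S J"
    unfolding ideal_of_def
  proof (intro conjI ballI)
    show "J \<subseteq> S" by (auto simp: J_def)
    show "0 \<in> J" unfolding J_def using unital_subringD(2)[OF S_ring] near_refl[of 0] by (simp add: zero_fun_def)
  next
    fix a b assume ab: "a \<in> J" "b \<in> J"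
    then have "near (\<lambda>z. a (\<phi> z)) 0" "near (\<lambda>z. b (\<phi> z)) 0" by (simp_all add: J_def)
    then have "near (\<lambda>z. (a + b) (\<phi> z)) 0" by (rule near_combine) simp
    moreover have "a + b \<in> S" using ab unital_subringD(6)[OF S_ring] by (simp only: J_def mem_Collect_eq)
    ultimately show "a + b \<in> J" unfolding J_def by (intro CollectI conjI)
  next
    fix s a assume s: "s \<in> S" and a: "a \<in> J"
    then have "near (\<lambda>z. a (\<phi> z)) 0" by (simp add: J_def)
    from near_combine[OF this this] have "near (\<lambda>z. (s * a) (\<phi> z)) 0" by simp
    moreover have "s * a \<in> S" using s a unital_subringD(4)[OF S_ring] by (simp only: J_def mem_Collect_eq)
    ultimately show "s * a \<in> J" unfolding J_def by (intro CollectI conjI)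
  qed
  obtain p q where pq: "p \<in> S" "q \<in> S" "chart_frac f p q" using f[of 0] by (auto simp: ord_ge_def)
  have "\<exists>i \<in> I. p - p * i \<in> J"
  proof (rule Krull_intersection[OF noetherian_poly_functions I_ideal vanishing_at_gen_by _ J pq(1)])
    show "coord_at (\<phi> x) i \<in> I" if "i < n" for i
      using coord_at_poly[OF that] by (simp add: vanishing_at_def coord_at_def)
  next
    fix N
    obtain P Q where PQ: "P \<in> ideal_power S I N" "Q \<in> S" "chart_frac f P Q" using f[of N] by (auto simp: ord_ge_def)
    define c where "c = Q (\<phi> x)"
    have c0: "c \<noteq> 0" using chart_frac_at_point[OF PQ(3)] by (simp add: c_def)
    define i where "i = Q - (\<lambda>_. c)"
    have "i \<in> S" unfolding i_def by (intro unital_subringD(3)[OF S_ring] PQ poly_functions.const)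
    then have i: "i \<in> I" by (simp add: vanishing_at_def i_def c_def)
    define j where "j = p * Q - q * P"
    have jS: "j \<in> S"
      unfolding j_def by (intro unital_subringD(3,4)[OF S_ring] pq PQ ideal_power_S[OF PQ(1)])
    have "chart_frac (\<lambda>z. j (\<phi> z)) 0 1"
    proof (rule chart_frac_combine[OF pq(3) PQ(3)])
      fix z assume "f z * q (\<phi> z) = p (\<phi> z)" "f z * Q (\<phi> z) = P (\<phi> z)"
      then have "j (\<phi> z) = 0" by (simp add: j_def flip: \<open>f z * q (\<phi> z) = p (\<phi> z)\<close> \<open>f z * Q (\<phi> z) = P (\<phi> z)\<close>)
      then show "1 (\<phi> z) \<noteq> (0::'k) \<and> j (\<phi> z) * 1 (\<phi> z) = 0 (\<phi> z)" by simp
    qed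
    then have "near (\<lambda>z. j (\<phi> z)) 0" unfolding chart_frac_def near_def by auto
    then have j: "j \<in> J" using jS by (simp add: J_def)
    have "p * ((\<lambda>_. c) + i) - j = q * P" by (simp add: fun_eq_iff i_def j_def)
    then have "p * ((\<lambda>_. c) + i) - j \<in> ideal_power S I N"
      using ideal_ofD(4)[OF I_power_ideal pq(2) PQ(1)] by (simp only:)
    moreover have "(\<lambda>_. inverse c) * (\<lambda>_. c) = (1 :: (nat \<Rightarrow> 'k) \<Rightarrow> 'k)" using c0 by (simp add: fun_eq_iff)
    ultimately show "\<exists>c u i j. c \<in> S \<and> u \<in> S \<and> u * c = 1 \<and> i \<in> I \<and> j \<in> J \<and>
       p * (c + i) - j \<in> ideal_power S I N"
      using i j poly_functions.const by blast
  qed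
  then obtain i where i: "i \<in> I" "p - p * i \<in> J" by blast
  then have iS: "i \<in> S" "i (\<phi> x) = 0" by (auto simp: vanishing_at_def)
  from i(2) have "near (\<lambda>z. (p - p * i) (\<phi> z)) 0" unfolding J_def by blast
  then obtain W where W: "openin (space_top X) W" "x \<in> W" "\<And>z. z \<in> W \<Longrightarrow> (p - p * i) (\<phi> z) = 0"
    by (auto simp: near_def)
  from pq(3) obtain W' where W': "openin (space_top X) W'" "x \<in> W'"
    "\<And>z. z \<in> W' \<Longrightarrow> q (\<phi> z) \<noteq> 0 \<and> f z * q (\<phi> z) = p (\<phi> z)" by (auto simp: chart_frac_def)
  \<comment> \<open>\<open>1 - i\<close> has the value \<open>1\<close> at \<open>\<phi> x\<close>,
    so it does not vanish near \<open>x\<close>; there \<open>p * (1 - i) = 0\<close> gives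
    \<open>p = 0\<close>.\<close>
  let ?W'' = "{z \<in> U. (1 - i) (\<phi> z) \<noteq> 0}"
  have W'': "openin (space_top X) ?W''"
    by (intro openin_chart_nonzero unital_subringD(1,3)[OF S_ring] iS)
  show ?thesis
    unfolding near_def
  proof (intro exI[of _ "W \<inter> W' \<inter> ?W''"] conjI ballI)
    show "openin (space_top X) (W \<inter> W' \<inter> ?W'')" using W W' W'' by blast
    show "x \<in> W \<inter> W' \<inter> ?W''" using W W' x_in_U iS by simp
    fix z assume z: "z \<in> W \<inter> W' \<inter> ?W''"
    then have "p (\<phi> z) * (1 - i (\<phi> z)) = 0" using W(3)[of z] by (simp add: algebra_simps)
    then have "p (\<phi> z) = 0" using z by simp
    then show "f z = 0 z" using W'(3)[of z] z by auto
  qed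
qed

lemma ord_ge_0_iff: "f \<in> ord_ge 0 \<longleftrightarrow> (\<exists>W. openin (space_top X) W \<and> x \<in> W \<and> f \<in> regular X W)"
proof
  assume "f \<in> ord_ge 0"
  then obtain P Q where PQ: "P \<in> S" "Q \<in> S" "chart_frac f P Q" by (auto simp: ord_ge_def)
  then obtain W where W: "openin (space_top X) W" "x \<in> W" "W \<subseteq> U"
    "\<And>z. z \<in> W \<Longrightarrow> Q (\<phi> z) \<noteq> 0 \<and> f z * Q (\<phi> z) = P (\<phi> z)" by (auto simp: chart_frac_def)
  have "(\<lambda>z. P (\<phi> z) / Q (\<phi> z)) \<in> regular X W"
    using W by (intro regular_subset[OF openin_chart_nonzero[OF PQ(2)] W(1) _ chart_fraction_regular[OF PQ(1,2)]]) blast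
  then have "f \<in> regular X W"
    by (rule regular_cong[OF W(1)]) (use W(4) in \<open>simp add: field_simps\<close>)
  then show "\<exists>W. openin (space_top X) W \<and> x \<in> W \<and> f \<in> regular X W" using W by blast
next
  assume "\<exists>W. openin (space_top X) W \<and> x \<in> W \<and> f \<in> regular X W"
  then obtain W where W: "openin (space_top X) W" "f \<in> regular X W" "x \<in> W" by blast
  from regular_local_fraction[OF W x_in_U] obtain p q W' where pq: "p \<in> S" "q \<in> S"
    and W': "openin (space_top X) W'" "x \<in> W'" "W' \<subseteq> W \<inter> U"
    "\<forall>z \<in> W'. q (\<phi> z) \<noteq> 0 \<and> f z * q (\<phi> z) = p (\<phi> z)" by (elim exE conjE)
  then have "chart_frac f p q" unfolding chart_frac_def by blast
  then show "f \<in> ord_ge 0" unfolding ord_ge_def using pq by auto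
qed

end

section \<open>Automorphisms fixing a point\<close>

lemma fun_comp_diff: "(f - g) \<circ> \<sigma> = (f \<circ> \<sigma>) - (g \<circ> \<sigma>)"
  and fun_comp_mult: "(f * g) \<circ> \<sigma> = (f \<circ> \<sigma>) * (g \<circ> \<sigma>)"
  by (simp_all add: fun_eq_iff)

context pointed_chart
begin

context
  fixes \<sigma> :: "'a \<Rightarrow> 'a"
  assumes \<sigma>: "morphism X X \<sigma>" "\<sigma> x = x"
begin

lemma openin_fixing_preimage:
  assumes "openin (space_top X) W" "x \<in> W"
  shows "openin (space_top X) {z \<in> points X. \<sigma> z \<in> W}" "x \<in> {z \<in> points X. \<sigma> z \<in> W}"
  using \<sigma> assms openin_subset[OF assms(1)]
  by (auto simp: morphism_def intro: openin_continuous_map_preimage)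

lemma near_comp: "near f g \<Longrightarrow> near (f \<circ> \<sigma>) (g \<circ> \<sigma>)"
proof -
  assume "near f g"
  then obtain W where W: "openin (space_top X) W" "x \<in> W" "\<forall>z \<in> W. f z = g z" by (auto simp: near_def)
  then show ?thesis
    unfolding near_def using openin_fixing_preimage[OF W(1,2)]
    by (intro exI[of _ "{z \<in> points X. \<sigma> z \<in> W}"]) simp
qed

lemma comp_ord_ge_0: "f \<in> ord_ge 0 \<Longrightarrow> f \<circ> \<sigma> \<in> ord_ge 0"
proof -
  assume "f \<in> ord_ge 0"
  then obtain W where W: "openin (space_top X) W" "x \<in> W" "f \<in> regular X W"
    by (auto simp: ord_ge_0_iff)
  then have "f \<circ> \<sigma> \<in> regular X {z \<in> points X. \<sigma> z \<in> W}" using \<sigma>(1) by (auto simp: morphism_def)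
  then show ?thesis unfolding ord_ge_0_iff using openin_fixing_preimage[OF W(1,2)] by blast
qed

lemma comp_ord_ge_1: "f \<in> ord_ge (Suc 0) \<Longrightarrow> f \<circ> \<sigma> \<in> ord_ge (Suc 0)"
  using comp_ord_ge_0 \<sigma>(2) by (auto simp: ord_ge_one_iff)

text \<open>A polynomial in the chart need not remain one after composition with
  \<open>\<sigma>\<close>. Orders zero and one are preserved by their chart-free descriptions, and
  higher orders follow by splitting off factors of order one.\<close>

lemma comp_poly_ord_ge: "P \<in> ideal_power S I N \<Longrightarrow> (\<lambda>z. P (\<phi> z)) \<circ> \<sigma> \<in> ord_ge N"
proof (induction N arbitrary: P)
  case 0
  then show ?case by (intro comp_ord_ge_0 ord_ge_poly)
next
  case (Suc N)
  from Suc.prems have "P \<in> ideal_prod I (ideal_power S I N)" by simp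
  then show ?case
  proof induction
    case zero
    have "(\<lambda>z. (0 :: (nat \<Rightarrow> 'k) \<Rightarrow> 'k) (\<phi> z)) \<circ> \<sigma> = 0" by (simp add: fun_eq_iff)
    then show ?case using ord_ge_zero by (simp only:)
  next
    case (step a b c)
    have "(\<lambda>z. a (\<phi> z)) \<in> ord_ge (Suc 0)"
      using step(1) ideal_power_one by (intro ord_ge_poly) blast
    then have "((\<lambda>z. a (\<phi> z)) \<circ> \<sigma>) * ((\<lambda>z. b (\<phi> z)) \<circ> \<sigma>) \<in> ord_ge (Suc 0 + N)"
      by (intro ord_ge_mult comp_ord_ge_1 Suc.IH step)
    then have "((\<lambda>z. a (\<phi> z)) \<circ> \<sigma>) * ((\<lambda>z. b (\<phi> z)) \<circ> \<sigma>) \<in> ord_ge (Suc N)"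
      by (simp only: plus_nat.simps)
    from ord_ge_add[OF this step.IH]
    have "((\<lambda>z. a (\<phi> z)) \<circ> \<sigma>) * ((\<lambda>z. b (\<phi> z)) \<circ> \<sigma>) + ((\<lambda>z. c (\<phi> z)) \<circ> \<sigma>) \<in> ord_ge (Suc N)" .
    moreover have "((\<lambda>z. a (\<phi> z)) \<circ> \<sigma>) * ((\<lambda>z. b (\<phi> z)) \<circ> \<sigma>) + ((\<lambda>z. c (\<phi> z)) \<circ> \<sigma>)
      = (\<lambda>z. (a * b + c) (\<phi> z)) \<circ> \<sigma>" by (simp add: fun_eq_iff)
    ultimately show ?case by (simp only:)
  qed
qed

end

text \<open>Separates the numerator from the inverse of the denominator, so that facts about the
  action of \<open>\<sigma>\<close> on polynomials extend to all germs.\<close>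

lemma ord_ge_factor:
  assumes "f \<in> ord_ge N"
  obtains P r where "P \<in> ideal_power S I N" "r \<in> ord_ge 0" "near ((\<lambda>z. P (\<phi> z)) * r) f"
proof -
  from assms obtain P Q where PQ: "P \<in> ideal_power S I N" "Q \<in> S" "chart_frac f P Q" by (auto simp: ord_ge_def)
  then obtain W where W: "openin (space_top X) W" "x \<in> W" "W \<subseteq> U"
    "\<forall>z \<in> W. Q (\<phi> z) \<noteq> 0 \<and> f z * Q (\<phi> z) = P (\<phi> z)" by (auto simp: chart_frac_def)
  let ?r = "\<lambda>z. 1 / Q (\<phi> z)"
  have "chart_frac ?r 1 Q" unfolding chart_frac_def using W by (intro exI[of _ W]) auto
  then have "?r \<in> ord_ge 0" unfolding ord_ge_def using PQ(2) unital_subringD(1)[OF S_ring] by auto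
  moreover have "near ((\<lambda>z. P (\<phi> z)) * ?r) f"
    unfolding near_def using W by (intro exI[of _ W]) (auto simp: field_simps)
  ultimately show ?thesis using that PQ(1) by blast
qed

context
  fixes \<sigma> :: "'a \<Rightarrow> 'a"
  assumes \<sigma>: "morphism X X \<sigma>" "\<sigma> x = x"
begin

lemma comp_ord_ge:
  assumes "f \<in> ord_ge N"
  shows "f \<circ> \<sigma> \<in> ord_ge N"
proof -
  obtain P r where P: "P \<in> ideal_power S I N" "r \<in> ord_ge 0" "near ((\<lambda>z. P (\<phi> z)) * r) f"
    using ord_ge_factor[OF assms] .
  have "((\<lambda>z. P (\<phi> z)) \<circ> \<sigma>) * (r \<circ> \<sigma>) \<in> ord_ge (N + 0)"
    by (intro ord_ge_mult comp_poly_ord_ge[OF \<sigma>] comp_ord_ge_0[OF \<sigma>] P)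
  then have "((\<lambda>z. P (\<phi> z)) * r) \<circ> \<sigma> \<in> ord_ge N" by (simp only: fun_comp_mult add_0_right)
  then show ?thesis using ord_ge_near near_comp[OF \<sigma> P(3)] by blast
qed

section \<open>Automorphisms that act trivially on the cotangent space\<close>

context
  assumes unip: "\<And>f. f \<in> ord_ge (Suc 0) \<Longrightarrow> (f \<circ> \<sigma>) - f \<in> ord_ge 2"
begin

text \<open>With a prime for composition with \<open>\<sigma>\<close>,
  \<open>a' b' - a b = (a' - a) b' + a (b' - b)\<close>: the first summand gains an order from
  \<open>a\<close> by hypothesis, the second from \<open>b\<close> by induction. In order zero, the
  difference vanishes at the fixed point \<open>x\<close>.\<close>

lemma unipotent_poly: "P \<in> ideal_power S I N \<Longrightarrow> ((\<lambda>z. P (\<phi> z)) \<circ> \<sigma>) - (\<lambda>z. P (\<phi> z)) \<in> ord_ge (Suc N)"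
proof (induction N arbitrary: P)
  case 0
  then have "((\<lambda>z. P (\<phi> z)) \<circ> \<sigma>) - (\<lambda>z. P (\<phi> z)) \<in> ord_ge 0"
    by (intro ord_ge_diff comp_ord_ge ord_ge_poly)
  then show ?case unfolding ord_ge_one_iff by (rule conjI) (simp add: \<sigma>(2))
next
  case (Suc N)
  from Suc.prems have "P \<in> ideal_prod I (ideal_power S I N)" by simp
  then show ?case
  proof induction
    case zero
    have "((\<lambda>z. (0 :: (nat \<Rightarrow> 'k) \<Rightarrow> 'k) (\<phi> z)) \<circ> \<sigma>) - (\<lambda>z. 0 (\<phi> z)) = 0" by (simp add: fun_eq_iff)
    then show ?case using ord_ge_zero by (simp only:)
  next
    case (step a b c)
    let ?a = "\<lambda>z. a (\<phi> z)" and ?b = "\<lambda>z. b (\<phi> z)" and ?c = "\<lambda>z. c (\<phi> z)"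
    have a: "?a \<in> ord_ge (Suc 0)" using step(1) ideal_power_one by (intro ord_ge_poly) blast
    have b: "?b \<in> ord_ge N" using step(2) by (rule ord_ge_poly)
    have "((?a \<circ> \<sigma>) - ?a) * (?b \<circ> \<sigma>) \<in> ord_ge (2 + N)"
      by (intro ord_ge_mult unip a comp_ord_ge b)
    then have 1: "((?a \<circ> \<sigma>) - ?a) * (?b \<circ> \<sigma>) \<in> ord_ge (Suc (Suc N))" by (simp only: add_2_eq_Suc)
    have "?a * ((?b \<circ> \<sigma>) - ?b) \<in> ord_ge (Suc 0 + Suc N)"
      by (intro ord_ge_mult a Suc.IH step)
    then have 2: "?a * ((?b \<circ> \<sigma>) - ?b) \<in> ord_ge (Suc (Suc N))" by (simp only: plus_nat.simps)
    have "((?a \<circ> \<sigma>) - ?a) * (?b \<circ> \<sigma>) + ?a * ((?b \<circ> \<sigma>) - ?b) + ((?c \<circ> \<sigma>) - ?c) \<in> ord_ge (Suc (Suc N))"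
      by (rule ord_ge_add[OF ord_ge_add[OF 1 2] step.IH])
    moreover have "((?a \<circ> \<sigma>) - ?a) * (?b \<circ> \<sigma>) + ?a * ((?b \<circ> \<sigma>) - ?b) + ((?c \<circ> \<sigma>) - ?c)
      = ((\<lambda>z. (a * b + c) (\<phi> z)) \<circ> \<sigma>) - (\<lambda>z. (a * b + c) (\<phi> z))"
      by (simp add: fun_eq_iff algebra_simps)
    ultimately show ?case by (simp only:)
  qed
qed

lemma unipotent_ord_ge:
  assumes "f \<in> ord_ge N"
  shows "(f \<circ> \<sigma>) - f \<in> ord_ge (Suc N)"
proof -
  obtain P r where P: "P \<in> ideal_power S I N" "r \<in> ord_ge 0" "near ((\<lambda>z. P (\<phi> z)) * r) f"
    using ord_ge_factor[OF assms] .
  let ?P = "\<lambda>z. P (\<phi> z)"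
  have "(r \<circ> \<sigma>) - r \<in> ord_ge 0" by (intro ord_ge_diff comp_ord_ge P)
  then have r: "(r \<circ> \<sigma>) - r \<in> ord_ge (Suc 0)"
    unfolding ord_ge_one_iff by (rule conjI) (simp add: \<sigma>(2))
  have "((?P \<circ> \<sigma>) - ?P) * (r \<circ> \<sigma>) \<in> ord_ge (Suc N + 0)"
    by (intro ord_ge_mult unipotent_poly comp_ord_ge P)
  moreover have "?P * ((r \<circ> \<sigma>) - r) \<in> ord_ge (N + Suc 0)"
    by (intro ord_ge_mult ord_ge_poly P r)
  ultimately have "((?P \<circ> \<sigma>) - ?P) * (r \<circ> \<sigma>) + ?P * ((r \<circ> \<sigma>) - r) \<in> ord_ge (Suc N)"
    unfolding add_0_right add_Suc_right by (rule ord_ge_add)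
  moreover have "near (((?P \<circ> \<sigma>) - ?P) * (r \<circ> \<sigma>) + ?P * ((r \<circ> \<sigma>) - r)) ((f \<circ> \<sigma>) - f)"
    by (rule near_combine[OF P(3) near_comp[OF \<sigma> P(3)]]) (simp add: algebra_simps)
  ultimately show ?thesis by (rule ord_ge_near)
qed

text \<open>If \<open>\<sigma> f = f + g\<close> with \<open>g\<close> of order at least \<open>j\<close>, then \<open>\<sigma>\<^sup>k f \<equiv> f + k g\<close> modulo order \<open>j + 1\<close>;
  as \<open>\<sigma>\<^sup>r = 1\<close> and \<open>r\<close> is invertible, \<open>g\<close> has order at least \<open>j + 1\<close>.\<close>

lemma unipotent_finite_order_trivial:
  fixes \<tau> :: "nat \<Rightarrow> 'a \<Rightarrow> 'a"
  assumes \<tau>: "\<And>z. z \<in> points X \<Longrightarrow> \<tau> 0 z = z"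
      "\<And>k z. z \<in> points X \<Longrightarrow> \<tau> (Suc k) z = \<tau> k (\<sigma> z)"
    and r: "\<And>z. z \<in> points X \<Longrightarrow> \<tau> r z = z" "(of_nat r :: 'k) \<noteq> 0"
    and f: "f \<in> ord_ge 0"
  shows "near (f \<circ> \<sigma>) f"
proof -
  have near_points: "near g h" if "\<And>z. z \<in> points X \<Longrightarrow> g z = h z" for g h
    unfolding near_def using open_U x_in_U openin_subset[OF open_U] that by blast
  have D: "(f \<circ> \<sigma>) - f \<in> ord_ge j" for j
  proof (induction j)
    case 0
    show ?case by (intro ord_ge_diff comp_ord_ge f)
  next
    case (Suc j)
    let ?g = "(f \<circ> \<sigma>) - f"
    have "(f \<circ> \<tau> k) - f - (\<lambda>_. of_nat k) * ?g \<in> ord_ge (Suc j)" for k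
    proof (induction k)
      case 0
      show ?case by (rule ord_ge_near[OF ord_ge_zero]) (rule near_points, simp add: \<tau>)
    next
      case (Suc k)
      \<comment> \<open>The next error is \<open>?e \<circ> \<sigma>\<close> plus \<open>k\<close>
        times \<open>(?g \<circ> \<sigma>) - ?g\<close>, and the latter has gained one
        order.\<close>
      let ?e = "(f \<circ> \<tau> k) - f - (\<lambda>_. of_nat k) * ?g"
      have "(?g \<circ> \<sigma>) - ?g \<in> ord_ge (Suc j)" by (rule unipotent_ord_ge[OF \<open>?g \<in> ord_ge j\<close>])
      then have "(?e \<circ> \<sigma>) + (\<lambda>_. of_nat k) * ((?g \<circ> \<sigma>) - ?g) \<in> ord_ge (Suc j)"
        by (intro ord_ge_add ord_ge_scale comp_ord_ge Suc.IH)
      moreover have "near ((?e \<circ> \<sigma>) + (\<lambda>_. of_nat k) * ((?g \<circ> \<sigma>) - ?g))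
          ((f \<circ> \<tau> (Suc k)) - f - (\<lambda>_. of_nat (Suc k)) * ?g)"
        by (rule near_points) (simp add: \<tau> algebra_simps)
      ultimately show ?case by (rule ord_ge_near)
    qed
    from ord_ge_scale[OF this[of r], of "- inverse (of_nat r)"] show ?case
      by (rule ord_ge_near) (rule near_points, use r in \<open>simp add: field_simps\<close>)
  qed
  then have "near ((f \<circ> \<sigma>) - f) 0" by (rule ord_ge_infinite)
  from near_combine[OF this this] show ?thesis by simp
qed

end

text \<open>The finitely many coordinate functions of the chart are regular, and together they
  separate the points of \<open>U\<close>.\<close>

lemma fixes_functions_imp_near_id:
  assumes "\<And>f. f \<in> ord_ge 0 \<Longrightarrow> near (f \<circ> \<sigma>) f"
  shows "\<exists>W. openin (space_top X) W \<and> x \<in> W \<and> (\<forall>z \<in> W. \<sigma> z = z)"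
proof -
  have "\<exists>W. openin (space_top X) W \<and> x \<in> W \<and> (\<forall>z \<in> W. \<phi> (\<sigma> z) i = \<phi> z i)" if "i < n" for i
  proof -
    have "(\<lambda>z. \<phi> z i) \<in> ord_ge 0"
      using ord_ge_poly[of "\<lambda>y. y i" 0] poly_functions.coord[OF that] by simp
    from assms[OF this] show ?thesis by (simp add: near_def)
  qed
  then obtain W where W: "\<And>i. i < n \<Longrightarrow> openin (space_top X) (W i) \<and> x \<in> W i \<and> (\<forall>z \<in> W i. \<phi> (\<sigma> z) i = \<phi> z i)"
    by metis
  \<comment> \<open>Both \<open>z\<close> and \<open>\<sigma> z\<close> must lie in \<open>U\<close>
    for the coordinates to compare them.\<close>
  define U' where "U' = U \<inter> {z \<in> points X. \<sigma> z \<in> U}"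
  have U': "openin (space_top X) U'" "x \<in> U'"
    using openin_fixing_preimage[OF \<sigma> open_U x_in_U] open_U x_in_U by (auto simp: U'_def)
  have "openin (space_top X) (U' \<inter> (\<Inter>i<m. W i)) \<and> x \<in> U' \<inter> (\<Inter>i<m. W i)" if "m \<le> n" for m
    using that
  proof (induction m)
    case (Suc m)
    then have "openin (space_top X) ((U' \<inter> (\<Inter>i<m. W i)) \<inter> W m)"
      using W[of m] by (intro openin_Int[of _ "U' \<inter> (\<Inter>i<m. W i)" "W m"]) auto
    moreover have "(U' \<inter> (\<Inter>i<m. W i)) \<inter> W m = U' \<inter> (\<Inter>i<Suc m. W i)" by (auto simp: less_Suc_eq)
    ultimately show ?case using Suc W[of m] by (auto simp: less_Suc_eq)
  qed (use U' in simp)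
  from this[OF order_refl] have W': "openin (space_top X) (U' \<inter> (\<Inter>i<n. W i))" "x \<in> U' \<inter> (\<Inter>i<n. W i)"
    by blast+
  have "\<sigma> z = z" if z: "z \<in> U' \<inter> (\<Inter>i<n. W i)" for z
  proof -
    have U: "z \<in> U" "\<sigma> z \<in> U" using z by (auto simp: U'_def)
    have "\<phi> (\<sigma> z) \<in> affine_space n" "\<phi> z \<in> affine_space n"
      using chart_into U algebraic_set_subset[OF alg] by blast+
    moreover have "\<phi> (\<sigma> z) i = \<phi> z i" if "i < n" for i using W[OF that] z that by auto
    ultimately have "\<phi> (\<sigma> z) = \<phi> z" unfolding affine_space_def by (intro PiE_ext) auto
    then show ?thesis using left_inv U by metis
  qed
  then show ?thesis using W' by blast
qed

end

end

section \<open>The cotangent representation\<close>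

lemma (in group) finite_order:
  assumes fin: "finite (carrier G)" and a: "a \<in> carrier G"
  shows "\<exists>r>0. a [^] (r::nat) = \<one>"
proof -
  have "finite (range (\<lambda>k::nat. a [^] k))"
    by (rule finite_subset[OF _ fin]) (use a in auto)
  then have "\<not> inj (\<lambda>k::nat. a [^] k)" using finite_imageD by blast
  then obtain i j :: nat where ij: "i < j" "a [^] i = a [^] j"
    unfolding inj_def by (metis linorder_neqE_nat)
  then have "a [^] i \<otimes> a [^] (j - i) = a [^] i" using nat_pow_mult[OF a, of i "j - i"] by simp
  then have "a [^] (j - i) = \<one>" using a by (metis l_cancel_one nat_pow_closed)
  then show ?thesis using ij(1) by (intro exI[of _ "j - i"]) simp
qed

lemma fun_sum_apply: "(\<Sum>i\<in>A. f i) z = (\<Sum>i\<in>A. f i z)"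
  by (induction A rule: infinite_finite_induct) simp_all

context pointed_chart
begin

definition lin_comb :: "nat \<Rightarrow> (nat \<Rightarrow> 'a \<Rightarrow> 'k) \<Rightarrow> (nat \<Rightarrow> 'k) \<Rightarrow> 'a \<Rightarrow> 'k" where
  "lin_comb d t c = (\<Sum>i<d. (\<lambda>_. c i) * t i)"

text \<open>Lifts to functions of a basis of \<open>M / M\<^sup>2\<close>, where \<open>M\<close> is
  the maximal ideal of the local ring at \<open>x\<close>.\<close>

definition cotangent_basis :: "nat \<Rightarrow> (nat \<Rightarrow> 'a \<Rightarrow> 'k) \<Rightarrow> bool" where
  "cotangent_basis d t \<longleftrightarrow> (\<forall>i<d. t i \<in> ord_ge (Suc 0)) \<and>
     (\<forall>f \<in> ord_ge (Suc 0). \<exists>c. f - lin_comb d t c \<in> ord_ge 2) \<and>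
     (\<forall>c. lin_comb d t c \<in> ord_ge 2 \<longrightarrow> (\<forall>i<d. c i = 0))"

lemma cotangent_basis_exists: "\<exists>d t. cotangent_basis d t"
proof -
  define P where "P B \<longleftrightarrow> B \<subseteq> {..<n} \<and>
    (\<forall>f \<in> ord_ge (Suc 0). \<exists>c. f - (\<Sum>i\<in>B. (\<lambda>_. c i) * chart_coord i) \<in> ord_ge 2)" for B
  have "P {..<n}" using cotangent_span by (simp add: P_def)
  then obtain B where B: "P B" and min: "\<And>B'. P B' \<Longrightarrow> card B \<le> card B'"
    using ex_has_least_nat[of P "{..<n}" card] by blast
  have fin: "finite B" using B finite_subset by (auto simp: P_def)
  have indep: "e j = 0" if e: "(\<Sum>i\<in>B. (\<lambda>_. e i) * chart_coord i) \<in> ord_ge 2" and j: "j \<in> B" for e j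
  proof (rule ccontr)
    assume ne: "e j \<noteq> 0"
    have "\<exists>c'. f - (\<Sum>i\<in>B - {j}. (\<lambda>_. c' i) * chart_coord i) \<in> ord_ge 2" if f: "f \<in> ord_ge (Suc 0)" for f
    proof -
      obtain c where c: "f - (\<Sum>i\<in>B. (\<lambda>_. c i) * chart_coord i) \<in> ord_ge 2"
        using B f unfolding P_def by blast
      \<comment> \<open>Subtracting \<open>c j / e j\<close> times the relation makes the
        coefficient of \<open>j\<close> zero, and the difference has order at least two.\<close>
      let ?c' = "\<lambda>i. c i - c j / e j * e i"
      have "f - (\<Sum>i\<in>B - {j}. (\<lambda>_. ?c' i) * chart_coord i)
        = (f - (\<Sum>i\<in>B. (\<lambda>_. c i) * chart_coord i)) + (\<lambda>_. c j / e j) * (\<Sum>i\<in>B. (\<lambda>_. e i) * chart_coord i)"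
        using ne by (simp add: fun_eq_iff fun_sum_apply sum.remove[OF fin j] left_diff_distrib sum_subtractf
            sum_distrib_left mult.assoc distrib_left)
      also have "\<dots> \<in> ord_ge 2" by (intro ord_ge_add c ord_ge_scale e)
      finally show ?thesis by (intro exI[of _ ?c'])
    qed
    then have "P (B - {j})" using B by (auto simp: P_def)
    from min[OF this] show False using card_Diff1_less[OF fin j] by linarith
  qed
  obtain h where h: "bij_betw h {0..<card B} B" using ex_bij_betw_nat_finite[OF fin] by blast
  define t where "t i = chart_coord (h i)" for i
  have reindex: "lin_comb (card B) t (\<lambda>i. c (h i)) = (\<Sum>i\<in>B. (\<lambda>_. c i) * chart_coord i)" for c
    unfolding lin_comb_def t_def lessThan_atLeast0 by (rule sum.reindex_bij_betw[OF h])
  have hB: "h i \<in> B" if "i < card B" for i using bij_betw_apply[OF h] that by simp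
  have "cotangent_basis (card B) t"
    unfolding cotangent_basis_def
  proof (intro conjI allI impI ballI)
    show "t i \<in> ord_ge (Suc 0)" if "i < card B" for i
      using chart_coord_ord_ge hB[OF that] B by (auto simp: t_def P_def)
    show "\<exists>c. f - lin_comb (card B) t c \<in> ord_ge 2" if "f \<in> ord_ge (Suc 0)" for f
      using B that reindex unfolding P_def by metis
    fix c i assume c: "lin_comb (card B) t c \<in> ord_ge 2" and i: "i < card B"
    let ?c = "\<lambda>b. c (inv_into {0..<card B} h b)"
    have "lin_comb (card B) t c = lin_comb (card B) t (\<lambda>i. ?c (h i))"
      unfolding lin_comb_def using h by (intro sum.cong) (auto simp: bij_betw_def)
    then have "(\<Sum>i\<in>B. (\<lambda>_. ?c i) * chart_coord i) \<in> ord_ge 2" using c reindex[of ?c] by simp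
    from indep[OF this hB[OF i]] show "c i = 0" using h i by (auto simp: bij_betw_def)
  qed
  then show ?thesis by blast
qed

lemma cotangent_basis_unique:
  assumes "cotangent_basis d t" "f - lin_comb d t c \<in> ord_ge 2" "f - lin_comb d t e \<in> ord_ge 2" "j < d"
  shows "c j = e j"
proof -
  have "lin_comb d t (\<lambda>i. c i - e i) = (f - lin_comb d t e) - (f - lin_comb d t c)"
    by (simp add: lin_comb_def fun_eq_iff fun_sum_apply left_diff_distrib sum_subtractf)
  then have "lin_comb d t (\<lambda>i. c i - e i) \<in> ord_ge 2" using ord_ge_diff[OF assms(3,2)] by (simp only:)
  then have "\<forall>i<d. c i - e i = 0" using assms(1) unfolding cotangent_basis_def by blast
  then show ?thesis using assms(4) by simp
qed

lemma lin_comb_comp: "lin_comb d t c \<circ> \<sigma> = lin_comb d (\<lambda>i. t i \<circ> \<sigma>) c"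
  by (simp add: lin_comb_def fun_eq_iff fun_sum_apply)

lemma lin_comb_diff_ord_ge:
  assumes "\<And>i. i < d \<Longrightarrow> t i - u i \<in> ord_ge N"
  shows "lin_comb d t c - lin_comb d u c \<in> ord_ge N"
proof -
  have "lin_comb d t c - lin_comb d u c = (\<Sum>i<d. (\<lambda>_. c i) * (t i - u i))"
    by (simp add: lin_comb_def fun_eq_iff fun_sum_apply right_diff_distrib sum_subtractf)
  also have "\<dots> \<in> ord_ge N" by (intro ord_ge_sum ord_ge_scale assms) simp
  finally show ?thesis .
qed

lemma lin_comb_lin_comb: "lin_comb d (\<lambda>l. lin_comb d t (r l)) c = lin_comb d t (\<lambda>j. \<Sum>l<d. c l * r l j)"
proof
  fix z
  have "(\<Sum>l<d. c l * (\<Sum>j<d. r l j * t j z)) = (\<Sum>j<d. (\<Sum>l<d. c l * r l j) * t j z)"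
    unfolding sum_distrib_left sum_distrib_right by (subst sum.swap) (simp add: mult.assoc)
  then show "lin_comb d (\<lambda>l. lin_comb d t (r l)) c z = lin_comb d t (\<lambda>j. \<Sum>l<d. c l * r l j) z"
    by (simp add: lin_comb_def fun_sum_apply)
qed

lemma lin_comb_delta: "i < d \<Longrightarrow> lin_comb d t (\<lambda>j. if i = j then 1 else 0) = t i"
  by (simp add: lin_comb_def fun_eq_iff fun_sum_apply if_distrib[of "\<lambda>x. x * _"] cong: if_cong)

text \<open>Row \<open>i\<close> of the matrix of \<open>g\<close> holds the coordinates of
  \<open>t i \<circ> g\<close> modulo order two. Pullback is a right action,
  \<open>t i \<circ> (g h) = (t i \<circ> g) \<circ> h\<close>, and with this row convention it
  becomes a homomorphism. Faithfulness combines \<open>unipotent_finite_order_trivial\<close> with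
  the rigidity hypothesis.\<close>

lemma cotangent_rep:
  assumes H: "subgroup H (Aut X)" "finite H" and fix_x: "\<And>g. g \<in> H \<Longrightarrow> g x = x"
    and rigid: "\<And>g W. g \<in> H \<Longrightarrow> openin (space_top X) W \<Longrightarrow> x \<in> W \<Longrightarrow> \<forall>z \<in> W. g z = z \<Longrightarrow> g = \<one>\<^bsub>Aut X\<^esub>"
    and char_0: "\<And>r. r > 0 \<Longrightarrow> (of_nat r :: 'k) \<noteq> 0"
    and basis: "cotangent_basis d t"
  shows "\<exists>\<rho> :: _ \<Rightarrow> nat \<Rightarrow> nat \<Rightarrow> 'k. faithful_rep (Aut X\<lparr>carrier := H\<rparr>) d \<rho>"
proof -
  let ?G = "Aut X\<lparr>carrier := H\<rparr>"
  interpret A: group "Aut X" by (rule group_Aut)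
  interpret G: group ?G using A.subgroup_imp_group[OF H(1)] .
  have HB: "g \<in> Bij (points X)" "isomorphism X X g" if "g \<in> H" for g
    using subgroup.mem_carrier[OF H(1) that] by (auto simp: Aut_def)
  then have mor: "morphism X X g" if "g \<in> H" for g using that by (simp add: isomorphism_def)
  have mult: "(g \<otimes>\<^bsub>Aut X\<^esub> h) z = g (h z)" if "g \<in> H" "h \<in> H" "z \<in> points X" for g h z
    using HB that by (simp add: Aut_def BijGroup_def compose_def)
  have one: "\<one>\<^bsub>Aut X\<^esub> z = z" if "z \<in> points X" for z
    using that by (simp add: Aut_def BijGroup_def)
  have near_points: "near p q" if "\<And>z. z \<in> points X \<Longrightarrow> p z = q z" for p q
    unfolding near_def using open_U x_in_U openin_subset[OF open_U] that by blast
  have t: "t i \<in> ord_ge (Suc 0)" if "i < d" for i using basis that by (simp add: cotangent_basis_def)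
  have "\<exists>c. (t i \<circ> g) - lin_comb d t c \<in> ord_ge 2" if "g \<in> H" "i < d" for g i
    using comp_ord_ge_1[OF mor[OF that(1)] fix_x[OF that(1)] t[OF that(2)]] basis
    unfolding cotangent_basis_def by blast
  then obtain \<rho> where \<rho>: "\<And>g i. g \<in> H \<Longrightarrow> i < d \<Longrightarrow> (t i \<circ> g) - lin_comb d t (\<rho> g i) \<in> ord_ge 2"
    by metis
  have "faithful_rep ?G d \<rho>"
  proof (unfold_locales)
    show "finite (carrier ?G)" using H(2) by simp
  next
    fix g h i j assume gh: "g \<in> carrier ?G" "h \<in> carrier ?G" and ij: "i < d" "j < d"
    then have g: "g \<in> H" and h: "h \<in> H" by simp_all
    have gh: "g \<otimes>\<^bsub>Aut X\<^esub> h \<in> H" using subgroup.m_closed[OF H(1) g h] .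
    have "((t i \<circ> g) - lin_comb d t (\<rho> g i)) \<circ> h \<in> ord_ge 2"
      by (intro comp_ord_ge mor fix_x h \<rho> g ij)
    moreover have "lin_comb d (\<lambda>l. t l \<circ> h) (\<rho> g i) - lin_comb d (\<lambda>l. lin_comb d t (\<rho> h l)) (\<rho> g i) \<in> ord_ge 2"
      by (intro lin_comb_diff_ord_ge \<rho> h)
    ultimately have "(((t i \<circ> g) - lin_comb d t (\<rho> g i)) \<circ> h) +
        (lin_comb d (\<lambda>l. t l \<circ> h) (\<rho> g i) - lin_comb d (\<lambda>l. lin_comb d t (\<rho> h l)) (\<rho> g i)) \<in> ord_ge 2"
      by (rule ord_ge_add)
    then have "(t i \<circ> (g \<otimes>\<^bsub>Aut X\<^esub> h)) - lin_comb d t (\<lambda>j. \<Sum>l<d. \<rho> g i l * \<rho> h l j) \<in> ord_ge 2"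
      by (rule ord_ge_near) (rule near_points,
        simp add: mult g h fun_comp_diff flip: lin_comb_comp lin_comb_lin_comb)
    from cotangent_basis_unique[OF basis \<rho>[OF gh ij(1)] this ij(2)]
    show "\<rho> (g \<otimes>\<^bsub>?G\<^esub> h) i j = (\<Sum>l<d. \<rho> g i l * \<rho> h l j)" by simp
  next
    fix i j assume ij: "i < d" "j < d"
    have "(t i \<circ> \<one>\<^bsub>Aut X\<^esub>) - lin_comb d t (\<lambda>j. if i = j then 1 else 0) \<in> ord_ge 2"
      unfolding lin_comb_delta[OF ij(1)]
      by (rule ord_ge_near[OF ord_ge_zero]) (rule near_points, simp add: one)
    from cotangent_basis_unique[OF basis \<rho>[OF subgroup.one_closed[OF H(1)] ij(1)] this ij(2)]
    show "\<rho> \<one>\<^bsub>?G\<^esub> i j = (if i = j then 1 else 0)" by simp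
  next
    fix g assume "g \<in> carrier ?G" and triv: "\<And>i j. i < d \<Longrightarrow> j < d \<Longrightarrow> \<rho> g i j = (if i = j then 1 else 0)"
    then have g: "g \<in> H" by simp
    have tg: "(t i \<circ> g) - t i \<in> ord_ge 2" if i: "i < d" for i
    proof -
      have "lin_comb d t (\<rho> g i) = lin_comb d t (\<lambda>j. if i = j then 1 else 0)"
        unfolding lin_comb_def using triv[OF i] by (intro sum.cong) auto
      then show ?thesis using \<rho>[OF g i] lin_comb_delta[OF i] by (simp only:)
    qed
    have unip: "(f \<circ> g) - f \<in> ord_ge 2" if f: "f \<in> ord_ge (Suc 0)" for f
    proof -
      obtain c where c: "f - lin_comb d t c \<in> ord_ge 2"
        using basis f unfolding cotangent_basis_def by blast
      have "((f - lin_comb d t c) \<circ> g) - (f - lin_comb d t c) \<in> ord_ge 2"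
        by (intro ord_ge_diff comp_ord_ge mor fix_x g c)
      moreover have "lin_comb d (\<lambda>i. t i \<circ> g) c - lin_comb d t c \<in> ord_ge 2"
        by (intro lin_comb_diff_ord_ge tg)
      ultimately have "(((f - lin_comb d t c) \<circ> g) - (f - lin_comb d t c)) +
          (lin_comb d (\<lambda>i. t i \<circ> g) c - lin_comb d t c) \<in> ord_ge 2"
        by (rule ord_ge_add)
      then show ?thesis
        by (rule ord_ge_near) (rule near_points, simp flip: lin_comb_comp)
    qed
    \<comment> \<open>Powers in the group are extensional functions, so they agree with iterates of
      \<open>g\<close> only on the points; this is why the iterates enter as a family
      \<open>\<tau>\<close>.\<close>
    define \<tau> where "\<tau> k = g [^]\<^bsub>?G\<^esub> k" for k :: nat
    have \<tau>H: "\<tau> k \<in> H" for k using G.nat_pow_closed[of g k] g by (simp add: \<tau>_def)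
    have \<tau>0: "\<tau> 0 z = z" if "z \<in> points X" for z using one[OF that] by (simp add: \<tau>_def)
    have \<tau>Suc: "\<tau> (Suc k) z = \<tau> k (g z)" if "z \<in> points X" for k z
      using mult[OF \<tau>H g that, of k] by (simp add: \<tau>_def)
    obtain r :: nat where r: "r > 0" "\<tau> r = \<one>\<^bsub>Aut X\<^esub>"
      using G.finite_order[of g] H(2) g by (auto simp: \<tau>_def)
    then have "\<tau> r z = z" if "z \<in> points X" for z using one[OF that] by simp
    then have "near (f \<circ> g) f" if "f \<in> ord_ge 0" for f
      using unipotent_finite_order_trivial[OF mor[OF g] fix_x[OF g] unip \<tau>0 \<tau>Suc _ char_0[OF r(1)] that] by blast
    from fixes_functions_imp_near_id[OF mor[OF g] fix_x[OF g] this]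
    show "g = \<one>\<^bsub>?G\<^esub>" using rigid[OF g] by auto
  qed
  then show ?thesis by blast
qed

end

section \<open>Rigidity of automorphisms of varieties\<close>

context variety
begin

lemma chart_at:
  assumes "x \<in> points X"
  obtains U n V \<phi> \<psi> where "pointed_chart X U n V \<phi> \<psi> x"
proof -
  obtain U where U: "affine_open X U" "x \<in> U" using finite_affine_cover assms by blast
  then obtain n V \<phi> where V: "openin (space_top X) U" "algebraic_set n V"
      "isomorphism (open_subspace X U) (affine_variety n V) \<phi>" unfolding affine_open_def by blast
  have pts: "points (open_subspace X U) = U"
    using openin_subset[OF V(1)] by (auto simp: open_subspace_def)
  obtain \<psi> where "morphism (open_subspace X U) (affine_variety n V) \<phi>"
      "morphism (affine_variety n V) (open_subspace X U) \<psi>" "\<forall>z \<in> U. \<psi> (\<phi> z) = z"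
    using V(3) unfolding isomorphism_def pts by blast
  then have "pointed_chart X U n V \<phi> \<psi> x" using V U by unfold_locales auto
  then show ?thesis by (rule that)
qed

text \<open>Locally \<open>f * q = p\<close> with \<open>q\<close> nowhere zero, so \<open>f\<close>
  vanishes exactly where \<open>p\<close> does. This is what makes preimages of the generators of
  \<open>zariski_product\<close> open.\<close>

lemma openin_nonzero:
  assumes W: "openin (space_top X) W" and f: "f \<in> regular X W"
  shows "openin (space_top X) {z \<in> W. f z \<noteq> 0}"
proof (subst openin_subopen, intro ballI)
  fix z assume z: "z \<in> {z \<in> W. f z \<noteq> 0}"
  then have "z \<in> points X" using openin_subset[OF W] by blast
  then obtain U n V \<phi> \<psi> where "pointed_chart X U n V \<phi> \<psi> z" by (rule chart_at)
  then interpret C: pointed_chart X U n V \<phi> \<psi> z .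
  from z have "z \<in> W" by blast
  from C.regular_local_fraction[OF W f this C.x_in_U] obtain p q W' where
    pq: "p \<in> poly_functions n" "q \<in> poly_functions n" and W': "openin (space_top X) W'" "z \<in> W'" "W' \<subseteq> W \<inter> U"
    "\<forall>z \<in> W'. q (\<phi> z) \<noteq> 0 \<and> f z * q (\<phi> z) = p (\<phi> z)" by (elim exE conjE)
  have nz: "f y \<noteq> 0 \<longleftrightarrow> p (\<phi> y) \<noteq> 0" if "y \<in> W'" for y
  proof -
    have "q (\<phi> y) \<noteq> 0" "f y * q (\<phi> y) = p (\<phi> y)" using W'(4) that by blast+
    then show ?thesis by (metis mult_eq_0_iff)
  qed
  let ?T = "W' \<inter> {y \<in> U. p (\<phi> y) \<noteq> 0}"
  have "openin (space_top X) ?T" by (intro openin_Int W' C.openin_chart_nonzero pq)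
  moreover have "z \<in> ?T" using W' C.x_in_U nz[OF W'(2)] z by simp
  moreover have "?T \<subseteq> {z \<in> W. f z \<noteq> 0}" using W'(3) nz by auto
  ultimately show "\<exists>T. openin (space_top X) T \<and> z \<in> T \<and> T \<subseteq> {z \<in> W. f z \<noteq> 0}" by blast
qed

text \<open>The fixed points are the preimage of the diagonal under
  \<open>z \<mapsto> (z, \<sigma> z)\<close>. As \<open>zariski_product\<close> is finer than the
  product topology, continuity has to be checked on its generators.\<close>

lemma closedin_fixed_points:
  assumes \<sigma>: "morphism X X \<sigma>"
  shows "closedin (space_top X) {z \<in> points X. \<sigma> z = z}"
proof -
  let ?\<Delta> = "{(x, x) | x. x \<in> points X}" and ?h = "\<lambda>z. (z, \<sigma> z)"
    and ?\<B> = "{{(x, y) \<in> U \<times> V. (\<Sum>i<m. f i x * g i y) \<noteq> 0} | U V f g (m::nat).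
        openin (space_top X) U \<and> openin (space_top X) V \<and>
        (\<forall>i<m. f i \<in> regular X U) \<and> (\<forall>i<m. g i \<in> regular X V)}"
  have cont: "continuous_map (space_top X) (space_top X) \<sigma>" using \<sigma> by (simp add: morphism_def)
  have maps: "\<sigma> z \<in> points X" if "z \<in> points X" for z
    using continuous_map_funspace[OF cont] that by auto
  have "continuous_map (space_top X) (zariski_product X X) ?h"
    unfolding zariski_product_def continuous_on_generated_topo_iff
  proof (intro conjI allI impI)
    fix D assume "D \<in> ?\<B>"
    then obtain U V f g and m :: nat where D: "D = {(x, y) \<in> U \<times> V. (\<Sum>i<m. f i x * g i y) \<noteq> 0}"
      and UV: "openin (space_top X) U" "openin (space_top X) V"
      and fg: "\<And>i. i < m \<Longrightarrow> f i \<in> regular X U" "\<And>i. i < m \<Longrightarrow> g i \<in> regular X V"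
      by auto
    let ?P = "{z \<in> points X. \<sigma> z \<in> V}"
    have P: "openin (space_top X) ?P" by (rule openin_continuous_map_preimage[OF cont UV(2)])
    let ?W = "U \<inter> ?P"
    have W: "openin (space_top X) ?W" by (rule openin_Int[OF UV(1) P])
    have reg: "(\<lambda>z. f i z * g i (\<sigma> z)) \<in> regular X ?W" if "i < m" for i
    proof (rule regular_mult[OF W])
      show "f i \<in> regular X ?W" by (rule regular_subset[OF UV(1) W _ fg(1)[OF that]]) blast
      have "g i \<circ> \<sigma> \<in> regular X ?P" using \<sigma> UV(2) fg(2)[OF that] by (auto simp: morphism_def)
      then have "g i \<circ> \<sigma> \<in> regular X ?W" using regular_subset[OF P W] by blast
      then show "(\<lambda>z. g i (\<sigma> z)) \<in> regular X ?W" by (simp add: comp_def)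
    qed
    have "(\<lambda>z. \<Sum>i<k. f i z * g i (\<sigma> z)) \<in> regular X ?W" if "k \<le> m" for k
      using that
    proof (induction k)
      case 0
      then show ?case using regular_const[OF W] by simp
    next
      case (Suc k)
      then show ?case using regular_add[OF W _ reg[of k]] by simp
    qed
    then have "openin (space_top X) {z \<in> ?W. (\<Sum>i<m. f i z * g i (\<sigma> z)) \<noteq> 0}"
      by (intro openin_nonzero W) simp
    moreover have "{z \<in> ?W. (\<Sum>i<m. f i z * g i (\<sigma> z)) \<noteq> 0} = ?h -` D \<inter> points X"
      using openin_subset[OF UV(1)] by (auto simp: D)
    ultimately show "openin (space_top X) (?h -` D \<inter> points X)" by simp
  next
    \<comment> \<open>The generators must also cover the image; the one with the single summand
      \<open>1 * 1\<close> on the whole space does.\<close>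
    let ?B = "{(x, y) \<in> points X \<times> points X. (\<Sum>i<1::nat. (\<lambda>_ _. 1) i x * (\<lambda>_ _. 1 :: 'k) i y) \<noteq> 0}"
    have "?h ` points X \<subseteq> ?B" using maps by auto
    moreover have "?B \<in> ?\<B>"
      by (rule CollectI, rule exI[of _ "points X"], rule exI[of _ "points X"], rule exI[of _ "\<lambda>_ _. 1"],
          rule exI[of _ "\<lambda>_ _. 1"], rule exI[of _ 1]) (simp add: regular_const)
    ultimately show "?h ` points X \<subseteq> \<Union>?\<B>"
      by (meson Union_upper order_trans)
  qed
  from closedin_continuous_map_preimage[OF this separated[unfolded separated_def]]
  have "closedin (space_top X) {z \<in> points X. ?h z \<in> ?\<Delta>}" .
  moreover have "{z \<in> points X. ?h z \<in> ?\<Delta>} = {z \<in> points X. \<sigma> z = z}" by auto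
  ultimately show ?thesis by simp
qed

text \<open>The fixed points and the complement of \<open>W\<close> are closed and cover the
  irreducible space, and the complement of \<open>W\<close> misses \<open>x\<close>.\<close>

lemma fixes_open_imp_id:
  assumes \<sigma>: "morphism X X \<sigma>" and W: "openin (space_top X) W" "x \<in> W" "\<forall>z \<in> W. \<sigma> z = z"
    and z: "z \<in> points X"
  shows "\<sigma> z = z"
proof -
  let ?F = "{z \<in> points X. \<sigma> z = z}"
  have "closedin (space_top X) (points X - W)" using W(1) by blast
  moreover have "closedin (space_top X) ?F" by (rule closedin_fixed_points[OF \<sigma>])
  moreover have "points X = ?F \<union> (points X - W)" using W by blast
  ultimately have "?F = points X \<or> points X - W = points X"
    using irreducible unfolding irreducible_space_def by metis
  moreover have "points X - W \<noteq> points X" using W(2) openin_subset[OF W(1)] by blast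
  ultimately show ?thesis using z by blast
qed

end

section \<open>Automorphisms preserve local rings\<close>

text \<open>As for the operations of \<open>local_ring\<close>, the union runs over representatives
  that all yield the same germ. The map goes from the local ring at \<open>\<sigma> x\<close> to the
  one at \<open>x\<close>.\<close>

definition germ_pullback ::
    "('a, 'k::field) fn_space \<Rightarrow> ('a \<Rightarrow> 'a) \<Rightarrow> 'a \<Rightarrow> ('a set \<times> ('a \<Rightarrow> 'k)) set \<Rightarrow> ('a set \<times> ('a \<Rightarrow> 'k)) set" where
  "germ_pullback X \<sigma> x A = (\<Union>(U, f) \<in> A. germ X x {z \<in> points X. \<sigma> z \<in> U} (f \<circ> \<sigma>))"

context space_with_functions
begin

context
  fixes \<sigma> :: "'a \<Rightarrow> 'a" and x
  assumes \<sigma>: "morphism X X \<sigma>" and x: "x \<in> points X"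
begin

lemma local_sections_pullback:
  assumes "(U, f) \<in> local_sections X (\<sigma> x)"
  shows "({z \<in> points X. \<sigma> z \<in> U}, f \<circ> \<sigma>) \<in> local_sections X x"
  using assms \<sigma> x unfolding local_sections_def morphism_def
  by (auto intro: openin_continuous_map_preimage)

lemma germ_pullback_germ:
  assumes s: "(U, f) \<in> local_sections X (\<sigma> x)"
  shows "germ_pullback X \<sigma> x (germ X (\<sigma> x) U f) = germ X x {z \<in> points X. \<sigma> z \<in> U} (f \<circ> \<sigma>)"
proof -
  have eq: "germ X x {z \<in> points X. \<sigma> z \<in> U'} (f' \<circ> \<sigma>) = germ X x {z \<in> points X. \<sigma> z \<in> U} (f \<circ> \<sigma>)"
    if "(U', f') \<in> germ X (\<sigma> x) U f" for U' f'
  proof -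
    from that obtain W where s': "(U', f') \<in> local_sections X (\<sigma> x)"
      and W: "openin (space_top X) W" "\<sigma> x \<in> W" "W \<subseteq> U \<inter> U'" "\<forall>y \<in> W. f y = f' y"
      unfolding germ_def germ_rel_def by auto
    have "openin (space_top X) {z \<in> points X. \<sigma> z \<in> W}"
      using \<sigma> W(1) by (auto simp: morphism_def intro: openin_continuous_map_preimage)
    then show ?thesis
      unfolding germ_eq_iff[OF local_sections_pullback[OF s'] local_sections_pullback[OF s]]
      using W x by (intro exI[of _ "{z \<in> points X. \<sigma> z \<in> W}"]) auto
  qed
  have "(U, f) \<in> germ X (\<sigma> x) U f"
    unfolding germ_def using equiv_class_self[OF germ_rel_equiv s] by simp
  then have "(\<Union>a \<in> germ X (\<sigma> x) U f. germ X x {z \<in> points X. \<sigma> z \<in> U} (f \<circ> \<sigma>))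
      = germ X x {z \<in> points X. \<sigma> z \<in> U} (f \<circ> \<sigma>)" by blast
  moreover have "germ_pullback X \<sigma> x (germ X (\<sigma> x) U f)
      = (\<Union>a \<in> germ X (\<sigma> x) U f. germ X x {z \<in> points X. \<sigma> z \<in> U} (f \<circ> \<sigma>))"
    unfolding germ_pullback_def by (intro SUP_cong refl) (auto simp: eq split: prod.splits)
  ultimately show ?thesis by simp
qed

lemma pullback_point: "\<sigma> x \<in> points X"
  using \<sigma> x by (auto simp: morphism_def continuous_map_def)

lemma germ_pullback_const: "germ_pullback X \<sigma> x (const_germ X (\<sigma> x) c) = const_germ X x c"
proof -
  note s = local_sections_const[OF pullback_point, of c]
  show ?thesis
    unfolding const_germ_def germ_pullback_germ[OF s]
    by (rule germ_eqI[OF local_sections_pullback[OF s] local_sections_const[OF x]]) simp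
qed

lemma germ_pullback_hom: "germ_pullback X \<sigma> x \<in> ring_hom (local_ring X (\<sigma> x)) (local_ring X x)"
proof (rule ring_hom_memI)
  fix A assume "A \<in> carrier (local_ring X (\<sigma> x))"
  then obtain U f where A: "(U, f) \<in> local_sections X (\<sigma> x)" "A = germ X (\<sigma> x) U f"
    by (rule carrier_local_ringE)
  show "germ_pullback X \<sigma> x A \<in> carrier (local_ring X x)"
    unfolding A(2) germ_pullback_germ[OF A(1)] by (rule germ_in_carrier[OF local_sections_pullback[OF A(1)]])
  fix B assume "B \<in> carrier (local_ring X (\<sigma> x))"
  then obtain V g where B: "(V, g) \<in> local_sections X (\<sigma> x)" "B = germ X (\<sigma> x) V g"
    by (rule carrier_local_ringE)
  note pA = local_sections_pullback[OF A(1)] and pB = local_sections_pullback[OF B(1)]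
  show "germ_pullback X \<sigma> x (A \<otimes>\<^bsub>local_ring X (\<sigma> x)\<^esub> B)
      = germ_pullback X \<sigma> x A \<otimes>\<^bsub>local_ring X x\<^esub> germ_pullback X \<sigma> x B"
    unfolding A(2) B(2) germ_mult[OF A(1) B(1)] germ_pullback_germ[OF local_sections_mult[OF A(1) B(1)]]
      germ_pullback_germ[OF A(1)] germ_pullback_germ[OF B(1)] germ_mult[OF pA pB]
    by (rule germ_eqI[OF local_sections_pullback[OF local_sections_mult[OF A(1) B(1)]] local_sections_mult[OF pA pB]]) simp
  show "germ_pullback X \<sigma> x (A \<oplus>\<^bsub>local_ring X (\<sigma> x)\<^esub> B)
      = germ_pullback X \<sigma> x A \<oplus>\<^bsub>local_ring X x\<^esub> germ_pullback X \<sigma> x B"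
    unfolding A(2) B(2) germ_add[OF A(1) B(1)] germ_pullback_germ[OF local_sections_add[OF A(1) B(1)]]
      germ_pullback_germ[OF A(1)] germ_pullback_germ[OF B(1)] germ_add[OF pA pB]
    by (rule germ_eqI[OF local_sections_pullback[OF local_sections_add[OF A(1) B(1)]] local_sections_add[OF pA pB]]) simp
next
  show "germ_pullback X \<sigma> x \<one>\<^bsub>local_ring X (\<sigma> x)\<^esub> = \<one>\<^bsub>local_ring X x\<^esub>"
    using germ_pullback_const[of 1] by (simp add: local_ring_def)
qed

end

lemma germ_pullback_inverse:
  assumes \<sigma>: "morphism X X \<sigma>" and \<tau>: "morphism X X \<tau>" and inv: "\<And>z. z \<in> points X \<Longrightarrow> \<sigma> (\<tau> z) = z"
    and y: "y \<in> points X" and A: "A \<in> carrier (local_ring X y)"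
  shows "germ_pullback X \<tau> y (germ_pullback X \<sigma> (\<tau> y) A) = A"
proof -
  obtain U f where U: "(U, f) \<in> local_sections X y" "A = germ X y U f" using A by (rule carrier_local_ringE)
  have \<tau>y: "\<tau> y \<in> points X" by (rule pullback_point[OF \<tau> y])
  have s: "(U, f) \<in> local_sections X (\<sigma> (\<tau> y))" using U(1) inv[OF y] by simp
  note s' = local_sections_pullback[OF \<sigma> \<tau>y s]
  have "germ_pullback X \<tau> y (germ_pullback X \<sigma> (\<tau> y) A)
      = germ X y {z \<in> points X. \<tau> z \<in> {z \<in> points X. \<sigma> z \<in> U}} (f \<circ> \<sigma> \<circ> \<tau>)"
    unfolding U(2) germ_pullback_germ[OF \<sigma> \<tau>y s, unfolded inv[OF y]] germ_pullback_germ[OF \<tau> y s'] ..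
  also have "\<dots> = A"
    unfolding U(2)
    by (rule germ_eqI[OF local_sections_pullback[OF \<tau> y s'] U(1)]) (use inv in auto)
  finally show ?thesis .
qed

text \<open>Pullbacks along \<open>\<sigma>\<close> and along its inverse are mutually inverse ring
  homomorphisms that respect constants. They relate \<open>\<sigma> x\<close> to \<open>x\<close>,
  and symmetry turns the pair round.\<close>

lemma isomorphism_same_local_ring:
  assumes "isomorphism X X \<sigma>" and x: "x \<in> points X"
  shows "(x, \<sigma> x) \<in> same_local_ring X"
proof -
  obtain \<tau> where \<sigma>: "morphism X X \<sigma>" and \<tau>: "morphism X X \<tau>"
    and inv: "\<And>z. z \<in> points X \<Longrightarrow> \<tau> (\<sigma> z) = z" "\<And>z. z \<in> points X \<Longrightarrow> \<sigma> (\<tau> z) = z"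
    using assms(1) by (auto simp: isomorphism_def)
  have y: "\<sigma> x \<in> points X" by (rule pullback_point[OF \<sigma> x])
  let ?R = "local_ring X (\<sigma> x)" and ?S = "local_ring X x"
  let ?f = "germ_pullback X \<sigma> x" and ?g = "germ_pullback X \<tau> (\<sigma> x)"
  have f: "?f \<in> ring_hom ?R ?S" by (rule germ_pullback_hom[OF \<sigma> x])
  have g: "?g \<in> ring_hom ?S ?R" using germ_pullback_hom[OF \<tau> y] inv(1)[OF x] by simp
  have "bij_betw ?f (carrier ?R) (carrier ?S)"
  proof (rule bij_betw_byWitness[of _ ?g])
    show "\<forall>A \<in> carrier ?R. ?g (?f A) = A"
      using germ_pullback_inverse[OF \<sigma> \<tau> inv(2) y] inv(1)[OF x] by simp
    show "\<forall>A \<in> carrier ?S. ?f (?g A) = A"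
      using germ_pullback_inverse[OF \<tau> \<sigma> inv(1) x] by simp
    show "?f ` carrier ?R \<subseteq> carrier ?S" using ring_hom_closed[OF f] by blast
    show "?g ` carrier ?S \<subseteq> carrier ?R" using ring_hom_closed[OF g] by blast
  qed
  then have "?f \<in> ring_iso ?R ?S" using f by (simp add: ring_iso_def)
  then have "local_rings_k_isomorphic X (\<sigma> x) x"
    unfolding local_rings_k_isomorphic_def using germ_pullback_const[OF \<sigma> x] by blast
  then have "(\<sigma> x, x) \<in> same_local_ring X" using x y by (simp add: same_local_ring_def)
  then show ?thesis using equiv_same_local_ring by (meson equivE symD)
qed

end

section \<open>Finite groups of automorphisms\<close>

text \<open>Left multiplication by the inverse of \<open>s\<close> carries the elements that send
  \<open>x\<close> to \<open>act s x\<close> injectively into the stabilizer. The laws are asked at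
  \<open>x\<close> only, because extensional functions compose like maps only on the points.\<close>

lemma card_le_orbit_stabilizer:
  assumes G: "group G" and fin: "finite (carrier G)" "finite C"
    and act: "\<And>g h. g \<in> carrier G \<Longrightarrow> h \<in> carrier G \<Longrightarrow> act (g \<otimes>\<^bsub>G\<^esub> h) x = act g (act h x)"
    and orbit: "\<And>g. g \<in> carrier G \<Longrightarrow> act g x \<in> C"
    and inj: "\<And>g h. g \<in> carrier G \<Longrightarrow> h \<in> carrier G \<Longrightarrow> act g (act h x) = act g x \<Longrightarrow> act h x = x"
  shows "card (carrier G) \<le> card C * card {g \<in> carrier G. act g x = x}"
proof -
  interpret group G by (rule G)
  let ?H = "{g \<in> carrier G. act g x = x}"
  have fibre: "card {g \<in> carrier G. act g x = y} \<le> card ?H" for y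
  proof (cases "\<exists>s \<in> carrier G. act s x = y")
    case True
    then obtain s where s: "s \<in> carrier G" "act s x = y" by blast
    show ?thesis
    proof (rule card_inj_on_le)
      show "inj_on (\<lambda>g. inv\<^bsub>G\<^esub> s \<otimes>\<^bsub>G\<^esub> g) {g \<in> carrier G. act g x = y}"
        using s by (auto intro!: inj_onI)
      show "(\<lambda>g. inv\<^bsub>G\<^esub> s \<otimes>\<^bsub>G\<^esub> g) ` {g \<in> carrier G. act g x = y} \<subseteq> ?H"
      proof
        fix h assume "h \<in> (\<lambda>g. inv\<^bsub>G\<^esub> s \<otimes>\<^bsub>G\<^esub> g) ` {g \<in> carrier G. act g x = y}"
        then obtain g where g: "g \<in> carrier G" "act g x = y" "h = inv\<^bsub>G\<^esub> s \<otimes>\<^bsub>G\<^esub> g" by blast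
        have h: "h \<in> carrier G" using g s by simp
        have "s \<otimes>\<^bsub>G\<^esub> h = g" using g s by (simp flip: m_assoc)
        then have "act s (act h x) = act s x" using act[OF s(1) h] g s by simp
        then show "h \<in> ?H" using inj[OF s(1) h] h by simp
      qed
      show "finite ?H" using fin by simp
    qed
  next
    case False
    then have "{g \<in> carrier G. act g x = y} = {}" by blast
    then show ?thesis by (metis card.empty le0)
  qed
  have "carrier G = (\<Union>y\<in>C. {g \<in> carrier G. act g x = y})" using orbit by blast
  then have "card (carrier G) \<le> (\<Sum>y\<in>C. card {g \<in> carrier G. act g x = y})"
    using card_UN_le[OF fin(2), of "\<lambda>y. {g \<in> carrier G. act g x = y}"] by simp
  also have "\<dots> \<le> card C * card ?H" using sum_bounded_above[of C _ "card ?H", OF fibre] by simp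
  finally show ?thesis .
qed

theorem theorem2p19:
  fixes X :: "('a, 'k::{alg_closed_field, field_char_0}) fn_space"
  assumes "variety X"
    and "\<exists>C \<in> points X // same_local_ring X. finite C"
  shows "jordan_group (Aut X)"
proof -
  interpret variety X by (rule assms(1))
  let ?G = "Aut X"
  interpret G: group ?G by (rule group_Aut)
  obtain C where C: "C \<in> points X // same_local_ring X" "finite C" using assms(2) by blast
  obtain x where xC: "x \<in> C" using in_quotient_imp_non_empty[OF equiv_same_local_ring C(1)] by blast
  then have x: "x \<in> points X" using in_quotient_imp_subset[OF equiv_same_local_ring C(1)] by blast
  obtain U n V \<phi> \<psi> where "pointed_chart X U n V \<phi> \<psi> x" using chart_at[OF x] .
  then interpret P: pointed_chart X U n V \<phi> \<psi> x .
  obtain d t where basis: "P.cotangent_basis d t" using P.cotangent_basis_exists by blast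
  \<comment> \<open>\<open>d\<close> and \<open>card C\<close> depend on \<open>X\<close> and on the
    choice of \<open>C\<close>, \<open>x\<close> and the basis, but on no subgroup, so a single
    \<open>J\<close> serves all finite subgroups.\<close>
  obtain J :: nat where J: "J > 0" and Jordan: "\<And>(G :: ('a \<Rightarrow> 'a) monoid) H (\<rho> :: _ \<Rightarrow> nat \<Rightarrow> nat \<Rightarrow> 'k).
      group G \<Longrightarrow> finite (carrier G) \<Longrightarrow> subgroup H G \<Longrightarrow> card (carrier G) \<le> card C * card H \<Longrightarrow>
      faithful_rep (G\<lparr>carrier := H\<rparr>) d \<rho> \<Longrightarrow>
      \<exists>A. A \<lhd> G \<and> comm_group (G\<lparr>carrier := A\<rparr>) \<and> card (rcosets\<^bsub>G\<^esub> A) \<le> J"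
    using Jordan_virtually_linear[of "card C" d, where ?'g = "'a \<Rightarrow> 'a" and ?'z = unit and ?'k = 'k] by (elim exE conjE) meson
  have Aut: "g \<in> Bij (points X)" "isomorphism X X g" "morphism X X g" if "g \<in> carrier ?G" for g
    using that by (auto simp: Aut_def isomorphism_def)
  have maps: "g z \<in> points X" if "g \<in> carrier ?G" "z \<in> points X" for g z
    using Aut(1)[OF that(1)] that(2) by (auto simp: Bij_def bij_betw_def)
  have mult: "(g \<otimes>\<^bsub>?G\<^esub> h) z = g (h z)" if "g \<in> carrier ?G" "h \<in> carrier ?G" "z \<in> points X" for g h z
    using Aut(1)[OF that(1)] Aut(1)[OF that(2)] that(3) by (simp add: Aut_def BijGroup_def compose_def)
  have one: "\<one>\<^bsub>?G\<^esub> = (\<lambda>z \<in> points X. z)" by (simp add: Aut_def BijGroup_def)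
  have "\<exists>A. A \<lhd> ?G\<lparr>carrier := K\<rparr> \<and> comm_group (?G\<lparr>carrier := A\<rparr>) \<and>
      card (rcosets\<^bsub>?G\<lparr>carrier := K\<rparr>\<^esub> A) \<le> J" if K: "subgroup K ?G" "finite K" for K
  proof -
    let ?K = "?G\<lparr>carrier := K\<rparr>" and ?H = "{g \<in> K. g x = x}"
    interpret K: group ?K using G.subgroup_imp_group[OF K(1)] .
    have KG: "g \<in> carrier ?G" if "g \<in> K" for g using subgroup.mem_carrier[OF K(1) that] .
    have inj: "z = w" if "g \<in> K" "z \<in> points X" "w \<in> points X" "g z = g w" for g z w
      using Aut(1)[OF KG[OF that(1)]] that by (auto simp: Bij_def bij_betw_def inj_on_def)
    have H: "subgroup ?H ?G"
    proof (rule G.subgroupI)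
      show "?H \<subseteq> carrier ?G" using KG by blast
      show "?H \<noteq> {}" using subgroup.one_closed[OF K(1)] one x by auto
      show "g \<otimes>\<^bsub>?G\<^esub> h \<in> ?H" if "g \<in> ?H" "h \<in> ?H" for g h
        using that mult[OF KG KG x, of g h] subgroup.m_closed[OF K(1)] by auto
      fix g assume g: "g \<in> ?H"
      then have gi: "inv\<^bsub>?G\<^esub> g \<in> K" using subgroup.m_inv_closed[OF K(1)] by blast
      have "g ((inv\<^bsub>?G\<^esub> g) x) = g x"
        using mult[OF KG KG[OF gi] x, of g] g KG[of g] one x by simp
      then have "(inv\<^bsub>?G\<^esub> g) x = x" using inj[of g "(inv\<^bsub>?G\<^esub> g) x" x] g maps[OF KG[OF gi] x] x by blast
      then show "inv\<^bsub>?G\<^esub> g \<in> ?H" using gi by blast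
    qed
    have "\<exists>\<rho> :: _ \<Rightarrow> nat \<Rightarrow> nat \<Rightarrow> 'k. faithful_rep (?G\<lparr>carrier := ?H\<rparr>) d \<rho>"
    proof (rule P.cotangent_rep[OF H _ _ _ _ basis])
      show "finite ?H" using K(2) by simp
      show "g x = x" if "g \<in> ?H" for g using that by simp
      show "(of_nat r :: 'k) \<noteq> 0" if "r > 0" for r using that by simp
      fix g W assume g: "g \<in> ?H" and W: "openin (space_top X) W" "x \<in> W" "\<forall>z \<in> W. g z = z"
      have gG: "g \<in> carrier ?G" using g KG by blast
      have "g z = z" if "z \<in> points X" for z
        by (rule fixes_open_imp_id[OF Aut(3)[OF gG] W that])
      \<comment> \<open>Elements of \<open>Aut X\<close> are extensional, so agreement with the
        identity on the points is equality in the group.\<close>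
      moreover have "g \<in> extensional (points X)" using Aut(1)[OF gG] by (simp add: Bij_def)
      ultimately show "g = \<one>\<^bsub>?G\<^esub>" unfolding one by (intro extensionalityI[of _ "points X"]) auto
    qed
    then obtain \<rho> :: "_ \<Rightarrow> nat \<Rightarrow> nat \<Rightarrow> 'k" where \<rho>: "faithful_rep (?G\<lparr>carrier := ?H\<rparr>) d \<rho>" by blast
    have "g x \<in> C" if "g \<in> K" for g
      using in_quotient_imp_closed[OF equiv_same_local_ring C(1) xC]
        isomorphism_same_local_ring[OF Aut(2)[OF KG[OF that]] x] by blast
    then have card: "card (carrier ?K) \<le> card C * card {g \<in> carrier ?K. g x = x}"
      using K(2) C(2) mult[OF KG KG x] inj x maps[OF KG x]
      by (intro card_le_orbit_stabilizer[where act = "\<lambda>g. g", OF K.is_group]) auto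
    have "\<exists>A. A \<lhd> ?K \<and> comm_group (?K\<lparr>carrier := A\<rparr>) \<and> card (rcosets\<^bsub>?K\<^esub> A) \<le> J"
    proof (rule Jordan[OF K.is_group])
      show "finite (carrier ?K)" using K(2) by simp
      show "subgroup ?H ?K" by (rule G.subgroup_incl[OF H K(1)]) blast
      show "card (carrier ?K) \<le> card C * card ?H" using card by simp
      show "faithful_rep (?K\<lparr>carrier := ?H\<rparr>) d \<rho>" using \<rho> by simp
    qed
    then show ?thesis by simp
  qed
  then show ?thesis unfolding jordan_group_def using G.is_group J by blast
qed

end
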